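(* Consider the episodic discounted MDP and the PAGE-PG method with the GPOMDP estimator described in the context, and suppose Assumptions (A1)–(A4) hold. Let $\eta>0$, $p\in(0,1]$, batch sizes $N,B\in\mathbb{N}$, and suppose $$\eta^2\leq \min\left\{\frac{p}{1-p}\cdot\frac{B}{2C},\ \frac{1}{4L^2}\right\}$$ (with the first term read as $+\infty$ when $p=1$). Then for every $T\geq 1$ the iterates $\theta_0,\dots,\theta_{T-1}$ of PAGE-PG satisfy $$\frac{1}{T}\sum_{t=0}^{T-1}\mathbb{E}\left[\Vert\nabla_\theta V(\theta_t)\Vert^2\right]\leq \frac{2\left(V^*-V(\theta_0)\right)}{\eta T}+\frac{\sigma^2}{N}+\frac{\sigma^2}{pNT},$$ where the expectation is over all randomness of the algorithm (sampled trajectories and probabilistic switches).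
   Context: MDP: state space $\mathcal{S}$, action space $\mathcal{A}$, transition density $P(s'|s,a)$, reward $r:\mathcal{S}\times\mathcal{A}\to[-R,R]$ with $R>0$, discount $\gamma\in(0,1)$, initial distribution $\rho$, horizon $H<\infty$. A stochastic policy $\pi_\theta(\cdot|s)$ is parametrized by $\theta\in\mathbb{R}^d$, differentiable in $\theta$. A trajectory $\tau=\{s_h,a_h\}_{h=0}^{H-1}$ has $s_0\sim\rho$, $a_h\sim\pi_\theta(\cdot|s_h)$, $s_{h+1}\sim P(\cdot|s_h,a_h)$; its law is $p(\tau|\theta)$. $V(\theta)=\mathbb{E}_{\tau\sim p(\cdot|\theta)}[\sum_{h=0}^{H-1}\gamma^h r(s_h,a_h)]$ and $V^*=\sup_\theta V(\theta)$. GPOMDP estimator: $g(\tau|\theta)=\sum_{h=0}^{H-1}\gamma^h r(s_h,a_h)Z_{\theta,h}$ with $Z_{\theta,h}=\sum_{z=0}^h\nabla_\theta\log\pi_\theta(a_z|s_z)$. Off-policy estimator, for $\tau$ generated with policy $\theta_2$: $g^{\omega_{\theta_2}}(\tau|\theta_1)=\sum_{h=0}^{H-1}\omega_{0:h}(\tau|\theta_2,\theta_1)\gamma^h r(s_h,a_h)Z_{\theta_1,h}$, where $\omega_{0:h}(\tau|\theta_2,\theta_1)=\prod_{j=0}^h\frac{\pi_{\theta_1}(a_j|s_j)}{\pi_{\theta_2}(a_j|s_j)}$ (policies are assumed to give positive probability to every action so these are well defined). PAGE-PG: given $\theta_0$, step size $\eta>0$, probability $p\in(0,1]$, batch sizes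 $N,B$: sample $N$ independent trajectories from $p(\cdot|\theta_0)$ and set $v_0=\frac1N\sum_{i=1}^N g(\tau_i|\theta_0)$. For $t=0,1,\dots$: set $\theta_{t+1}=\theta_t+\eta v_t$; then, independently with probability $p$, sample $N$ fresh trajectories $\tau_i\sim p(\cdot|\theta_{t+1})$ and set $v_{t+1}=\frac1N\sum_{i=1}^N g(\tau_i|\theta_{t+1})$; otherwise (probability $1-p$) sample $B$ fresh trajectories $\tau_i\sim p(\cdot|\theta_{t+1})$ and set $v_{t+1}=\frac1B\sum_{i=1}^B g(\tau_i|\theta_{t+1})+v_t-\frac1B\sum_{i=1}^B g^{\omega_{\theta_{t+1}}}(\tau_i|\theta_t)$. Assumptions: (A1) there is $G>0$ with $\Vert\nabla_\theta\log\pi_\theta(a|s)\Vert\le G$ for all $a,s,\theta$. (A2) $\pi_\theta$ is twice differentiable and there is $M>0$ with $\Vert\nabla^2_\theta\log\pi_\theta(a|s)\Vert\le M$ for all $a,s,\theta$. (A3) there is $\sigma>0$ with $\mathrm{Var}(g(\tau|\theta))=\mathbb{E}_{\tau\sim p(\cdot|\theta)}\Vert g(\tau|\theta)-\nabla_\theta V(\theta)\Vert^2\le\sigma^2$ for all $\theta$. (A4) for all $\theta_a,\theta_b$ and $\tau\sim p(\cdot|\theta_b)$, the importance weight $\omega(\tau|\theta_b,\theta_a)=p(\tau|\theta_a)/p(\tau|\theta_b)$ is well defined and there is $W>0$ with $\mathrm{Var}(\omega(\tau|\theta_b,\theta_a))\le W$. Constants: $L=\frac{MR}{(1-\gamma)^2}+\frac{2G^2R}{(1-\gamma)^3}$,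 $C_\omega=\frac{24RG^2(2G^2+M)(W+1)\gamma}{(1-\gamma)^5}$, $C=2(L^2+C_\omega)$. *)

theory Defs
  imports "HOL-Probability.Probability"
begin

text \<open>Trajectories: tau :: nat => 's * 'a, with tau h = (s_h, a_h) for h < H.
  Parameters: S, A base measures on states/actions; rho initial density (w.r.t. S);
  P s a s' transition density (w.r.t. S); r reward; gm discount; H horizon;
  pol th s a policy density (w.r.t. A).\<close>

definition grad :: "('d::euclidean_space \<Rightarrow> real) \<Rightarrow> 'd \<Rightarrow> 'd" where
  "grad f x = (\<Sum>b\<in>Basis. frechet_derivative f (at x) b *\<^sub>R b)"

definition hess_norm :: "('d::euclidean_space \<Rightarrow> real) \<Rightarrow> 'd \<Rightarrow> real" where
  "hess_norm f x = onorm (frechet_derivative (grad f) (at x))"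

definition traj_dens ::
  "('s \<Rightarrow> real) \<Rightarrow> ('s \<Rightarrow> 'a \<Rightarrow> 's \<Rightarrow> real) \<Rightarrow> nat \<Rightarrow> ('d \<Rightarrow> 's \<Rightarrow> 'a \<Rightarrow> real)
    \<Rightarrow> 'd \<Rightarrow> (nat \<Rightarrow> 's \<times> 'a) \<Rightarrow> real" where
  "traj_dens rho P H pol th tau =
     rho (fst (tau 0)) * (\<Prod>h<H. pol th (fst (tau h)) (snd (tau h)))
     * (\<Prod>h<H - 1. P (fst (tau h)) (snd (tau h)) (fst (tau (Suc h))))"

definition traj ::
  "'s measure \<Rightarrow> 'a measure \<Rightarrow> ('s \<Rightarrow> real) \<Rightarrow> ('s \<Rightarrow> 'a \<Rightarrow> 's \<Rightarrow> real) \<Rightarrow> nat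
    \<Rightarrow> ('d \<Rightarrow> 's \<Rightarrow> 'a \<Rightarrow> real) \<Rightarrow> 'd \<Rightarrow> (nat \<Rightarrow> 's \<times> 'a) measure" where
  "traj S A rho P H pol th =
     density (PiM {..<H} (\<lambda>_. S \<Otimes>\<^sub>M A)) (\<lambda>tau. ennreal (traj_dens rho P H pol th tau))"

definition disc_return ::
  "('s \<Rightarrow> 'a \<Rightarrow> real) \<Rightarrow> real \<Rightarrow> nat \<Rightarrow> (nat \<Rightarrow> 's \<times> 'a) \<Rightarrow> real" where
  "disc_return r gm H tau = (\<Sum>h<H. gm ^ h * r (fst (tau h)) (snd (tau h)))"

definition Vf ::
  "'s measure \<Rightarrow> 'a measure \<Rightarrow> ('s \<Rightarrow> real) \<Rightarrow> ('s \<Rightarrow> 'a \<Rightarrow> 's \<Rightarrow> real)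
    \<Rightarrow> ('s \<Rightarrow> 'a \<Rightarrow> real) \<Rightarrow> real \<Rightarrow> nat \<Rightarrow> ('d \<Rightarrow> 's \<Rightarrow> 'a \<Rightarrow> real) \<Rightarrow> 'd \<Rightarrow> real" where
  "Vf S A rho P r gm H pol th = (\<integral>tau. disc_return r gm H tau \<partial>traj S A rho P H pol th)"

definition score :: "('d::euclidean_space \<Rightarrow> 's \<Rightarrow> 'a \<Rightarrow> real) \<Rightarrow> 'd \<Rightarrow> 's \<Rightarrow> 'a \<Rightarrow> 'd" where
  "score pol th s a = grad (\<lambda>th'. ln (pol th' s a)) th"

definition Zsum :: "('d::euclidean_space \<Rightarrow> 's \<Rightarrow> 'a \<Rightarrow> real) \<Rightarrow> 'd \<Rightarrow> nat \<Rightarrow> (nat \<Rightarrow> 's \<times> 'a) \<Rightarrow> 'd" where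
  "Zsum pol th h tau = (\<Sum>z\<le>h. score pol th (fst (tau z)) (snd (tau z)))"

definition gpomdp ::
  "('s \<Rightarrow> 'a \<Rightarrow> real) \<Rightarrow> real \<Rightarrow> nat \<Rightarrow> ('d::euclidean_space \<Rightarrow> 's \<Rightarrow> 'a \<Rightarrow> real)
    \<Rightarrow> 'd \<Rightarrow> (nat \<Rightarrow> 's \<times> 'a) \<Rightarrow> 'd" where
  "gpomdp r gm H pol th tau =
     (\<Sum>h<H. (gm ^ h * r (fst (tau h)) (snd (tau h))) *\<^sub>R Zsum pol th h tau)"

definition iw_prefix ::
  "('d \<Rightarrow> 's \<Rightarrow> 'a \<Rightarrow> real) \<Rightarrow> 'd \<Rightarrow> 'd \<Rightarrow> nat \<Rightarrow> (nat \<Rightarrow> 's \<times> 'a) \<Rightarrow> real" where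
  "iw_prefix pol th2 th1 h tau =
     (\<Prod>j\<le>h. pol th1 (fst (tau j)) (snd (tau j)) / pol th2 (fst (tau j)) (snd (tau j)))"

text \<open>Off-policy estimator g^{omega_{th2}}(tau | th1), tau generated with th2.\<close>
definition gpomdp_off ::
  "('s \<Rightarrow> 'a \<Rightarrow> real) \<Rightarrow> real \<Rightarrow> nat \<Rightarrow> ('d::euclidean_space \<Rightarrow> 's \<Rightarrow> 'a \<Rightarrow> real)
    \<Rightarrow> 'd \<Rightarrow> 'd \<Rightarrow> (nat \<Rightarrow> 's \<times> 'a) \<Rightarrow> 'd" where
  "gpomdp_off r gm H pol th2 th1 tau =
     (\<Sum>h<H. (iw_prefix pol th2 th1 h tau * gm ^ h * r (fst (tau h)) (snd (tau h)))
              *\<^sub>R Zsum pol th1 h tau)"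

definition traj_iw ::
  "('s \<Rightarrow> real) \<Rightarrow> ('s \<Rightarrow> 'a \<Rightarrow> 's \<Rightarrow> real) \<Rightarrow> nat \<Rightarrow> ('d \<Rightarrow> 's \<Rightarrow> 'a \<Rightarrow> real)
    \<Rightarrow> 'd \<Rightarrow> 'd \<Rightarrow> (nat \<Rightarrow> 's \<times> 'a) \<Rightarrow> real" where
  "traj_iw rho P H pol thb tha tau = traj_dens rho P H pol tha tau / traj_dens rho P H pol thb tau"

definition page_init ::
  "'s measure \<Rightarrow> 'a measure \<Rightarrow> ('s \<Rightarrow> real) \<Rightarrow> ('s \<Rightarrow> 'a \<Rightarrow> 's \<Rightarrow> real)
    \<Rightarrow> ('s \<Rightarrow> 'a \<Rightarrow> real) \<Rightarrow> real \<Rightarrow> nat \<Rightarrow> ('d::euclidean_space \<Rightarrow> 's \<Rightarrow> 'a \<Rightarrow> real)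
    \<Rightarrow> nat \<Rightarrow> 'd \<Rightarrow> ('d \<times> 'd) measure" where
  "page_init S A rho P r gm H pol N th0 =
     distr (PiM {..<N} (\<lambda>_. traj S A rho P H pol th0)) borel
       (\<lambda>taus. (th0, (1 / real N) *\<^sub>R (\<Sum>i<N. gpomdp r gm H pol th0 (taus i))))"

text \<open>One PAGE-PG iteration as a Markov kernel on the state (theta_t, v_t):
  theta_{t+1} = theta_t + eta v_t, then the probabilistic switch and fresh sampling.\<close>
definition page_step ::
  "'s measure \<Rightarrow> 'a measure \<Rightarrow> ('s \<Rightarrow> real) \<Rightarrow> ('s \<Rightarrow> 'a \<Rightarrow> 's \<Rightarrow> real)
    \<Rightarrow> ('s \<Rightarrow> 'a \<Rightarrow> real) \<Rightarrow> real \<Rightarrow> nat \<Rightarrow> ('d::euclidean_space \<Rightarrow> 's \<Rightarrow> 'a \<Rightarrow> real)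
    \<Rightarrow> real \<Rightarrow> real \<Rightarrow> nat \<Rightarrow> nat \<Rightarrow> 'd \<times> 'd \<Rightarrow> ('d \<times> 'd) measure" where
  "page_step S A rho P r gm H pol eta p N B st =
     (let th = fst st; v = snd st; th' = th + eta *\<^sub>R v in
      measure_pmf (bernoulli_pmf p) \<bind> (\<lambda>b.
        if b then
          distr (PiM {..<N} (\<lambda>_. traj S A rho P H pol th')) borel
            (\<lambda>taus. (th', (1 / real N) *\<^sub>R (\<Sum>i<N. gpomdp r gm H pol th' (taus i))))
        else
          distr (PiM {..<B} (\<lambda>_. traj S A rho P H pol th')) borel
            (\<lambda>taus. (th', (1 / real B) *\<^sub>R (\<Sum>i<B. gpomdp r gm H pol th' (taus i)) + v
                        - (1 / real B) *\<^sub>R (\<Sum>i<B. gpomdp_off r gm H pol th' th (taus i))))))"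

definition page_law ::
  "'s measure \<Rightarrow> 'a measure \<Rightarrow> ('s \<Rightarrow> real) \<Rightarrow> ('s \<Rightarrow> 'a \<Rightarrow> 's \<Rightarrow> real)
    \<Rightarrow> ('s \<Rightarrow> 'a \<Rightarrow> real) \<Rightarrow> real \<Rightarrow> nat \<Rightarrow> ('d::euclidean_space \<Rightarrow> 's \<Rightarrow> 'a \<Rightarrow> real)
    \<Rightarrow> real \<Rightarrow> real \<Rightarrow> nat \<Rightarrow> nat \<Rightarrow> 'd \<Rightarrow> nat \<Rightarrow> ('d \<times> 'd) measure" where
  "page_law S A rho P r gm H pol eta p N B th0 t =
     ((\<lambda>mu. mu \<bind> page_step S A rho P r gm H pol eta p N B) ^^ t)
       (page_init S A rho P r gm H pol N th0)"

end

theory Submission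
  imports Defs
begin

text \<open>
  Let \<open>e\<^sub>t = v\<^sub>t - \<nabla>V(\<theta>\<^sub>t)\<close>. The usual analysis uses the potential
  \<open>V\<^sup>* - V(\<theta>) + \<eta>/(2p) |e|\<^sup>2\<close> and needs the correction
  \<open>D = g(\<tau>|\<theta>\<^sub>t\<^sub>+\<^sub>1) - g\<^sup>\<omega>(\<tau>|\<theta>\<^sub>t)\<close> to satisfy \<open>E |D|\<^sup>2 \<le> C |\<theta>\<^sub>t\<^sub>+\<^sub>1 - \<theta>\<^sub>t|\<^sup>2\<close>.
  With the stated \<open>C\<close> this need not hold for large steps, because \<open>C\<^sub>\<omega>\<close> scales linearly in \<open>R\<close> and vanishes
  with \<open>\<gamma>\<close>. It holds, even with \<open>2 L\<^sup>2\<close> in place of \<open>C\<close>, as long as \<open>G |\<theta>\<^sub>t\<^sub>+\<^sub>1 - \<theta>\<^sub>t|\<close> is at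
  most \<open>(41/32) (1 - \<gamma>)\<close>: the step ratios then have conditional mean 1 and bounded logarithm, which
  controls the second moments of the importance weights. We therefore truncate \<open>|e|\<^sup>2\<close> in the potential
  at a level \<open>Q\<close>. Where \<open>|e|\<^sup>2 < Q\<close> the step is that small and the usual argument applies; where
  \<open>|e|\<^sup>2 \<ge> Q\<close> the potential decreases enough because \<open>V\<close> and its gradient are bounded. The truncation
  also makes every integrand bounded.
\<close>

section \<open>Elementary estimates\<close>

text \<open>The factor \<open>1 - gm\<close> in the step bound comes from the horizon. With
  \<open>x = G * norm (th' - th)\<close>, the second moment of a weight over \<open>n\<close> steps
  is bounded by \<open>q ^ n\<close> for \<open>q = exp x + exp (- x) - 1\<close>, and discounting
  absorbs this growth uniformly in \<open>H\<close> only if \<open>gm * q < 1\<close>. The number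
  41/32 = 1/4 + 33/32 is what the condition on \<open>eta\<close> delivers:
  \<open>eta * L \<le> 1/2\<close> bounds \<open>eta * G^2 * R\<close> by
  \<open>(1 - gm)^3 / 4\<close>, and then, after scaling by \<open>G * eta\<close> and in multiples
  of \<open>1 - gm\<close>, the true gradient contributes at most 1/4 and an error of size
  \<open>sqrt Q\<close> at most 33/32. Differentiability of \<open>V\<close> is not a hypothesis and
  nothing is differentiated under an integral sign. Instead \<open>V\<close> at a nearby parameter
  is written as an expectation under the current law and expanded through the logarithm of the
  weight. What is left beyond the logarithm has as its mean a divergence that grows linearly in the
  number of steps, not exponentially. This gives at once the policy gradient formula and the ascent
  inequality with \<open>L / 2\<close>.\<close>

lemma exp_le_taylor6:
  fixes y :: real
  assumes "\<bar>y\<bar> \<le> 41/32"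
  shows "exp y \<le> 1 + y + y\<^sup>2/2 + y^3/6 + y^4/24 + y^5/120 + y^6/90"
proof -
  obtain t where t: "\<bar>t\<bar> \<le> \<bar>y\<bar>" and e: "exp y = (\<Sum>m<6. y ^ m / fact m) + exp t / fact 6 * y ^ 6"
    using Maclaurin_exp_le[of y 6] by blast
  \<comment> \<open>Since \<open>t\<close> is at most 2, the Lagrange remainder has coefficient at
    most 8/720 = 1/90.\<close>
  have "exp t \<le> exp (2::real)" using t assms by simp
  also have "\<dots> = exp 1 * exp (1::real)" by (simp flip: exp_add)
  also have "\<dots> \<le> 272/100 * (272/100)"
    using e_less_272 by (intro mult_mono) auto
  finally have et: "exp t \<le> 8" by simp
  have y6: "exp t / 720 * y ^ 6 \<le> 8 / 720 * y ^ 6"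
    using et by (intro mult_right_mono divide_right_mono) auto
  have "exp y = 1 + y + y\<^sup>2/2 + y^3/6 + y^4/24 + y^5/120 + exp t / 720 * y^6"
    unfolding e by (simp add: lessThan_nat_numeral lessThan_Suc fact_numeral)
  then show ?thesis using y6 by simp
qed

text \<open>Applied to \<open>y = ln (ratio ...)\<close>, it makes
  \<open>ratio - 1 - ln ratio\<close> quadratically small, which is the one-step divergence
  estimate. Higher powers are reduced to \<open>y^2\<close> by the size of \<open>y\<close>.\<close>

lemma exp_le_quadratic:
  fixes y :: real
  assumes "\<bar>y\<bar> \<le> 41/32"
  shows "exp y \<le> 1 + y + y\<^sup>2"
proof -
  have y2: "y\<^sup>2 \<le> (41/32)\<^sup>2" using assms by (metis abs_ge_zero power2_abs power_mono)
  have y4: "y^4 \<le> y\<^sup>2 * (1681/1024)"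
    using mult_left_mono[OF y2, of "y\<^sup>2"] by (simp add: power_divide flip: power_add)
  have y6: "y^6 \<le> y^4 * (1681/1024)"
    using mult_left_mono[OF y2, of "y^4"] by (simp add: power_divide flip: power_add)
  have y3: "y^3 \<le> y\<^sup>2 * (41/32)"
    using mult_left_mono[of y "41/32" "y\<^sup>2"] assms by (simp add: power3_eq_cube power2_eq_square)
  have "y^4 * y \<le> y^4 * (41/32)"
    using assms by (intro mult_left_mono) auto
  then have y5: "y^5 \<le> y^4 * (41/32)" by (simp flip: power_Suc2)
  have "y\<^sup>2 \<ge> 0" by simp
  with exp_le_taylor6[OF assms] y4 y6 y3 y5 show ?thesis by linarith
qed

text \<open>Odd powers cancel, and the rest is \<open>x^2\<close> times 1 + u/12 + u^2/45 with u =
  1681/1024, just below 6/5. This controls the second moment of one step ratio.\<close>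

lemma exp_add_exp_minus_le:
  fixes x :: real
  assumes "\<bar>x\<bar> \<le> 41/32"
  shows "exp x + exp (- x) \<le> 2 + 6/5 * x\<^sup>2"
proof -
  have y2: "x\<^sup>2 \<le> (41/32)\<^sup>2" using assms by (metis abs_ge_zero power2_abs power_mono)
  have y4: "x^4 \<le> x\<^sup>2 * (1681/1024)"
    using mult_left_mono[OF y2, of "x\<^sup>2"] by (simp add: power_divide flip: power_add)
  have y6: "x^6 \<le> x^4 * (1681/1024)"
    using mult_left_mono[OF y2, of "x^4"] by (simp add: power_divide flip: power_add)
  have "x\<^sup>2 \<ge> 0" by simp
  moreover have "exp (- x) \<le> 1 - x + x\<^sup>2/2 - x^3/6 + x^4/24 - x^5/120 + x^6/90"
    using exp_le_taylor6[of "- x"] assms by simp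
  ultimately show ?thesis using exp_le_taylor6[OF assms] y4 y6 by linarith
qed

text \<open>Cauchy-Schwarz with the weight \<open>a i\<close> split into two square roots. Keeping
  the discount weights on both sides is what later makes the bound independent of the
  horizon.\<close>

lemma sum_mult_square_le:
  fixes a b :: "'i \<Rightarrow> real"
  assumes "\<And>i. i \<in> I \<Longrightarrow> a i \<ge> 0"
  shows "(\<Sum>i\<in>I. a i * b i)\<^sup>2 \<le> (\<Sum>i\<in>I. a i) * (\<Sum>i\<in>I. a i * (b i)\<^sup>2)"
proof -
  have "(\<Sum>i\<in>I. sqrt (a i) * (sqrt (a i) * b i))\<^sup>2
      \<le> (\<Sum>i\<in>I. (sqrt (a i))\<^sup>2) * (\<Sum>i\<in>I. (sqrt (a i) * b i)\<^sup>2)"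
    by (rule Cauchy_Schwarz_ineq_sum)
  also have "(\<Sum>i\<in>I. sqrt (a i) * (sqrt (a i) * b i)) = (\<Sum>i\<in>I. a i * b i)"
    using assms by (intro sum.cong) (auto simp flip: mult.assoc)
  also have "(\<Sum>i\<in>I. (sqrt (a i))\<^sup>2) = (\<Sum>i\<in>I. a i)"
    using assms by (intro sum.cong) auto
  also have "(\<Sum>i\<in>I. (sqrt (a i) * b i)\<^sup>2) = (\<Sum>i\<in>I. a i * (b i)\<^sup>2)"
    using assms by (intro sum.cong) (auto simp: power_mult_distrib)
  finally show ?thesis .
qed

lemma sum_geometric_le:
  fixes z :: real
  assumes "0 \<le> z" "z < 1"
  shows "(\<Sum>h<H. z ^ h) \<le> 1 / (1 - z)"
proof -
  have s: "(\<lambda>n. z ^ n) sums (1 / (1 - z))" using geometric_sums[of z] assms by simp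
  show ?thesis
    using sum_le_suminf[OF sums_summable[OF s], of "{..<H}"] assms sums_unique[OF s] by auto
qed

lemma sum_geometric_deriv_le:
  fixes z :: real
  assumes "0 \<le> z" "z < 1"
  shows "(\<Sum>h<H. z ^ h * (real h + 1)) \<le> 1 / (1 - z)\<^sup>2"
proof -
  have s: "(\<lambda>n. of_nat (Suc n) * z ^ n) sums (1 / (1 - z)\<^sup>2)"
    using geometric_deriv_sums[of z] assms by simp
  have "(\<Sum>h<H. of_nat (Suc h) * z ^ h) \<le> 1 / (1 - z)\<^sup>2"
    using sum_le_suminf[OF sums_summable[OF s], of "{..<H}"] assms sums_unique[OF s] by auto
  then show ?thesis by (simp add: algebra_simps)
qed

text \<open>Both halves are derivatives of geometric series, at \<open>z * q\<close> and at
  \<open>z\<close>, so the infinite sum is \<open>q / (1 - z * q)^2 - 1 / (1 - z)^2\<close>; the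
  assumption on \<open>x\<close> keeps \<open>z * q\<close> below 1. The factor 4 is the square of
  the 2 in the second summand of \<open>L\<close>, so the weights' share of the correction will fit
  into that summand exactly.\<close>

lemma sum_geometric_deriv_diff_le:
  fixes z q x :: real
  assumes z: "0 < z" "z < 1" and q: "1 \<le> q" and qx: "q \<le> 1 + 6/5 * x\<^sup>2"
    and x: "x\<^sup>2 \<le> ((41/32) * (1 - z))\<^sup>2"
  shows "(\<Sum>h<H. z ^ h * (real h + 1) * (q ^ Suc h - 1)) \<le> 4 * x\<^sup>2 / (1 - z) ^ 4"
proof -
  define d where "d = 1 - z"
  define b where "b = q - 1"
  have d: "0 < d" "d < 1" "z = 1 - d" using z by (auto simp: d_def)
  have bx: "0 \<le> b" "b \<le> 6/5 * x\<^sup>2" using q qx by (auto simp: b_def)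
  have "x\<^sup>2 \<le> 1681/1024 * d\<^sup>2"
    using x by (simp only: power_mult_distrib power_divide d_def) simp
  moreover have "d\<^sup>2 \<ge> 0" by simp
  ultimately have b2: "b \<le> 2 * d\<^sup>2" using bx(2) by linarith
  have zd: "z * d \<le> 1/4"
  proof -
    have "0 \<le> (d - 1/2)\<^sup>2" by simp
    then show ?thesis by (simp add: d(3) power2_eq_square algebra_simps)
  qed
  \<comment> \<open>Writing \<open>q = 1 + b\<close> gives \<open>1 - z * q = d - z * b\<close>, and
    \<open>b \<le> 2 * d^2\<close> (as 6/5 * 1681/1024 < 2) turns this into at least
    \<open>d * w\<close>. As \<open>z * d \<le> 1/4\<close>, \<open>w\<close> stays above
    1/2.\<close>
  define w where "w = 1 - 2 * (z * d)"
  have w: "1/2 \<le> w" "w \<le> 1" using zd z d by (auto simp: w_def)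
  have zq: "1 - z * q \<ge> d * w"
  proof -
    have "z * b \<le> z * (2 * d\<^sup>2)" using b2 z by (intro mult_left_mono) auto
    then show ?thesis by (simp add: b_def d_def w_def power2_eq_square algebra_simps)
  qed
  have dw: "d * w > 0" using d w by simp
  have zq1: "z * q < 1" "0 \<le> z * q" using zq dw z q by auto
  have s1: "(\<lambda>n. of_nat (Suc n) * (z * q) ^ n) sums (1 / (1 - z * q)\<^sup>2)"
    using geometric_deriv_sums[of "z * q"] zq1 by simp
  have s2: "(\<lambda>n. of_nat (Suc n) * z ^ n) sums (1 / (1 - z)\<^sup>2)"
    using geometric_deriv_sums[of z] z by simp
  have s: "(\<lambda>n. q * (of_nat (Suc n) * (z * q) ^ n) - of_nat (Suc n) * z ^ n) sums (q * (1 / (1 - z * q)\<^sup>2) - 1 / (1 - z)\<^sup>2)"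
    by (intro sums_diff sums_mult s1 s2)
  have eq: "q * (of_nat (Suc n) * (z * q) ^ n) - of_nat (Suc n) * z ^ n = z ^ n * (real n + 1) * (q ^ Suc n - 1)" for n
    by (simp add: power_mult_distrib algebra_simps)
  have "(\<Sum>h<H. z ^ h * (real h + 1) * (q ^ Suc h - 1)) \<le> q * (1 / (1 - z * q)\<^sup>2) - 1 / d\<^sup>2"
    using sum_le_suminf[OF sums_summable[OF s[unfolded eq]], of "{..<H}"] z sums_unique[OF s[unfolded eq]] 
      one_le_power[OF q] by (auto simp: d_def simp del: power_Suc)
  also have "\<dots> = (q * d\<^sup>2 - (1 - z * q)\<^sup>2) / (d\<^sup>2 * (1 - z * q)\<^sup>2)"
    using d zq1 by (simp add: divide_simps)
  also have "\<dots> \<le> (b * (d * (2 - d))) / (d\<^sup>2 * (1 - z * q)\<^sup>2)"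
  proof (rule divide_right_mono)
    have "q * d\<^sup>2 - (1 - z * q)\<^sup>2 = b * (d * (2 - d)) - (z * b)\<^sup>2"
      by (simp add: b_def d_def power2_eq_square algebra_simps)
    then show "q * d\<^sup>2 - (1 - z * q)\<^sup>2 \<le> b * (d * (2 - d))" by simp
  qed auto
  also have "\<dots> \<le> (b * (d * (2 - d))) / (d\<^sup>2 * (d * w)\<^sup>2)"
  proof (rule divide_left_mono)
    show "d\<^sup>2 * (d * w)\<^sup>2 \<le> d\<^sup>2 * (1 - z * q)\<^sup>2"
      using zq dw by (intro mult_left_mono power_mono) auto
    show "0 \<le> b * (d * (2 - d))" using bx d by simp
    show "0 < d\<^sup>2 * (1 - z * q)\<^sup>2 * (d\<^sup>2 * (d * w)\<^sup>2)"
      using zq1(1) d(1) w(1) by (intro mult_pos_pos zero_less_power) linarith+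
  qed
  also have "\<dots> \<le> (6/5 * x\<^sup>2 * (d * (2 - d))) / (d\<^sup>2 * (d * w)\<^sup>2)"
    using d bx(2) by (intro divide_right_mono mult_right_mono) auto
  also have "\<dots> = x\<^sup>2 / d ^ 4 * ((6/5 * (d * (2 - d))) / w\<^sup>2)"
    using d w by (simp add: divide_simps power_mult_distrib flip: power_add)
  also have "\<dots> \<le> x\<^sup>2 / d ^ 4 * 4"
  proof -
    have "6/5 * (d * (2 - d)) \<le> 4 * w\<^sup>2"
    proof -
      \<comment> \<open>With u = \<open>(2 * d - 1)^2\<close> one has \<open>2 * w\<close> = u + 1,
        so \<open>4 * w^2\<close> = u^2 + 2u + 1; completing the square in the remaining quadratic
        in \<open>d\<close> leaves the positive constant 7/115.\<close>
      have "4 * w\<^sup>2 - 6/5 * (d * (2 - d))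
          = ((2 * d - 1)\<^sup>2)\<^sup>2 + 46/5 * (d - 13/23)\<^sup>2 + 7/115"
        by (simp add: w_def d(3) power2_eq_square field_simps)
      then show ?thesis
        using zero_le_power2[of "(2 * d - 1)\<^sup>2"] zero_le_power2[of "d - 13/23"] by linarith
    qed
    then have "(6/5 * (d * (2 - d))) / w\<^sup>2 \<le> 4" using w by (simp add: divide_simps)
    then show ?thesis by (intro mult_left_mono) auto
  qed
  also have "\<dots> = 4 * x\<^sup>2 / (1 - z) ^ 4" by (simp add: d_def)
  finally show ?thesis .
qed

text \<open>Along the segment the remainder has derivative at most
  \<open>M * t * norm d ^ 2\<close>, so adding or subtracting
  \<open>M / 2 * t^2 * norm d ^ 2\<close> makes it monotone. The mean value theorem alone would lose
  the factor 1/2.\<close>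

lemma taylor_lipschitz_gradient:
  fixes f :: "'d::euclidean_space \<Rightarrow> real"
  assumes f: "\<And>x. (f has_derivative (\<lambda>d. g x \<bullet> d)) (at x)"
    and g: "\<And>x y. norm (g x - g y) \<le> M * norm (x - y)"
  shows "\<bar>f y - f x - g x \<bullet> (y - x)\<bar> \<le> M / 2 * (norm (y - x))\<^sup>2"
proof -
  define d where "d = y - x"
  define \<phi> where "\<phi> t = f (x + t *\<^sub>R d) - t * (g x \<bullet> d)" for t :: real
  have D: "(\<phi> has_real_derivative (g (x + t *\<^sub>R d) - g x) \<bullet> d) (at t)" for t
  proof -
    have "((\<lambda>t. f (x + t *\<^sub>R d)) has_derivative (\<lambda>h. g (x + t *\<^sub>R d) \<bullet> (h *\<^sub>R d))) (at t)"
      by (rule has_derivative_compose[OF _ f]) (auto intro!: derivative_eq_intros)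
    moreover have "(\<lambda>h. g (x + t *\<^sub>R d) \<bullet> (h *\<^sub>R d)) = (*) (g (x + t *\<^sub>R d) \<bullet> d)"
      by (rule ext) simp
    ultimately have "((\<lambda>t. f (x + t *\<^sub>R d)) has_real_derivative g (x + t *\<^sub>R d) \<bullet> d) (at t)"
      by (simp only: has_field_derivative_def)
    then show ?thesis unfolding \<phi>_def
      by (auto intro!: derivative_eq_intros simp: inner_diff_left)
  qed
  have B: "\<bar>(g (x + t *\<^sub>R d) - g x) \<bullet> d\<bar> \<le> M * t * (norm d)\<^sup>2" if "t \<ge> 0" for t
  proof -
    have "\<bar>(g (x + t *\<^sub>R d) - g x) \<bullet> d\<bar> \<le> norm (g (x + t *\<^sub>R d) - g x) * norm d"
      by (rule Cauchy_Schwarz_ineq2)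
    also have "\<dots> \<le> (M * norm (x + t *\<^sub>R d - x)) * norm d"
      by (intro mult_right_mono g) auto
    finally show ?thesis using that by (simp add: power2_eq_square)
  qed
  have "\<phi> 1 - M / 2 * (norm d)\<^sup>2 * 1\<^sup>2 \<le> \<phi> 0 - M / 2 * (norm d)\<^sup>2 * 0\<^sup>2"
  proof (rule DERIV_nonpos_imp_nonincreasing[of 0 1 "\<lambda>t. \<phi> t - M / 2 * (norm d)\<^sup>2 * t\<^sup>2"])
    fix t :: real assume t: "0 \<le> t" "t \<le> 1"
    show "\<exists>y. ((\<lambda>t. \<phi> t - M / 2 * (norm d)\<^sup>2 * t\<^sup>2) has_real_derivative y) (at t) \<and> y \<le> 0"
      using B[OF t(1)]
      by (intro exI[of _ "(g (x + t *\<^sub>R d) - g x) \<bullet> d - M * t * (norm d)\<^sup>2"])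
        (auto intro!: derivative_eq_intros D)
  qed auto
  moreover have "\<phi> 0 + M / 2 * (norm d)\<^sup>2 * 0\<^sup>2 \<le> \<phi> 1 + M / 2 * (norm d)\<^sup>2 * 1\<^sup>2"
  proof (rule DERIV_nonneg_imp_nondecreasing[of 0 1 "\<lambda>t. \<phi> t + M / 2 * (norm d)\<^sup>2 * t\<^sup>2"])
    fix t :: real assume t: "0 \<le> t" "t \<le> 1"
    show "\<exists>y. ((\<lambda>t. \<phi> t + M / 2 * (norm d)\<^sup>2 * t\<^sup>2) has_real_derivative y) (at t) \<and> y \<ge> 0"
      using B[OF t(1)]
      by (intro exI[of _ "(g (x + t *\<^sub>R d) - g x) \<bullet> d + M * t * (norm d)\<^sup>2"])
        (auto intro!: derivative_eq_intros D)
  qed auto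
  ultimately have "\<bar>\<phi> 1 - \<phi> 0\<bar> \<le> M / 2 * (norm d)\<^sup>2"
    by (simp only: one_power2 zero_power2 mult_1_right mult_zero_right abs_le_iff) linarith
  then show ?thesis by (simp add: \<phi>_def d_def algebra_simps)
qed

text \<open>Identifies a derivative from a local expansion; this is how \<open>V\<close> becomes
  differentiable. \<open>K\<close> may have either sign, hence its absolute value in the
  comparison.\<close>

lemma has_derivative_of_quadratic_bound:
  fixes f :: "'d::euclidean_space \<Rightarrow> real"
  assumes e: "e > 0"
    and b: "\<And>y. norm (y - x) < e \<Longrightarrow> \<bar>f y - f x - g \<bullet> (y - x)\<bar> \<le> K * (norm (y - x))\<^sup>2"
  shows "(f has_derivative (\<lambda>d. g \<bullet> d)) (at x)"
  unfolding has_derivative_at2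
proof
  show "bounded_linear ((\<bullet>) g)" by (rule bounded_linear_inner_right)
  show "((\<lambda>y. (1 / norm (y - x)) *\<^sub>R (f y - (f x + g \<bullet> (y - x)))) \<longlongrightarrow> 0) (at x)"
  proof (rule Lim_null_comparison)
    show "((\<lambda>y. \<bar>K\<bar> * norm (y - x)) \<longlongrightarrow> 0) (at x)"
      by (auto intro!: tendsto_eq_intros)
    show "\<forall>\<^sub>F y in at x. norm ((1 / norm (y - x)) *\<^sub>R (f y - (f x + g \<bullet> (y - x)))) \<le> \<bar>K\<bar> * norm (y - x)"
      unfolding eventually_at
    proof (intro exI[of _ e] conjI ballI impI e)
      fix y assume y: "y \<noteq> x \<and> dist y x < e"
      then have n: "norm (y - x) > 0" "norm (y - x) < e" by (auto simp: dist_norm)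
      have "K * (norm (y - x))\<^sup>2 \<le> \<bar>K\<bar> * (norm (y - x))\<^sup>2"
        by (intro mult_right_mono) auto
      with b[OF n(2)] have "\<bar>f y - f x - g \<bullet> (y - x)\<bar> \<le> \<bar>K\<bar> * norm (y - x) * norm (y - x)"
        by (simp add: power2_eq_square mult.assoc)
      then show "norm ((1 / norm (y - x)) *\<^sub>R (f y - (f x + g \<bullet> (y - x)))) \<le> \<bar>K\<bar> * norm (y - x)"
        using n by (simp add: divide_simps diff_diff_eq)
    qed
  qed
qed

lemma grad_eqI:
  fixes f :: "'d::euclidean_space \<Rightarrow> real"
  assumes "(f has_derivative (\<lambda>d. g \<bullet> d)) (at x)"
  shows "grad f x = g"
  unfolding grad_def frechet_derivative_at[OF assms, symmetric]
  by (rule euclidean_representation)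

lemma has_derivative_grad:
  fixes f :: "'d::euclidean_space \<Rightarrow> real"
  assumes "f differentiable (at x)"
  shows "(f has_derivative (\<lambda>d. grad f x \<bullet> d)) (at x)"
proof -
  have D: "(f has_derivative frechet_derivative f (at x)) (at x)"
    using assms by (simp add: frechet_derivative_works)
  interpret bounded_linear "frechet_derivative f (at x)" using D by (rule has_derivative_bounded_linear)
  have "frechet_derivative f (at x) d = grad f x \<bullet> d" for d
  proof -
    have "frechet_derivative f (at x) d = frechet_derivative f (at x) (\<Sum>b\<in>Basis. (d \<bullet> b) *\<^sub>R b)"
      by (simp add: euclidean_representation)
    also have "\<dots> = grad f x \<bullet> d"
      unfolding sum scaleR grad_def inner_sum_left inner_scaleR_left real_scaleR_def
      by (intro sum.cong refl) (simp add: inner_commute mult.commute)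
    finally show ?thesis .
  qed
  then have "frechet_derivative f (at x) = (\<lambda>d. grad f x \<bullet> d)" by (rule ext)
  with D show ?thesis by simp
qed

section \<open>Products of densities and sample means\<close>

text \<open>Lets an i.i.d. sample be written as a density over a base measure that does not depend
  on the policy parameter, which is needed for measurability of the sampling kernel. Checked on
  boxes, where the integral factorises.\<close>

lemma density_PiM_prod:
  assumes sf: "sigma_finite_measure M" and [measurable]: "f \<in> borel_measurable M"
    and sfd: "sigma_finite_measure (density M f)" and I: "finite I"
  shows "density (PiM I (\<lambda>_. M)) (\<lambda>x. \<Prod>i\<in>I. f (x i)) = PiM I (\<lambda>_. density M f)"
proof -
  interpret M: product_sigma_finite "\<lambda>_. M" by (simp add: product_sigma_finite_def sf)
  interpret D: product_sigma_finite "\<lambda>_. density M f" by (simp add: product_sigma_finite_def sfd)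
  show ?thesis
  proof (rule D.PiM_eqI[OF I])
    show "sets (density (PiM I (\<lambda>_. M)) (\<lambda>x. \<Prod>i\<in>I. f (x i))) = sets (PiM I (\<lambda>_. density M f))"
      unfolding sets_density by (rule sets_PiM_cong) auto
  next
    fix E assume E: "\<And>i. i \<in> I \<Longrightarrow> E i \<in> sets (density M f)"
    then have E'[measurable]: "\<And>i. i \<in> I \<Longrightarrow> E i \<in> sets M" by simp
    have ES: "Pi\<^sub>E I E \<in> sets (PiM I (\<lambda>_. M))" using E' I by (intro sets_PiM_I_finite) auto
    have "emeasure (density (PiM I (\<lambda>_. M)) (\<lambda>x. \<Prod>i\<in>I. f (x i))) (Pi\<^sub>E I E)
        = (\<integral>\<^sup>+x. (\<Prod>i\<in>I. f (x i)) * indicator (Pi\<^sub>E I E) x \<partial>PiM I (\<lambda>_. M))"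
      using I by (intro emeasure_density ES) measurable
    also have "\<dots> = (\<integral>\<^sup>+x. (\<Prod>i\<in>I. f (x i) * indicator (E i) (x i)) \<partial>PiM I (\<lambda>_. M))"
    proof (rule nn_integral_cong)
      fix x assume "x \<in> space (PiM I (\<lambda>_. M))"
      then have "x \<in> extensional I" by (auto simp: space_PiM PiE_def)
      then have "x \<in> Pi\<^sub>E I E \<longleftrightarrow> (\<forall>i\<in>I. x i \<in> E i)" by (auto simp: PiE_def)
      then have "indicator (Pi\<^sub>E I E) x = (\<Prod>i\<in>I. indicator (E i) (x i) :: ennreal)"
        using I by (auto simp: indicator_def prod_zero_iff)
      then show "(\<Prod>i\<in>I. f (x i)) * indicator (Pi\<^sub>E I E) x = (\<Prod>i\<in>I. f (x i) * indicator (E i) (x i))"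
        by (simp add: prod.distrib)
    qed
    also have "\<dots> = (\<Prod>i\<in>I. \<integral>\<^sup>+x. f x * indicator (E i) x \<partial>M)"
      by (rule M.product_nn_integral_prod[OF I]) simp
    also have "\<dots> = (\<Prod>i\<in>I. emeasure (density M f) (E i))"
      using E' by (intro prod.cong refl) (simp add: emeasure_density)
    finally show "emeasure (density (PiM I (\<lambda>_. M)) (\<lambda>x. \<Prod>i\<in>I. f (x i))) (Pi\<^sub>E I E)
        = (\<Prod>i\<in>I. emeasure (density M f) (E i))" .
  qed
qed

lemma (in prob_space) expectation_norm_sum_square:
  fixes Y :: "'i \<Rightarrow> 'a \<Rightarrow> 'd::euclidean_space"
  assumes I: "finite I" and Y: "\<And>i. i \<in> I \<Longrightarrow> Y i \<in> borel_measurable M"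
    and bd: "\<And>i x. i \<in> I \<Longrightarrow> x \<in> space M \<Longrightarrow> norm (Y i x) \<le> K"
    and orth: "\<And>i j. i \<in> I \<Longrightarrow> j \<in> I \<Longrightarrow> i \<noteq> j \<Longrightarrow> (\<integral>x. Y i x \<bullet> Y j x \<partial>M) = 0"
  shows "(\<integral>x. (norm (\<Sum>i\<in>I. Y i x))\<^sup>2 \<partial>M) = (\<Sum>i\<in>I. \<integral>x. (norm (Y i x))\<^sup>2 \<partial>M)"
proof -
  have int: "integrable M (\<lambda>x. Y i x \<bullet> Y j x)" if "i \<in> I" "j \<in> I" for i j
  proof (rule integrable_const_bound)
    show "AE x in M. norm (Y i x \<bullet> Y j x) \<le> K * K"
    proof (rule AE_I2)
      fix x assume x: "x \<in> space M"
      have "norm (Y i x \<bullet> Y j x) \<le> norm (Y i x) * norm (Y j x)"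
        by (simp add: Cauchy_Schwarz_ineq2)
      also have "\<dots> \<le> K * K"
        using bd[OF that(1) x] bd[OF that(2) x] norm_ge_zero order_trans by (intro mult_mono) blast+
      finally show "norm (Y i x \<bullet> Y j x) \<le> K * K" .
    qed
    show "(\<lambda>x. Y i x \<bullet> Y j x) \<in> borel_measurable M" using Y that by simp
  qed
  have "(\<integral>x. (norm (\<Sum>i\<in>I. Y i x))\<^sup>2 \<partial>M) = (\<integral>x. (\<Sum>i\<in>I. \<Sum>j\<in>I. Y i x \<bullet> Y j x) \<partial>M)"
    unfolding power2_norm_eq_inner inner_sum_left by (simp only: inner_sum_right)
  also have "\<dots> = (\<Sum>i\<in>I. \<Sum>j\<in>I. \<integral>x. Y i x \<bullet> Y j x \<partial>M)"
    by (simp add: int Bochner_Integration.integral_sum Bochner_Integration.integrable_sum)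
  also have "\<dots> = (\<Sum>i\<in>I. \<Sum>j\<in>I. if j = i then \<integral>x. Y i x \<bullet> Y i x \<partial>M else 0)"
    by (intro sum.cong refl) (auto simp: orth)
  also have "\<dots> = (\<Sum>i\<in>I. \<integral>x. (norm (Y i x))\<^sup>2 \<partial>M)"
    using I by (simp add: sum.delta power2_norm_eq_inner)
  finally show ?thesis .
qed

lemma (in prob_space) integrable_bounded:
  fixes f :: "'a \<Rightarrow> 'd::euclidean_space"
  assumes "f \<in> borel_measurable M" "\<And>x. x \<in> space M \<Longrightarrow> norm (f x) \<le> K"
  shows "integrable M f"
  using assms by (intro integrable_const_bound[of _ K]) auto

text \<open>Two distinct coordinates of the sample have the product law, so by Fubini the inner
  product of their centred values has mean zero; only the \<open>n\<close> diagonal terms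
  survive.\<close>

lemma (in prob_space) mean_square_sample_mean:
  fixes X :: "'a \<Rightarrow> 'd::euclidean_space"
  assumes X[measurable]: "X \<in> borel_measurable M" and bd: "\<And>x. x \<in> space M \<Longrightarrow> norm (X x) \<le> K"
    and n: "n \<ge> 1"
  shows "(\<integral>x. (norm ((1 / real n) *\<^sub>R (\<Sum>i<n. X (x i)) - expectation X))\<^sup>2 \<partial>PiM {..<n} (\<lambda>_. M))
     = (\<integral>x. (norm (X x - expectation X))\<^sup>2 \<partial>M) / real n"
proof -
  interpret P: product_prob_space "\<lambda>_. M" "{..<n}" by unfold_locales
  define m where "m = expectation X"
  define Y where "Y x = X x - m" for x
  have Y[measurable]: "Y \<in> borel_measurable M" unfolding Y_def by simp
  have Yb: "norm (Y x) \<le> K + norm m" if "x \<in> space M" for x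
    using bd[OF that] norm_triangle_ineq4[of "X x" m] by (simp add: Y_def)
  have Xi: "integrable M X" using bd by (rule integrable_bounded[OF X])
  have Yi: "integrable M Y" unfolding Y_def using Xi by simp
  have Y0: "expectation Y = 0" unfolding Y_def using Xi by (simp add: m_def prob_space)
  have comp: "distr (PiM {..<n} (\<lambda>_. M)) M (\<lambda>x. x i) = M" if "i < n" for i
    using that by (intro P.PiM_component) auto
  have orth: "(\<integral>x. Y (x i) \<bullet> Y (x j) \<partial>PiM {..<n} (\<lambda>_. M)) = 0" if ij: "i < n" "j < n" "i \<noteq> j" for i j
  proof -
    interpret Q: product_sigma_finite "\<lambda>_. M" by unfold_locales
    interpret PM: pair_prob_space M M by unfold_locales
    have "(\<integral>x. Y (x i) \<bullet> Y (x j) \<partial>PiM {..<n} (\<lambda>_. M))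
        = (\<integral>x. Y (fst x) \<bullet> Y (snd x) \<partial>distr (PiM {..<n} (\<lambda>_. M)) (M \<Otimes>\<^sub>M M) (\<lambda>x. (x i, x j)))"
      using ij by (subst integral_distr) (auto intro!: measurable_Pair measurable_component_singleton)
    also have "distr (PiM {..<n} (\<lambda>_. M)) (M \<Otimes>\<^sub>M M) (\<lambda>x. (x i, x j)) = M \<Otimes>\<^sub>M M"
    proof (rule pair_measure_eqI[symmetric])
      fix C D assume CD: "C \<in> sets M" "D \<in> sets M"
      have "emeasure (distr (PiM {..<n} (\<lambda>_. M)) (M \<Otimes>\<^sub>M M) (\<lambda>x. (x i, x j))) (C \<times> D)
        = emeasure (PiM {..<n} (\<lambda>_. M)) {x \<in> space (PiM {..<n} (\<lambda>_. M)). \<forall>k\<in>{i,j}. x k \<in> (if k = i then C else D)}"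
        using ij CD by (subst emeasure_distr)
          (auto intro!: measurable_Pair measurable_component_singleton arg_cong2[where f=emeasure])
      also have "\<dots> = (\<Prod>k\<in>{i,j}. emeasure M (if k = i then C else D))"
        using ij CD by (intro P.emeasure_PiM_Collect) auto
      finally show "emeasure M C * emeasure M D
          = emeasure (distr (PiM {..<n} (\<lambda>_. M)) (M \<Otimes>\<^sub>M M) (\<lambda>x. (x i, x j))) (C \<times> D)"
        using ij by simp
    qed (auto intro: sigma_finite_measure_axioms)
    also have "(\<integral>x. Y (fst x) \<bullet> Y (snd x) \<partial>(M \<Otimes>\<^sub>M M)) = (\<integral>x. (\<integral>y. Y x \<bullet> Y y \<partial>M) \<partial>M)"
    proof -
      have "integrable (M \<Otimes>\<^sub>M M) (\<lambda>x. Y (fst x) \<bullet> Y (snd x))"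
      proof (rule PM.integrable_bounded)
        fix x assume "x \<in> space (M \<Otimes>\<^sub>M M)"
        then have x: "fst x \<in> space M" "snd x \<in> space M" by (auto simp: space_pair_measure)
        have "norm (Y (fst x) \<bullet> Y (snd x)) \<le> norm (Y (fst x)) * norm (Y (snd x))"
          by (simp add: Cauchy_Schwarz_ineq2)
        also have "\<dots> \<le> (K + norm m) * (K + norm m)"
          using Yb[OF x(1)] Yb[OF x(2)] norm_ge_zero order_trans by (intro mult_mono) blast+
        finally show "norm (Y (fst x) \<bullet> Y (snd x)) \<le> (K + norm m) * (K + norm m)" .
      qed measurable
      from PM.integral_fst'[OF this] show ?thesis by simp
    qed
    also have "\<dots> = 0" using Yi Y0 by simp
    finally show ?thesis .
  qed
  have "(\<integral>x. (norm ((1 / real n) *\<^sub>R (\<Sum>i<n. X (x i)) - m))\<^sup>2 \<partial>PiM {..<n} (\<lambda>_. M))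
      = (\<integral>x. (1 / real n)\<^sup>2 * (norm (\<Sum>i<n. Y (x i)))\<^sup>2 \<partial>PiM {..<n} (\<lambda>_. M))"
  proof (intro Bochner_Integration.integral_cong refl)
    fix x
    have "(1 / real n) *\<^sub>R (\<Sum>i<n. X (x i)) - m = (1 / real n) *\<^sub>R (\<Sum>i<n. Y (x i))"
      using n by (simp add: Y_def sum_subtractf scaleR_diff_right sum_constant_scaleR)
    then show "(norm ((1 / real n) *\<^sub>R (\<Sum>i<n. X (x i)) - m))\<^sup>2 = (1 / real n)\<^sup>2 * (norm (\<Sum>i<n. Y (x i)))\<^sup>2"
      by (simp add: power_mult_distrib power_divide)
  qed
  also have "\<dots> = (1 / real n)\<^sup>2 * (\<integral>x. (norm (\<Sum>i<n. Y (x i)))\<^sup>2 \<partial>PiM {..<n} (\<lambda>_. M))"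
    by simp
  also have "(\<integral>x. (norm (\<Sum>i<n. Y (x i)))\<^sup>2 \<partial>PiM {..<n} (\<lambda>_. M))
      = (\<Sum>i<n. \<integral>x. (norm (Y (x i)))\<^sup>2 \<partial>PiM {..<n} (\<lambda>_. M))"
  proof (rule P.expectation_norm_sum_square[where K="K + norm m"])
    show "(\<lambda>x. Y (x i)) \<in> borel_measurable (PiM {..<n} (\<lambda>_. M))" if "i \<in> {..<n}" for i
      using that by measurable
    show "norm (Y (x i)) \<le> K + norm m" if "i \<in> {..<n}" "x \<in> space (PiM {..<n} (\<lambda>_. M))" for i x
      using that by (intro Yb) (auto simp: space_PiM)
  qed (auto intro: orth)
  also have "\<dots> = (\<Sum>i<n. \<integral>x. (norm (Y x))\<^sup>2 \<partial>M)"
  proof (intro sum.cong refl)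
    fix i assume i: "i \<in> {..<n}"
    have "(\<integral>x. (norm (Y (x i)))\<^sup>2 \<partial>PiM {..<n} (\<lambda>_. M))
       = (\<integral>x. (norm (Y x))\<^sup>2 \<partial>distr (PiM {..<n} (\<lambda>_. M)) M (\<lambda>x. x i))"
      using i by (subst integral_distr) auto
    then show "(\<integral>x. (norm (Y (x i)))\<^sup>2 \<partial>PiM {..<n} (\<lambda>_. M)) = (\<integral>x. (norm (Y x))\<^sup>2 \<partial>M)"
      using comp[of i] i by simp
  qed
  finally show ?thesis using n by (simp add: Y_def m_def power2_eq_square)
qed

section \<open>Trajectory laws and changes of measure\<close>

locale mdp =
  fixes S :: "'s measure" and A :: "'a measure"
    and rho :: "'s \<Rightarrow> real" and P :: "'s \<Rightarrow> 'a \<Rightarrow> 's \<Rightarrow> real"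
  assumes sfS: "sigma_finite_measure S" and sfA: "sigma_finite_measure A"
    and rho_meas[measurable]: "rho \<in> borel_measurable S"
    and rho_nonneg: "\<forall>s\<in>space S. rho s \<ge> 0"
    and rho_int: "(\<integral>\<^sup>+ s. ennreal (rho s) \<partial>S) = 1"
    and P_meas: "(\<lambda>(s, a, s'). P s a s') \<in> borel_measurable (S \<Otimes>\<^sub>M A \<Otimes>\<^sub>M S)"
    and P_nonneg: "\<forall>s\<in>space S. \<forall>a\<in>space A. \<forall>s'\<in>space S. P s a s' \<ge> 0"
    and P_int: "\<forall>s\<in>space S. \<forall>a\<in>space A. (\<integral>\<^sup>+ s'. ennreal (P s a s') \<partial>S) = 1"
begin

sublocale SA: pair_sigma_finite S A
  by (simp add: pair_sigma_finite_def sfS sfA)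

definition mu :: "nat \<Rightarrow> (nat \<Rightarrow> 's \<times> 'a) measure" where
  "mu n = PiM {..<n} (\<lambda>_. S \<Otimes>\<^sub>M A)"

sublocale prodSA: product_sigma_finite "\<lambda>_::nat. S \<Otimes>\<^sub>M A"
  by (simp add: product_sigma_finite_def SA.sigma_finite_measure_axioms)

lemma sigma_finite_mu: "sigma_finite_measure (mu n)"
  unfolding mu_def by (rule prodSA.sigma_finite) simp

text \<open>Charges each transition to the step whose state it produces. Every time step then
  carries one state factor and one action factor, with the initial density as the case
  \<open>0\<close>, and the last step can be integrated out on its own.\<close>

definition state_dens :: "nat \<Rightarrow> (nat \<Rightarrow> 's \<times> 'a) \<Rightarrow> 's \<Rightarrow> real" where
  "state_dens h t s = (case h of 0 \<Rightarrow> rho s | Suc k \<Rightarrow> P (fst (t k)) (snd (t k)) s)"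

text \<open>The policy may vary with the time step: trajectories that follow one policy up to some step and
  another one afterwards are what makes the changes of measure below work.\<close>

definition path_dens :: "(nat \<Rightarrow> 's \<Rightarrow> 'a \<Rightarrow> real) \<Rightarrow> nat \<Rightarrow> (nat \<Rightarrow> 's \<times> 'a) \<Rightarrow> real" where
  "path_dens q n t = (\<Prod>h<n. state_dens h t (fst (t h)) * q h (fst (t h)) (snd (t h)))"

definition path_law :: "(nat \<Rightarrow> 's \<Rightarrow> 'a \<Rightarrow> real) \<Rightarrow> nat \<Rightarrow> (nat \<Rightarrow> 's \<times> 'a) measure" where
  "path_law q n = density (mu n) (\<lambda>t. ennreal (path_dens q n t))"

definition policy :: "('s \<Rightarrow> 'a \<Rightarrow> real) \<Rightarrow> bool" where
  "policy q \<longleftrightarrow> (\<lambda>(s, a). q s a) \<in> borel_measurable (S \<Otimes>\<^sub>M A)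
    \<and> (\<forall>s\<in>space S. \<forall>a\<in>space A. q s a \<ge> 0) \<and> (\<forall>s\<in>space S. (\<integral>\<^sup>+ a. ennreal (q s a) \<partial>A) = 1)"

lemma measurable_mu_component [measurable]:
  "h < n \<Longrightarrow> (\<lambda>t. t h) \<in> mu n \<rightarrow>\<^sub>M S \<Otimes>\<^sub>M A"
  unfolding mu_def by (rule measurable_component_singleton) simp

lemma space_mu_component: "t \<in> space (mu n) \<Longrightarrow> h < n \<Longrightarrow> fst (t h) \<in> space S \<and> snd (t h) \<in> space A"
  by (auto simp: mu_def space_PiM space_pair_measure PiE_def Pi_def)

lemma measurable_state_dens_pair:
  assumes "h \<le> n"
  shows "(\<lambda>(t, s). state_dens h t s) \<in> borel_measurable (mu n \<Otimes>\<^sub>M S)"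
proof (cases h)
  case 0
  then show ?thesis by (simp add: state_dens_def case_prod_beta')
next
  case (Suc k)
  then have k[measurable]: "(\<lambda>t. t k) \<in> mu n \<rightarrow>\<^sub>M S \<Otimes>\<^sub>M A" using assms by simp
  have "(\<lambda>z. (fst (fst z k), snd (fst z k), snd z)) \<in> mu n \<Otimes>\<^sub>M S \<rightarrow>\<^sub>M S \<Otimes>\<^sub>M A \<Otimes>\<^sub>M S"
    by measurable
  from measurable_compose[OF this P_meas] show ?thesis
    by (simp add: state_dens_def Suc case_prod_beta')
qed

lemma measurable_state_dens [measurable]:
  assumes "h < n"
  shows "(\<lambda>t. state_dens h t (fst (t h))) \<in> borel_measurable (mu n)"
proof -
  have [measurable]: "(\<lambda>t. t h) \<in> mu n \<rightarrow>\<^sub>M S \<Otimes>\<^sub>M A" using assms by simp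
  have "(\<lambda>t. (t, fst (t h))) \<in> mu n \<rightarrow>\<^sub>M mu n \<Otimes>\<^sub>M S" by measurable
  from measurable_compose[OF this measurable_state_dens_pair[of h n]] assms show ?thesis by simp
qed

lemma measurable_policy:
  assumes "policy q" "h < n"
  shows "(\<lambda>t. q (fst (t h)) (snd (t h))) \<in> borel_measurable (mu n)"
proof -
  have "(\<lambda>(s, a). q s a) \<in> borel_measurable (S \<Otimes>\<^sub>M A)" using assms by (simp add: policy_def)
  from measurable_compose[OF measurable_mu_component[OF assms(2)] this] show ?thesis
    by (simp add: case_prod_beta')
qed

lemma measurable_path_dens:
  assumes "\<And>h. policy (q h)" "n \<le> m"
  shows "path_dens q n \<in> borel_measurable (mu m)"
  unfolding path_dens_def
proof (rule borel_measurable_prod)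
  fix h assume "h \<in> {..<n}"
  then have h: "h < m" using assms by simp
  show "(\<lambda>t. state_dens h t (fst (t h)) * q h (fst (t h)) (snd (t h))) \<in> borel_measurable (mu m)"
    by (intro borel_measurable_times measurable_state_dens measurable_policy assms h)
qed

lemma state_dens_nonneg:
  "t \<in> space (mu n) \<Longrightarrow> h \<le> n \<Longrightarrow> s \<in> space S \<Longrightarrow> state_dens h t s \<ge> 0"
  using rho_nonneg P_nonneg space_mu_component[of t n] by (cases h) (auto simp: state_dens_def)

lemma state_dens_int:
  "t \<in> space (mu n) \<Longrightarrow> h \<le> n \<Longrightarrow> (\<integral>\<^sup>+s. ennreal (state_dens h t s) \<partial>S) = 1"
  using rho_int P_int space_mu_component[of t n] by (cases h) (auto simp: state_dens_def)

lemma path_dens_nonneg: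
  assumes "\<And>h. policy (q h)" "t \<in> space (mu n)"
  shows "path_dens q n t \<ge> 0"
  unfolding path_dens_def using assms space_mu_component[of t n] state_dens_nonneg[of t n]
  by (intro prod_nonneg) (auto simp: policy_def)

lemma sets_path_law [simp, measurable_cong]: "sets (path_law q n) = sets (mu n)"
  by (simp add: path_law_def)

lemma space_path_law [simp]: "space (path_law q n) = space (mu n)"
  by (simp add: path_law_def)

lemma measurable_restrict_mu: "n \<le> m \<Longrightarrow> (\<lambda>t. restrict t {..<n}) \<in> mu m \<rightarrow>\<^sub>M mu n"
  unfolding mu_def by (rule measurable_restrict_subset) auto

lemma state_dens_upd: "h \<le> n \<Longrightarrow> state_dens h (t(n := y)) s = state_dens h t s"
  by (cases h) (auto simp: state_dens_def)

lemma path_dens_upd: "path_dens q (Suc n) (t(n := y)) = path_dens q n t * (state_dens n t (fst y) * q n (fst y) (snd y))"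
  unfolding path_dens_def prod.lessThan_Suc by (simp add: state_dens_upd)

text \<open>Integrating out the last action and then the last state gives 1 each time, since both
  conditional densities are normalised. Hence a prefix does not feel what happens later.\<close>

lemma distr_path_law_Suc:
  assumes q: "\<And>h. policy (q h)"
  shows "distr (path_law q (Suc n)) (mu n) (\<lambda>t. restrict t {..<n}) = path_law q n"
proof (rule measure_eqI)
  fix E assume "E \<in> sets (distr (path_law q (Suc n)) (mu n) (\<lambda>t. restrict t {..<n}))"
  then have E[measurable]: "E \<in> sets (mu n)" by simp
  note [measurable] = measurable_restrict_mu[of n "Suc n", OF le_SucI, OF order_refl] measurable_path_dens[OF q]
  have "emeasure (distr (path_law q (Suc n)) (mu n) (\<lambda>t. restrict t {..<n})) E
      = (\<integral>\<^sup>+t. indicator E (restrict t {..<n}) \<partial>path_law q (Suc n))"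
    by (subst nn_integral_indicator[symmetric], simp, subst nn_integral_distr) auto
  also have "\<dots> = (\<integral>\<^sup>+t. ennreal (path_dens q (Suc n) t) * indicator E (restrict t {..<n}) \<partial>mu (Suc n))"
    unfolding path_law_def by (subst nn_integral_density) auto
  also have "\<dots> = (\<integral>\<^sup>+t. \<integral>\<^sup>+y. ennreal (path_dens q (Suc n) (t(n := y))) * indicator E (restrict (t(n := y)) {..<n}) \<partial>(S \<Otimes>\<^sub>M A) \<partial>mu n)"
  proof -
    have "(\<lambda>t. ennreal (path_dens q (Suc n) t) * indicator E (restrict t {..<n})) \<in> borel_measurable (mu (Suc n))"
      by measurable
    then show ?thesis unfolding mu_def lessThan_Suc
      by (intro prodSA.product_nn_integral_insert) auto
  qed
  also have "\<dots> = (\<integral>\<^sup>+t. ennreal (path_dens q n t) * indicator E t \<partial>mu n)"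
  proof (rule nn_integral_cong)
    fix t assume t: "t \<in> space (mu n)"
    have ext: "restrict t {..<n} = t" using t by (auto simp: mu_def space_PiM PiE_def extensional_restrict)
    have k[measurable]: "state_dens n t \<in> borel_measurable S"
      using measurable_compose[OF measurable_Pair1'[OF t] measurable_state_dens_pair[of n n]] by simp
    have qn[measurable]: "(\<lambda>(s, a). q n s a) \<in> borel_measurable (S \<Otimes>\<^sub>M A)" using q[of n] by (simp add: policy_def)
    have qs[measurable]: "q n s \<in> borel_measurable A" if "s \<in> space S" for s
      using measurable_compose[OF measurable_Pair1'[OF that] qn] by simp
    have "(\<integral>\<^sup>+y. ennreal (path_dens q (Suc n) (t(n := y))) * indicator E (restrict (t(n := y)) {..<n}) \<partial>(S \<Otimes>\<^sub>M A))
        = (\<integral>\<^sup>+y. (ennreal (path_dens q n t) * indicator E t) * ennreal (state_dens n t (fst y) * q n (fst y) (snd y)) \<partial>(S \<Otimes>\<^sub>M A))"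
      by (rule nn_integral_cong)
        (simp add: path_dens_upd ext ennreal_mult' path_dens_nonneg[OF q t] mult_ac)
    also have "\<dots> = (ennreal (path_dens q n t) * indicator E t) * (\<integral>\<^sup>+y. ennreal (state_dens n t (fst y) * q n (fst y) (snd y)) \<partial>(S \<Otimes>\<^sub>M A))"
      using qn by (intro nn_integral_cmult) (simp add: case_prod_beta')
    also have "(\<integral>\<^sup>+y. ennreal (state_dens n t (fst y) * q n (fst y) (snd y)) \<partial>(S \<Otimes>\<^sub>M A))
        = (\<integral>\<^sup>+s. \<integral>\<^sup>+a. ennreal (state_dens n t s * q n s a) \<partial>A \<partial>S)"
      using qn by (subst SA.M2.nn_integral_fst[symmetric]) (simp_all add: case_prod_beta')
    also have "\<dots> = (\<integral>\<^sup>+s. ennreal (state_dens n t s) \<partial>S)"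
    proof (rule nn_integral_cong)
      fix s assume s: "s \<in> space S"
      have "(\<integral>\<^sup>+a. ennreal (state_dens n t s * q n s a) \<partial>A) = (\<integral>\<^sup>+a. ennreal (state_dens n t s) * ennreal (q n s a) \<partial>A)"
        using state_dens_nonneg[OF t order_refl s] by (simp add: ennreal_mult')
      also have "\<dots> = ennreal (state_dens n t s) * (\<integral>\<^sup>+a. ennreal (q n s a) \<partial>A)"
        using s by (intro nn_integral_cmult) simp
      finally show "(\<integral>\<^sup>+a. ennreal (state_dens n t s * q n s a) \<partial>A) = ennreal (state_dens n t s)"
        using q[of n] s by (simp add: policy_def)
    qed
    finally show "(\<integral>\<^sup>+y. ennreal (path_dens q (Suc n) (t(n := y))) * indicator E (restrict (t(n := y)) {..<n}) \<partial>(S \<Otimes>\<^sub>M A))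
        = ennreal (path_dens q n t) * indicator E t"
      unfolding state_dens_int[OF t order_refl] mult_1_right .
  qed
  also have "\<dots> = emeasure (path_law q n) E"
    unfolding path_law_def by (subst emeasure_density) auto
  finally show "emeasure (distr (path_law q (Suc n)) (mu n) (\<lambda>t. restrict t {..<n})) E = emeasure (path_law q n) E" .
qed simp

lemma distr_path_law:
  assumes q: "\<And>h. policy (q h)" and "n \<le> m"
  shows "distr (path_law q m) (mu n) (\<lambda>t. restrict t {..<n}) = path_law q n"
  using \<open>n \<le> m\<close>
proof (induction m rule: dec_induct)
  case base
  have "distr (path_law q n) (mu n) (\<lambda>t. restrict t {..<n}) = distr (path_law q n) (mu n) (\<lambda>t. t)"
    by (rule distr_cong) (auto simp: mu_def space_PiM PiE_def extensional_restrict)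
  also have "\<dots> = path_law q n" by (rule distr_id2) simp
  finally show ?case .
next
  case (step m)
  have "distr (path_law q (Suc m)) (mu n) (\<lambda>t. restrict t {..<n})
      = distr (path_law q (Suc m)) (mu n) ((\<lambda>t. restrict t {..<n}) \<circ> (\<lambda>t. restrict t {..<m}))"
  proof (rule distr_cong)
    fix t assume "t \<in> space (path_law q (Suc m))"
    have "{..<m} \<inter> {..<n} = {..<n}" using step by auto
    then show "restrict t {..<n} = ((\<lambda>t. restrict t {..<n}) \<circ> (\<lambda>t. restrict t {..<m})) t"
      by simp
  qed auto
  also have "\<dots> = distr (distr (path_law q (Suc m)) (mu m) (\<lambda>t. restrict t {..<m})) (mu n) (\<lambda>t. restrict t {..<n})"
    by (rule distr_distr[symmetric]) (use step measurable_restrict_mu[of n m] measurable_restrict_mu[of m "Suc m"] in auto)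
  also have "\<dots> = path_law q n" by (simp only: distr_path_law_Suc[OF q] step.IH)
  finally show ?case .
qed

text \<open>The path law of length 0 lives on a one-point space with mass 1, and passing to the
  empty prefix preserves total mass.\<close>

lemma prob_space_path_law:
  assumes q: "\<And>h. policy (q h)"
  shows "prob_space (path_law q n)"
proof
  have "emeasure (path_law q 0) (space (mu 0)) = 1"
    by (simp add: path_law_def emeasure_density path_dens_def mu_def PiM_empty)
  moreover have "emeasure (path_law q 0) (space (mu 0)) = emeasure (path_law q n) (space (path_law q n))"
    unfolding distr_path_law[OF q le0[of n], symmetric]
    using measurable_restrict_mu[OF le0[of n]] measurable_space[OF measurable_restrict_mu[OF le0[of n]]]
    by (subst emeasure_distr) (auto intro!: arg_cong2[where f=emeasure])
  ultimately show "emeasure (path_law q n) (space (path_law q n)) = 1" by simp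
qed

text \<open>Causality: an integrand that sees only the first \<open>k\<close> steps (assumption
  \<open>fr\<close>) is insensitive to the policies used from step \<open>k\<close> on.\<close>

lemma integral_path_law_prefix_cong:
  fixes f :: "(nat \<Rightarrow> 's \<times> 'a) \<Rightarrow> 'd::{banach, second_countable_topology}"
  assumes q: "\<And>h. policy (q h)" "\<And>h. policy (q' h)" and eq: "\<And>h. h < k \<Longrightarrow> q h = q' h" and "k \<le> n"
    and f: "f \<in> borel_measurable (mu k)" and fr: "\<And>t. t \<in> space (mu n) \<Longrightarrow> f (restrict t {..<k}) = f t"
  shows "integral\<^sup>L (path_law q n) f = integral\<^sup>L (path_law q' n) f"
proof -
  have *: "integral\<^sup>L (path_law q n) f = integral\<^sup>L (path_law q k) f" if q: "\<And>h. policy (q h)" for q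
  proof -
    have "integral\<^sup>L (path_law q n) f = (\<integral>t. f (restrict t {..<k}) \<partial>path_law q n)"
      by (intro Bochner_Integration.integral_cong refl) (simp add: fr)
    also have "\<dots> = integral\<^sup>L (distr (path_law q n) (mu k) (\<lambda>t. restrict t {..<k})) f"
      using measurable_restrict_mu[OF \<open>k \<le> n\<close>] f by (subst integral_distr) auto
    finally show ?thesis by (simp add: distr_path_law[OF q \<open>k \<le> n\<close>])
  qed
  have "path_law q k = path_law q' k" unfolding path_law_def path_dens_def using eq by simp
  then show ?thesis using *[of q] *[of q'] q by simp
qed

text \<open>The ratios exchange the policy exactly at the times in \<open>I\<close>. Taking
  \<open>I\<close> as an initial segment produces the importance weight of a prefix, and taking a
  single time produces one step ratio.\<close>

lemma integral_path_law_reweight: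
  fixes f :: "(nat \<Rightarrow> 's \<times> 'a) \<Rightarrow> 'd::{banach, second_countable_topology}"
  assumes q: "\<And>h. policy (q h)" "\<And>h. policy (q' h)" and "I \<subseteq> {..<n}"
    and pos: "\<And>h s a. s \<in> space S \<Longrightarrow> a \<in> space A \<Longrightarrow> q h s a > 0"
    and f: "f \<in> borel_measurable (mu n)"
  shows "(\<integral>t. (\<Prod>h\<in>I. q' h (fst (t h)) (snd (t h)) / q h (fst (t h)) (snd (t h))) *\<^sub>R f t \<partial>path_law q n)
     = integral\<^sup>L (path_law (\<lambda>h. if h \<in> I then q' h else q h) n) f"
proof -
  let ?W = "\<lambda>t. (\<Prod>h\<in>I. q' h (fst (t h)) (snd (t h)) / q h (fst (t h)) (snd (t h)))"
  let ?m = "\<lambda>h. if h \<in> I then q' h else q h"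
  have m: "policy (?m h)" for h using q by simp
  have W: "?W \<in> borel_measurable (mu n)"
    using assms(3) by (intro borel_measurable_prod borel_measurable_divide measurable_policy q) auto
  have "(\<integral>t. ?W t *\<^sub>R f t \<partial>path_law q n) = (\<integral>t. path_dens q n t *\<^sub>R (?W t *\<^sub>R f t) \<partial>mu n)"
    unfolding path_law_def using W f measurable_path_dens[OF q(1), of n n]
    by (intro integral_density) (auto intro!: AE_I2 path_dens_nonneg q)
  also have "\<dots> = (\<integral>t. path_dens ?m n t *\<^sub>R f t \<partial>mu n)"
  proof (intro Bochner_Integration.integral_cong refl)
    fix t assume t: "t \<in> space (mu n)"
    have W': "?W t = (\<Prod>h<n. if h \<in> I then q' h (fst (t h)) (snd (t h)) / q h (fst (t h)) (snd (t h)) else 1)"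
      using assms(3) by (simp add: prod.If_cases Int_absorb1)
    have "path_dens q n t * ?W t = path_dens ?m n t"
      unfolding path_dens_def W' prod.distrib[symmetric]
    proof (rule prod.cong[OF refl])
      fix h assume "h \<in> {..<n}"
      then have "q h (fst (t h)) (snd (t h)) > 0" using space_mu_component[OF t] pos by auto
      then show "state_dens h t (fst (t h)) * q h (fst (t h)) (snd (t h)) *
          (if h \<in> I then q' h (fst (t h)) (snd (t h)) / q h (fst (t h)) (snd (t h)) else 1)
        = state_dens h t (fst (t h)) * ?m h (fst (t h)) (snd (t h))" by simp
    qed
    then show "path_dens q n t *\<^sub>R (?W t *\<^sub>R f t) = path_dens ?m n t *\<^sub>R f t" by simp
  qed
  also have "\<dots> = integral\<^sup>L (path_law ?m n) f"
    unfolding path_law_def using f measurable_path_dens[OF m, of n n]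
    by (intro integral_density[symmetric]) (auto intro!: AE_I2 path_dens_nonneg m)
  finally show ?thesis .
qed

text \<open>A matter of regrouping factors. At \<open>H = 0\<close> it would fail, because
  \<open>traj_dens\<close> keeps the initial density while the path density is an empty
  product.\<close>

lemma traj_eq_path_law:
  assumes "H \<ge> 1"
  shows "traj S A rho P H pol th = path_law (\<lambda>_. pol th) H"
proof -
  obtain n where H: "H = Suc n" using assms by (cases H) auto
  have "traj_dens rho P H pol th t = path_dens (\<lambda>_. pol th) H t" for t
    unfolding traj_dens_def path_dens_def prod.distrib H
    by (subst (2) prod.lessThan_Suc_shift) (simp add: state_dens_def mult_ac)
  then show ?thesis unfolding traj_def path_law_def mu_def by simp
qed

end

section \<open>Regularity of the policy\<close>

locale pg = mdp S A rho P
  for S :: "'s measure" and A :: "'a measure" and rho P +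
  fixes r :: "'s \<Rightarrow> 'a \<Rightarrow> real" and R gm :: real and H :: nat
    and pol :: "'d::euclidean_space \<Rightarrow> 's \<Rightarrow> 'a \<Rightarrow> real" and G M :: real
  assumes H_pos: "H \<ge> 1"
    and r_meas: "(\<lambda>(s, a). r s a) \<in> borel_measurable (S \<Otimes>\<^sub>M A)"
    and R_pos: "R > 0"
    and r_bound: "\<forall>s\<in>space S. \<forall>a\<in>space A. \<bar>r s a\<bar> \<le> R"
    and gm: "0 < gm" "gm < 1"
    and pol_meas: "(\<lambda>(th, s, a). pol th s a) \<in> borel_measurable (borel \<Otimes>\<^sub>M S \<Otimes>\<^sub>M A)"
    and pol_pos: "\<forall>th. \<forall>s\<in>space S. \<forall>a\<in>space A. pol th s a > 0"
    and pol_int: "\<forall>th. \<forall>s\<in>space S. (\<integral>\<^sup>+ a. ennreal (pol th s a) \<partial>A) = 1"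
    and pol_diff: "\<forall>th. \<forall>s\<in>space S. \<forall>a\<in>space A. (\<lambda>th'. pol th' s a) differentiable (at th)"
    and pol_diff2: "\<forall>th. \<forall>s\<in>space S. \<forall>a\<in>space A.
                      grad (\<lambda>th'. pol th' s a) differentiable (at th)"
    and G_pos: "G > 0" and score_bound: "\<forall>th. \<forall>s\<in>space S. \<forall>a\<in>space A. norm (score pol th s a) \<le> G"
    and M_pos: "M > 0" and hess_bound: "\<forall>th. \<forall>s\<in>space S. \<forall>a\<in>space A. hess_norm (\<lambda>th'. ln (pol th' s a)) th \<le> M"
begin

context
  fixes s a assumes sa: "s \<in> space S" "a \<in> space A"
begin

lemma ln_pol_has_derivative:
  "((\<lambda>th. ln (pol th s a)) has_derivative (\<lambda>d. score pol th s a \<bullet> d)) (at th)"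
proof -
  have "((\<lambda>th. pol th s a) has_derivative (\<lambda>d. grad (\<lambda>th. pol th s a) th \<bullet> d)) (at th)"
    by (rule has_derivative_grad) (use pol_diff sa in auto)
  then have "((\<lambda>th. ln (pol th s a)) has_derivative (\<lambda>d. (grad (\<lambda>th. pol th s a) th \<bullet> d) * inverse (pol th s a))) (at th)"
    using pol_pos sa by (auto intro!: derivative_eq_intros)
  then have "(\<lambda>th. ln (pol th s a)) differentiable (at th)" by (rule differentiableI)
  from has_derivative_grad[OF this] show ?thesis by (simp add: score_def)
qed

text \<open>The assumptions give second differentiability of the policy itself, not of its
  logarithm; this quotient form carries it over to the score, so that the Hessian bound speaks about
  a genuine derivative.\<close>

lemma score_eq: "score pol th s a = inverse (pol th s a) *\<^sub>R grad (\<lambda>th'. pol th' s a) th"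
  unfolding score_def
proof (rule grad_eqI)
  have "((\<lambda>th. pol th s a) has_derivative (\<lambda>d. grad (\<lambda>th. pol th s a) th \<bullet> d)) (at th)"
    by (rule has_derivative_grad) (use pol_diff sa in auto)
  then show "((\<lambda>th. ln (pol th s a)) has_derivative (\<lambda>d. (inverse (pol th s a) *\<^sub>R grad (\<lambda>th'. pol th' s a) th) \<bullet> d)) (at th)"
    using pol_pos sa by (auto intro!: derivative_eq_intros simp: field_simps)
qed

lemma score_lipschitz: "norm (score pol th s a - score pol th' s a) \<le> M * norm (th - th')"
proof -
  let ?f = "\<lambda>th. score pol th s a"
  have "?f differentiable (at th)" for th
    unfolding score_eq
    using pol_diff pol_diff2 pol_pos sa
    by (intro differentiable_scaleR differentiable_inverse) (auto simp: less_imp_neq[symmetric])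
  then have D: "(?f has_derivative frechet_derivative ?f (at th)) (at th)" for th
    by (simp add: frechet_derivative_works)
  have "onorm (frechet_derivative ?f (at th)) \<le> M" for th
    using hess_bound sa by (auto simp: hess_norm_def score_def[abs_def])
  then show ?thesis
    using differentiable_bound[of UNIV ?f "\<lambda>th. frechet_derivative ?f (at th)" M th th'] D by simp
qed

lemma ln_pol_taylor:
  "\<bar>ln (pol th' s a) - ln (pol th s a) - score pol th s a \<bullet> (th' - th)\<bar> \<le> M / 2 * (norm (th' - th))\<^sup>2"
  by (rule taylor_lipschitz_gradient[of "\<lambda>th. ln (pol th s a)"]) (rule ln_pol_has_derivative score_lipschitz)+

lemma ln_pol_lipschitz: "\<bar>ln (pol th' s a) - ln (pol th s a)\<bar> \<le> G * norm (th' - th)"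
proof -
  have "onorm (\<lambda>d. score pol th s a \<bullet> d) \<le> G" for th
  proof (rule onorm_le)
    fix d
    have "norm (score pol th s a \<bullet> d) \<le> norm (score pol th s a) * norm d"
      by (simp add: Cauchy_Schwarz_ineq2)
    also have "\<dots> \<le> G * norm d" using score_bound sa by (intro mult_right_mono) auto
    finally show "norm (score pol th s a \<bullet> d) \<le> G * norm d" .
  qed
  then show ?thesis
    using differentiable_bound[of UNIV "\<lambda>th. ln (pol th s a)" "\<lambda>th d. score pol th s a \<bullet> d" G th' th] ln_pol_has_derivative
    by simp
qed

lemma pol_ratio_bounds:
  "exp (- (G * norm (th' - th))) \<le> pol th' s a / pol th s a" "pol th' s a / pol th s a \<le> exp (G * norm (th' - th))"
proof -
  have p: "pol th' s a > 0" "pol th s a > 0" using pol_pos sa by auto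
  then have eq: "pol th' s a / pol th s a = exp (ln (pol th' s a) - ln (pol th s a))"
    by (simp add: exp_diff)
  show "exp (- (G * norm (th' - th))) \<le> pol th' s a / pol th s a" "pol th' s a / pol th s a \<le> exp (G * norm (th' - th))"
    unfolding eq using ln_pol_lipschitz[of th' th] by (simp_all add: abs_le_iff)
qed

end

lemma measurable_pol_comp [measurable]:
  assumes [measurable]: "f \<in> N \<rightarrow>\<^sub>M borel" "g \<in> N \<rightarrow>\<^sub>M S" "h \<in> N \<rightarrow>\<^sub>M A"
  shows "(\<lambda>x. pol (f x) (g x) (h x)) \<in> borel_measurable N"
proof -
  have "(\<lambda>x. (f x, g x, h x)) \<in> N \<rightarrow>\<^sub>M borel \<Otimes>\<^sub>M S \<Otimes>\<^sub>M A" by measurable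
  from measurable_compose[OF this pol_meas] show ?thesis by simp
qed

lemma measurable_reward_comp [measurable]:
  assumes [measurable]: "g \<in> N \<rightarrow>\<^sub>M S" "h \<in> N \<rightarrow>\<^sub>M A"
  shows "(\<lambda>x. r (g x) (h x)) \<in> borel_measurable N"
proof -
  have "(\<lambda>x. (g x, h x)) \<in> N \<rightarrow>\<^sub>M S \<Otimes>\<^sub>M A" by measurable
  from measurable_compose[OF this r_meas] show ?thesis by simp
qed

text \<open>The score is a Frechet derivative, so joint measurability in parameter, state and action
  is not visible from its definition. Each coordinate is a limit of difference quotients of
  \<open>ln pol\<close> along a basis vector, and those are measurable.\<close>

lemma measurable_score_comp [measurable]:
  assumes [measurable]: "f \<in> N \<rightarrow>\<^sub>M borel" "g \<in> N \<rightarrow>\<^sub>M S" "h \<in> N \<rightarrow>\<^sub>M A"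
  shows "(\<lambda>x. score pol (f x) (g x) (h x)) \<in> borel_measurable N"
proof (subst borel_measurable_euclidean_space, rule ballI)
  fix b :: 'd assume "b \<in> Basis"
  let ?X = "\<lambda>n. inverse (real (Suc n))"
  show "(\<lambda>x. score pol (f x) (g x) (h x) \<bullet> b) \<in> borel_measurable N"
  proof (rule borel_measurable_LIMSEQ_real)
    fix x assume "x \<in> space N"
    then have sa: "g x \<in> space S" "h x \<in> space A" by (auto intro: measurable_space[OF assms(2)] measurable_space[OF assms(3)])
    let ?l = "\<lambda>t. ln (pol (f x + t *\<^sub>R b) (g x) (h x))"
    have "(?l has_derivative (\<lambda>d. score pol (f x + 0 *\<^sub>R b) (g x) (h x) \<bullet> (d *\<^sub>R b))) (at 0)"
      by (rule has_derivative_compose[OF _ ln_pol_has_derivative[OF sa]]) (auto intro!: derivative_eq_intros)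
    moreover have "(\<lambda>d. score pol (f x + 0 *\<^sub>R b) (g x) (h x) \<bullet> (d *\<^sub>R b)) = (*) (score pol (f x) (g x) (h x) \<bullet> b)"
      by (rule ext) simp
    ultimately have "(?l has_real_derivative score pol (f x) (g x) (h x) \<bullet> b) (at 0)"
      by (simp only: has_field_derivative_def)
    then have "((\<lambda>t. (?l (0 + t) - ?l 0) / t) \<longlongrightarrow> score pol (f x) (g x) (h x) \<bullet> b) (at 0)"
      by (simp only: DERIV_def)
    moreover have "filterlim ?X (at 0) sequentially"
      by (intro filterlim_atI LIMSEQ_inverse_real_of_nat) auto
    ultimately show "(\<lambda>n. (?l (0 + ?X n) - ?l 0) / ?X n) \<longlonglongrightarrow> score pol (f x) (g x) (h x) \<bullet> b"
      by (rule filterlim_compose)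
  next
    show "(\<lambda>x. (ln (pol (f x + (0 + ?X n) *\<^sub>R b) (g x) (h x)) - ln (pol (f x + 0 *\<^sub>R b) (g x) (h x))) / ?X n)
        \<in> borel_measurable N" for n
      by measurable
  qed
qed

lemma policy_pol: "policy (pol th)"
proof -
  have "(\<lambda>z. pol th (fst z) (snd z)) \<in> borel_measurable (S \<Otimes>\<^sub>M A)" by measurable
  then show ?thesis using pol_pos pol_int
    by (auto simp: policy_def case_prod_beta' less_imp_le)
qed

lemma measurable_component_comp:
  assumes "t \<in> N \<rightarrow>\<^sub>M mu n" "h < n"
  shows "(\<lambda>x. t x h) \<in> N \<rightarrow>\<^sub>M S \<Otimes>\<^sub>M A"
  using assms by (rule measurable_compose[OF _ measurable_mu_component])

lemma measurable_Zsum_comp: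
  assumes [measurable]: "f \<in> N \<rightarrow>\<^sub>M borel" "t \<in> N \<rightarrow>\<^sub>M mu n" and h: "h < n"
  shows "(\<lambda>x. Zsum pol (f x) h (t x)) \<in> borel_measurable N"
  unfolding Zsum_def
proof (rule borel_measurable_sum)
  fix z assume "z \<in> {..h}"
  then have [measurable]: "(\<lambda>x. t x z) \<in> N \<rightarrow>\<^sub>M S \<Otimes>\<^sub>M A" using h by (intro measurable_component_comp[OF assms(2)]) auto
  show "(\<lambda>x. score pol (f x) (fst (t x z)) (snd (t x z))) \<in> borel_measurable N" by measurable
qed

lemma measurable_iw_prefix_comp:
  assumes [measurable]: "f \<in> N \<rightarrow>\<^sub>M borel" "g \<in> N \<rightarrow>\<^sub>M borel" "t \<in> N \<rightarrow>\<^sub>M mu n" and h: "h < n"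
  shows "(\<lambda>x. iw_prefix pol (f x) (g x) h (t x)) \<in> borel_measurable N"
  unfolding iw_prefix_def
proof (rule borel_measurable_prod)
  fix z assume "z \<in> {..h}"
  then have [measurable]: "(\<lambda>x. t x z) \<in> N \<rightarrow>\<^sub>M S \<Otimes>\<^sub>M A" using h by (intro measurable_component_comp[OF assms(3)]) auto
  show "(\<lambda>x. pol (g x) (fst (t x z)) (snd (t x z)) / pol (f x) (fst (t x z)) (snd (t x z))) \<in> borel_measurable N" by measurable
qed

lemma measurable_reward_component:
  assumes [measurable]: "t \<in> N \<rightarrow>\<^sub>M mu n" and h: "h < n"
  shows "(\<lambda>x. r (fst (t x h)) (snd (t x h))) \<in> borel_measurable N"
proof -
  have [measurable]: "(\<lambda>x. t x h) \<in> N \<rightarrow>\<^sub>M S \<Otimes>\<^sub>M A" using h by (intro measurable_component_comp[OF assms(1)]) auto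
  show ?thesis by measurable
qed

lemma measurable_gpomdp_comp [measurable]:
  assumes [measurable]: "f \<in> N \<rightarrow>\<^sub>M borel" "t \<in> N \<rightarrow>\<^sub>M mu H"
  shows "(\<lambda>x. gpomdp r gm H pol (f x) (t x)) \<in> borel_measurable N"
  unfolding gpomdp_def
  by (intro borel_measurable_sum borel_measurable_scaleR borel_measurable_times borel_measurable_const
      measurable_reward_component[of t] measurable_Zsum_comp[of f _ t] assms) auto

lemma measurable_gpomdp_off_comp [measurable]:
  assumes [measurable]: "f \<in> N \<rightarrow>\<^sub>M borel" "g \<in> N \<rightarrow>\<^sub>M borel" "t \<in> N \<rightarrow>\<^sub>M mu H"
  shows "(\<lambda>x. gpomdp_off r gm H pol (f x) (g x) (t x)) \<in> borel_measurable N"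
  unfolding gpomdp_off_def
  by (intro borel_measurable_sum borel_measurable_scaleR borel_measurable_times borel_measurable_const
      measurable_reward_component[of t] measurable_Zsum_comp[of g _ t] measurable_iw_prefix_comp[of f _ g t] assms) auto

lemma measurable_path_dens_comp [measurable]:
  assumes [measurable]: "f \<in> N \<rightarrow>\<^sub>M borel" "t \<in> N \<rightarrow>\<^sub>M mu n"
  shows "(\<lambda>x. path_dens (\<lambda>_. pol (f x)) n (t x)) \<in> borel_measurable N"
  unfolding path_dens_def
proof (rule borel_measurable_prod)
  fix z assume z: "z \<in> {..<n}"
  then have [measurable]: "(\<lambda>x. t x z) \<in> N \<rightarrow>\<^sub>M S \<Otimes>\<^sub>M A" by (intro measurable_component_comp[OF assms(2)]) auto
  have [measurable]: "(\<lambda>x. state_dens z (t x) (fst (t x z))) \<in> borel_measurable N"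
    using z by (intro measurable_compose[OF assms(2) measurable_state_dens]) auto
  show "(\<lambda>x. state_dens z (t x) (fst (t x z)) * pol (f x) (fst (t x z)) (snd (t x z))) \<in> borel_measurable N" by measurable
qed

end

section \<open>Importance weights\<close>

context pg
begin

abbreviation tr :: "'d \<Rightarrow> (nat \<Rightarrow> 's \<times> 'a) measure" where
  "tr th \<equiv> traj S A rho P H pol th"

abbreviation V :: "'d \<Rightarrow> real" where
  "V th \<equiv> Vf S A rho P r gm H pol th"

definition ratio :: "'d \<Rightarrow> 'd \<Rightarrow> nat \<Rightarrow> (nat \<Rightarrow> 's \<times> 'a) \<Rightarrow> real" where
  "ratio th th' h t = pol th' (fst (t h)) (snd (t h)) / pol th (fst (t h)) (snd (t h))"

text \<open>Indexed by the number of factors rather than by the last time, so that inductions can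
  start from the empty product.\<close>

definition weight :: "'d \<Rightarrow> 'd \<Rightarrow> nat \<Rightarrow> (nat \<Rightarrow> 's \<times> 'a) \<Rightarrow> real" where
  "weight th th' n t = (\<Prod>h<n. ratio th th' h t)"

lemma iw_prefix_eq_weight: "iw_prefix pol th th' h t = weight th th' (Suc h) t"
  by (simp add: iw_prefix_def weight_def ratio_def lessThan_Suc_atMost)

lemma sets_tr [simp, measurable_cong]: "sets (tr th) = sets (mu H)"
  by (simp add: traj_def mu_def)

lemma space_tr [simp]: "space (tr th) = space (mu H)"
  by (simp add: traj_def mu_def)

lemma prob_space_tr: "prob_space (tr th)"
  unfolding traj_eq_path_law[OF H_pos] by (rule prob_space_path_law) (rule policy_pol)

lemma integrable_tr:
  fixes f :: "(nat \<Rightarrow> 's \<times> 'a) \<Rightarrow> 'e::euclidean_space"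
  assumes "f \<in> borel_measurable (mu H)" "\<And>t. t \<in> space (mu H) \<Longrightarrow> norm (f t) \<le> K"
  shows "integrable (tr th) f"
  using assms by (intro prob_space.integrable_bounded[OF prob_space_tr, of _ _ K]) auto

lemma measurable_ratio: "h < n \<Longrightarrow> ratio th th' h \<in> borel_measurable (mu n)"
  unfolding ratio_def by (intro borel_measurable_divide measurable_policy policy_pol)

lemma measurable_weight: "n \<le> m \<Longrightarrow> weight th th' n \<in> borel_measurable (mu m)"
  unfolding weight_def by (intro borel_measurable_prod measurable_ratio) auto

lemma ratio_bounds:
  assumes "t \<in> space (mu n)" "h < n"
  shows "exp (- (G * norm (th' - th))) \<le> ratio th th' h t" "ratio th th' h t \<le> exp (G * norm (th' - th))"
  using pol_ratio_bounds[of "fst (t h)" "snd (t h)"] space_mu_component[OF assms] by (auto simp: ratio_def)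

lemma ratio_pos: "t \<in> space (mu n) \<Longrightarrow> h < n \<Longrightarrow> ratio th th' h t > 0"
  using pol_pos space_mu_component[of t n h] by (simp add: ratio_def)

lemma weight_bounds:
  assumes "t \<in> space (mu m)" "n \<le> m"
  shows "0 < weight th th' n t" "weight th th' n t \<le> exp (G * norm (th' - th)) ^ n"
proof -
  show "0 < weight th th' n t"
    unfolding weight_def using assms by (intro prod_pos) (auto intro!: ratio_pos[of t m])
  have "weight th th' n t \<le> (\<Prod>h<n. exp (G * norm (th' - th)))"
    unfolding weight_def using assms
    by (intro prod_mono) (auto intro!: ratio_bounds[of t m] less_imp_le[OF ratio_pos[of t m]])
  then show "weight th th' n t \<le> exp (G * norm (th' - th)) ^ n" by simp
qed

text \<open>The weight produces trajectories that follow \<open>th'\<close> for \<open>n\<close>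
  steps and \<open>th\<close> afterwards; since \<open>f\<close> sees only the first
  \<open>n\<close> steps, the tail may be switched to \<open>th'\<close> as well.\<close>

lemma integral_reweight:
  fixes f :: "(nat \<Rightarrow> 's \<times> 'a) \<Rightarrow> 'e::{banach, second_countable_topology}"
  assumes n: "n \<le> H" and f: "f \<in> borel_measurable (mu n)"
    and fr: "\<And>t. t \<in> space (mu H) \<Longrightarrow> f (restrict t {..<n}) = f t"
  shows "(\<integral>t. weight th th' n t *\<^sub>R f t \<partial>tr th) = integral\<^sup>L (tr th') f"
proof -
  have fH: "f \<in> borel_measurable (mu H)"
    using measurable_compose[OF measurable_restrict_mu[OF n] f] by (rule measurable_cong[THEN iffD1, rotated]) (simp add: fr)
  have "(\<integral>t. weight th th' n t *\<^sub>R f t \<partial>tr th) = integral\<^sup>L (path_law (\<lambda>h. if h \<in> {..<n} then pol th' else pol th) H) f"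
    unfolding traj_eq_path_law[OF H_pos] weight_def ratio_def
    using n pol_pos by (intro integral_path_law_reweight policy_pol fH) auto
  also have "\<dots> = integral\<^sup>L (path_law (\<lambda>_. pol th') H) f"
    by (rule integral_path_law_prefix_cong[OF _ _ _ n f fr]) (auto simp: policy_pol)
  finally show ?thesis unfolding traj_eq_path_law[OF H_pos] .
qed

text \<open>Expresses that the step ratio has conditional mean 1 given the past: the ratio changes
  the policy only at step \<open>n\<close>, which \<open>f\<close> does not see.\<close>

lemma integral_step_reweight:
  fixes f :: "(nat \<Rightarrow> 's \<times> 'a) \<Rightarrow> 'e::{banach, second_countable_topology}"
  assumes n: "n < H" and f: "f \<in> borel_measurable (mu n)"
    and fr: "\<And>t. t \<in> space (mu H) \<Longrightarrow> f (restrict t {..<n}) = f t"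
  shows "(\<integral>t. ratio th th' n t *\<^sub>R f t \<partial>tr th) = integral\<^sup>L (tr th) f"
proof -
  have n': "n \<le> H" using n by simp
  have fH: "f \<in> borel_measurable (mu H)"
    using measurable_compose[OF measurable_restrict_mu[OF n'] f] by (rule measurable_cong[THEN iffD1, rotated]) (simp add: fr)
  have "(\<integral>t. ratio th th' n t *\<^sub>R f t \<partial>tr th)
     = (\<integral>t. (\<Prod>h\<in>{n}. pol th' (fst (t h)) (snd (t h)) / pol th (fst (t h)) (snd (t h))) *\<^sub>R f t \<partial>path_law (\<lambda>_. pol th) H)"
    unfolding traj_eq_path_law[OF H_pos] ratio_def by simp
  also have "\<dots> = integral\<^sup>L (path_law (\<lambda>h. if h \<in> {n} then pol th' else pol th) H) f"
    using n pol_pos by (intro integral_path_law_reweight policy_pol fH) auto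
  also have "\<dots> = integral\<^sup>L (path_law (\<lambda>_. pol th) H) f"
    by (rule integral_path_law_prefix_cong[OF _ _ _ n' f fr]) (auto simp: policy_pol)
  finally show ?thesis unfolding traj_eq_path_law[OF H_pos] .
qed

lemma weight_restrict: "weight th th' n (restrict t {..<n}) = weight th th' n t"
  by (simp add: weight_def ratio_def)

lemma integrable_weight_power: "n \<le> H \<Longrightarrow> integrable (tr th\<^sub>0) (\<lambda>t. weight th th' n t ^ k)"
proof (rule integrable_tr)
  assume n: "n \<le> H"
  then show "(\<lambda>t. weight th th' n t ^ k) \<in> borel_measurable (mu H)"
    by (intro borel_measurable_power measurable_weight)
  show "norm (weight th th' n t ^ k) \<le> (exp (G * norm (th' - th)) ^ n) ^ k" if "t \<in> space (mu H)" for t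
    using weight_bounds[OF that n, of th th'] by (auto intro!: power_mono simp: norm_power)
qed

lemma integrable_weight: "n \<le> H \<Longrightarrow> integrable (tr th\<^sub>0) (weight th th' n)"
  using integrable_weight_power[of n th\<^sub>0 th th' 1] by simp

lemma integral_weight: "n \<le> H \<Longrightarrow> integral\<^sup>L (tr th) (weight th th' n) = 1"
  using integral_reweight[of n "\<lambda>_. 1::real" th th'] prob_space.prob_space[OF prob_space_tr[of th']]
  by (simp del: space_tr)

lemma integral_ratio: "n < H \<Longrightarrow> integral\<^sup>L (tr th) (ratio th th' n) = 1"
  using integral_step_reweight[of n "\<lambda>_. 1::real" th th'] prob_space.prob_space[OF prob_space_tr[of th]]
  by (simp del: space_tr)

text \<open>A step ratio lies in \<open>[exp (-x), exp x]\<close> and has conditional mean 1, so that its conditional second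
  moment is at most \<open>exp x + exp (-x) - 1\<close>, uniformly in the past.\<close>

lemma integral_weight_square_le:
  fixes th th' :: 'd
  assumes "n \<le> H"
  defines "x \<equiv> G * norm (th' - th)"
  shows "(\<integral>t. (weight th th' n t)\<^sup>2 \<partial>tr th) \<le> (exp x + exp (- x) - 1) ^ n"
  using assms(1)
proof (induction n)
  case 0
  show ?case using prob_space.prob_space[OF prob_space_tr[of th]] by (simp add: weight_def del: space_tr)
next
  case (Suc n)
  define q where "q = exp x + exp (- x)"
  have "q \<ge> 2"
    using exp_ge_add_one_self[of x] exp_ge_add_one_self[of "- x"] unfolding q_def by linarith
  have i1: "integrable (tr th) (\<lambda>t. (weight th th' n t)\<^sup>2)" "integrable (tr th) (\<lambda>t. (weight th th' (Suc n) t)\<^sup>2)"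
    using Suc.prems by (auto intro!: integrable_weight_power)
  have i2: "integrable (tr th) (\<lambda>t. ratio th th' n t * (weight th th' n t)\<^sup>2)"
  proof (rule integrable_tr)
    show "(\<lambda>t. ratio th th' n t * (weight th th' n t)\<^sup>2) \<in> borel_measurable (mu H)"
      using Suc.prems by (intro borel_measurable_times borel_measurable_power measurable_weight measurable_ratio) auto
    show "norm (ratio th th' n t * (weight th th' n t)\<^sup>2) \<le> exp x * (exp x ^ n)\<^sup>2" if t: "t \<in> space (mu H)" for t
      using weight_bounds[OF t, of n th th'] ratio_bounds[OF t, where h=n and th=th and th'=th'] ratio_pos[OF t, of n th th'] Suc.prems
      by (auto simp: abs_mult x_def intro!: mult_mono power_mono)
  qed
  have "(\<integral>t. (weight th th' (Suc n) t)\<^sup>2 \<partial>tr th) \<le> (\<integral>t. q * (ratio th th' n t * (weight th th' n t)\<^sup>2) - (weight th th' n t)\<^sup>2 \<partial>tr th)"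
  proof (rule integral_mono[OF i1(2)])
    show "integrable (tr th) (\<lambda>t. q * (ratio th th' n t * (weight th th' n t)\<^sup>2) - (weight th th' n t)\<^sup>2)"
      using i1 i2 by simp
    fix t assume "t \<in> space (tr th)"
    then have t: "t \<in> space (mu H)" by simp
    \<comment> \<open>On the interval \<open>[exp (- x), exp x]\<close> the square lies below its
      chord. The chord is affine in the ratio, so its conditional mean is known from the mean of the
      ratio alone.\<close>
    have "0 \<le> (ratio th th' n t - exp (- x)) * (exp x - ratio th th' n t)"
      using ratio_bounds[OF t, where h=n and th=th and th'=th'] Suc.prems by (intro mult_nonneg_nonneg) (auto simp: x_def)
    also have "\<dots> = q * ratio th th' n t - 1 - (ratio th th' n t)\<^sup>2"
      by (simp add: q_def algebra_simps power2_eq_square flip: exp_add)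
    finally have "(ratio th th' n t)\<^sup>2 \<le> q * ratio th th' n t - 1" by simp
    from mult_left_mono[OF this, of "(weight th th' n t)\<^sup>2"]
    show "(weight th th' (Suc n) t)\<^sup>2 \<le> q * (ratio th th' n t * (weight th th' n t)\<^sup>2) - (weight th th' n t)\<^sup>2"
      by (simp add: weight_def power_mult_distrib algebra_simps)
  qed
  also have "\<dots> = q * (\<integral>t. ratio th th' n t * (weight th th' n t)\<^sup>2 \<partial>tr th) - (\<integral>t. (weight th th' n t)\<^sup>2 \<partial>tr th)"
    using i1 i2 by simp
  also have "(\<integral>t. ratio th th' n t * (weight th th' n t)\<^sup>2 \<partial>tr th) = (\<integral>t. (weight th th' n t)\<^sup>2 \<partial>tr th)"
    using Suc.prems integral_step_reweight[of n "\<lambda>t. (weight th th' n t)\<^sup>2" th th'] measurable_weight[of n n th th']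
    by (simp add: weight_restrict del: restrict_apply)
  also have "q * (\<integral>t. (weight th th' n t)\<^sup>2 \<partial>tr th) - (\<integral>t. (weight th th' n t)\<^sup>2 \<partial>tr th)
      = (q - 1) * (\<integral>t. (weight th th' n t)\<^sup>2 \<partial>tr th)" by (simp add: algebra_simps)
  also have "\<dots> \<le> (q - 1) * (q - 1) ^ n"
    using Suc \<open>q \<ge> 2\<close> by (intro mult_left_mono) (auto simp: q_def)
  finally show ?case by (simp add: q_def)
qed

lemma integral_weight_diff_square_le:
  fixes th th' :: 'd
  assumes "n \<le> H"
  defines "x \<equiv> G * norm (th' - th)"
  shows "(\<integral>t. (1 - weight th th' n t)\<^sup>2 \<partial>tr th) \<le> (exp x + exp (- x) - 1) ^ n - 1"
proof -
  interpret T: prob_space "tr th" by (rule prob_space_tr)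
  have "(\<integral>t. (1 - weight th th' n t)\<^sup>2 \<partial>tr th) = (\<integral>t. 1 - 2 * weight th th' n t + (weight th th' n t)\<^sup>2 \<partial>tr th)"
    by (simp add: power2_diff algebra_simps)
  also have "\<dots> = (\<integral>t. (weight th th' n t)\<^sup>2 \<partial>tr th) - 1"
    using integrable_weight[OF assms(1), of th th th'] integrable_weight_power[OF assms(1), of th th th' 2]
      integral_weight[OF assms(1), of th th'] T.prob_space by simp
  finally show ?thesis using integral_weight_square_le[OF assms(1), of th th'] by (simp add: x_def)
qed

section \<open>Logarithms of weights and the divergence between trajectory laws\<close>

lemma ln_weight: "t \<in> space (mu m) \<Longrightarrow> n \<le> m \<Longrightarrow> ln (weight th th' n t) = (\<Sum>h<n. ln (ratio th th' h t))"
  unfolding weight_def using ratio_pos[of t m _ th th'] by (intro ln_prod) (auto simp: less_le)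

lemma ln_ratio:
  assumes "t \<in> space (mu m)" "h < m"
  shows "ln (ratio th th' h t) = ln (pol th' (fst (t h)) (snd (t h))) - ln (pol th (fst (t h)) (snd (t h)))"
proof -
  have "pol th (fst (t h)) (snd (t h)) > 0" "pol th' (fst (t h)) (snd (t h)) > 0"
    using pol_pos space_mu_component[OF assms] by auto
  then show ?thesis unfolding ratio_def by (simp add: ln_div)
qed

lemma abs_ln_ratio_le:
  assumes "t \<in> space (mu m)" "h < m"
  shows "\<bar>ln (ratio th th' h t)\<bar> \<le> G * norm (th' - th)"
  unfolding ln_ratio[OF assms] using ln_pol_lipschitz space_mu_component[OF assms] by auto

lemma integrable_ln_weight:
  assumes "n \<le> H"
  shows "integrable (tr th\<^sub>0) (\<lambda>t. ln (weight th th' n t))"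
proof (rule integrable_tr)
  show "(\<lambda>t. ln (weight th th' n t)) \<in> borel_measurable (mu H)"
    using measurable_weight[OF assms, of th th'] by simp
  show "norm (ln (weight th th' n t)) \<le> (\<Sum>h<n. G * norm (th' - th))" if t: "t \<in> space (mu H)" for t
    unfolding ln_weight[OF t assms] using assms
    by (intro sum_norm_le) (auto intro!: abs_ln_ratio_le[OF t])
qed

text \<open>The left-hand side is a Kullback--Leibler divergence, hence additive over the time steps.\<close>

lemma integral_weight_sub_ln_le:
  assumes n: "n \<le> H" and x: "G * norm (th' - th) \<le> 41/32"
  shows "(\<integral>t. weight th th' n t - 1 - ln (weight th th' n t) \<partial>tr th) \<le> real n * (G * norm (th' - th))\<^sup>2"
proof -
  interpret T: prob_space "tr th" by (rule prob_space_tr)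
  have ir: "integrable (tr th) (ratio th th' h)" if "h < n" for h
  proof (rule integrable_tr)
    show "ratio th th' h \<in> borel_measurable (mu H)" using that n by (intro measurable_ratio) auto
    show "norm (ratio th th' h t) \<le> exp (G * norm (th' - th))" if t: "t \<in> space (mu H)" for t
      using ratio_bounds[OF t, where h=h and th=th and th'=th'] ratio_pos[OF t, of h th th'] \<open>h < n\<close> n by auto
  qed
  have "(\<integral>t. weight th th' n t - 1 - ln (weight th th' n t) \<partial>tr th) = - (\<integral>t. ln (weight th th' n t) \<partial>tr th)"
    using integrable_weight[OF n, of th th th'] integrable_ln_weight[OF n, of th th th'] integral_weight[OF n, of th th'] T.prob_space
    by simp
  \<comment> \<open>Each \<open>ratio - 1\<close> has mean zero and is added for free. It
    compensates the linear part of the logarithm step by step, which avoids the product that makes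
    up the weight.\<close>
  also have "\<dots> = (\<integral>t. (\<Sum>h<n. ratio th th' h t - 1) - ln (weight th th' n t) \<partial>tr th)"
  proof -
    have "(\<integral>t. (\<Sum>h<n. ratio th th' h t - 1) \<partial>tr th) = (\<Sum>h<n. \<integral>t. ratio th th' h t - 1 \<partial>tr th)"
      by (rule Bochner_Integration.integral_sum) (auto simp: ir)
    also have "\<dots> = 0"
      by (rule sum.neutral) (use n ir integral_ratio[of _ th th'] T.prob_space in auto)
    moreover have "integrable (tr th) (\<lambda>t. \<Sum>h<n. ratio th th' h t - 1)"
      by (rule Bochner_Integration.integrable_sum) (auto simp: ir)
    ultimately show ?thesis using integrable_ln_weight[OF n, of th th th'] by simp
  qed
  also have "\<dots> \<le> (\<integral>t. (\<Sum>h<n. (G * norm (th' - th))\<^sup>2) \<partial>tr th)"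
  proof (rule integral_mono)
    show "integrable (tr th) (\<lambda>t. (\<Sum>h<n. ratio th th' h t - 1) - ln (weight th th' n t))"
      using integrable_ln_weight[OF n, of th th th'] ir
      by (intro Bochner_Integration.integrable_diff Bochner_Integration.integrable_sum) auto
    fix t assume "t \<in> space (tr th)"
    then have t: "t \<in> space (mu H)" by simp
    have "(\<Sum>h<n. ratio th th' h t - 1) - ln (weight th th' n t) = (\<Sum>h<n. ratio th th' h t - 1 - ln (ratio th th' h t))"
      by (simp add: ln_weight[OF t n] sum_subtractf)
    also have "\<dots> \<le> (\<Sum>h<n. (G * norm (th' - th))\<^sup>2)"
    proof (rule sum_mono)
      fix h assume h: "h \<in> {..<n}"
      let ?y = "ln (ratio th th' h t)"
      have y: "\<bar>?y\<bar> \<le> G * norm (th' - th)" using h n by (intro abs_ln_ratio_le[OF t]) auto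
      have "ratio th th' h t = exp ?y" using ratio_pos[OF t, of h th th'] h n by simp
      also have "\<dots> \<le> 1 + ?y + ?y\<^sup>2" using y x by (intro exp_le_quadratic) auto
      finally have "ratio th th' h t - 1 - ?y \<le> ?y\<^sup>2" by simp
      also have "\<dots> \<le> (G * norm (th' - th))\<^sup>2" using y by (metis abs_ge_zero power2_abs power_mono)
      finally show "ratio th th' h t - 1 - ?y \<le> (G * norm (th' - th))\<^sup>2" .
    qed
    finally show "(\<Sum>h<n. ratio th th' h t - 1) - ln (weight th th' n t) \<le> (\<Sum>h<n. (G * norm (th' - th))\<^sup>2)" .
  qed simp
  finally show ?thesis using T.prob_space by simp
qed

end

section \<open>The policy gradient and the off-policy correction\<close>

context pg
begin

abbreviation rw :: "nat \<Rightarrow> (nat \<Rightarrow> 's \<times> 'a) \<Rightarrow> real" where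
  "rw h t \<equiv> r (fst (t h)) (snd (t h))"

text \<open>Defined as the mean of the on-policy estimator, so unbiasedness is immediate; the burden
  moves to \<open>grad_V\<close>, which identifies it with the gradient of \<open>V\<close>.\<close>

definition pgrad :: "'d \<Rightarrow> 'd" where
  "pgrad th = (\<integral>t. gpomdp r gm H pol th t \<partial>tr th)"

definition lip :: real where
  "lip = M * R / (1 - gm)\<^sup>2 + 2 * G\<^sup>2 * R / (1 - gm) ^ 3"

definition grad_bound :: real where
  "grad_bound = R * G / (1 - gm)\<^sup>2"

lemma abs_rw_le: "t \<in> space (mu m) \<Longrightarrow> h < m \<Longrightarrow> \<bar>rw h t\<bar> \<le> R"
  using r_bound space_mu_component[of t m h] by auto

lemma norm_Zsum_le:
  assumes t: "t \<in> space (mu m)" and "h < m"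
  shows "norm (Zsum pol th h t) \<le> (real h + 1) * G"
proof -
  have "norm (Zsum pol th h t) \<le> (\<Sum>z\<le>h. G)"
    unfolding Zsum_def using score_bound space_mu_component[OF t] \<open>h < m\<close>
    by (intro sum_norm_le) auto
  then show ?thesis by (simp add: add.commute)
qed

lemma norm_Zsum_diff_le:
  assumes t: "t \<in> space (mu m)" and "h < m"
  shows "norm (Zsum pol th' h t - Zsum pol th h t) \<le> (real h + 1) * (M * norm (th' - th))"
proof -
  have "norm (Zsum pol th' h t - Zsum pol th h t) \<le> (\<Sum>z\<le>h. M * norm (th' - th))"
    unfolding Zsum_def sum_subtractf[symmetric] using score_lipschitz space_mu_component[OF t] \<open>h < m\<close>
    by (intro sum_norm_le) auto
  then show ?thesis by (simp add: add.commute)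
qed

lemma abs_disc_return_le:
  assumes t: "t \<in> space (mu H)"
  shows "\<bar>disc_return r gm H t\<bar> \<le> R / (1 - gm)"
proof -
  have "\<bar>disc_return r gm H t\<bar> \<le> (\<Sum>h<H. gm ^ h * R)"
    unfolding disc_return_def
  proof (rule order_trans[OF sum_abs sum_mono])
    fix h assume "h \<in> {..<H}"
    then show "\<bar>gm ^ h * rw h t\<bar> \<le> gm ^ h * R"
      using abs_rw_le[OF t, of h] gm by (simp add: abs_mult)
  qed
  also have "\<dots> = R * (\<Sum>h<H. gm ^ h)" by (simp add: sum_distrib_left mult.commute)
  also have "\<dots> \<le> R * (1 / (1 - gm))"
    using gm R_pos by (intro mult_left_mono sum_geometric_le) auto
  finally show ?thesis by simp
qed

lemma norm_gpomdp_le: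
  assumes t: "t \<in> space (mu H)"
  shows "norm (gpomdp r gm H pol th t) \<le> grad_bound"
proof -
  have "norm (gpomdp r gm H pol th t) \<le> (\<Sum>h<H. (R * G) * (gm ^ h * (real h + 1)))"
    unfolding gpomdp_def
  proof (rule sum_norm_le)
    fix h assume "h \<in> {..<H}"
    then have h: "h < H" by simp
    have "norm ((gm ^ h * rw h t) *\<^sub>R Zsum pol th h t) = gm ^ h * (\<bar>rw h t\<bar> * norm (Zsum pol th h t))"
      using gm by (simp add: abs_mult)
    also have "\<dots> \<le> gm ^ h * (R * ((real h + 1) * G))"
      using gm R_pos G_pos by (intro mult_left_mono mult_mono abs_rw_le[OF t h] norm_Zsum_le[OF t h]) auto
    finally show "norm ((gm ^ h * rw h t) *\<^sub>R Zsum pol th h t) \<le> (R * G) * (gm ^ h * (real h + 1))"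
      by (simp add: algebra_simps)
  qed
  also have "\<dots> = (R * G) * (\<Sum>h<H. gm ^ h * (real h + 1))" by (simp add: sum_distrib_left)
  also have "\<dots> \<le> (R * G) * (1 / (1 - gm)\<^sup>2)"
    using gm R_pos G_pos by (intro mult_left_mono sum_geometric_deriv_le) auto
  finally show ?thesis by (simp add: grad_bound_def)
qed

lemma measurable_rw: "h < n \<Longrightarrow> rw h \<in> borel_measurable (mu n)"
  using measurable_reward_component[of "\<lambda>t. t" "mu n" n h] by simp

lemma measurable_Zsum: "h < n \<Longrightarrow> Zsum pol th h \<in> borel_measurable (mu n)"
  using measurable_Zsum_comp[of "\<lambda>_. th" "mu n" "\<lambda>t. t" n h] by simp

lemma measurable_gpomdp [measurable]: "gpomdp r gm H pol th \<in> borel_measurable (mu H)"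
  using measurable_gpomdp_comp[of "\<lambda>_. th" "mu H" "\<lambda>t. t"] by simp

lemma measurable_gpomdp_off [measurable]: "gpomdp_off r gm H pol th th' \<in> borel_measurable (mu H)"
  using measurable_gpomdp_off_comp[of "\<lambda>_. th" "mu H" "\<lambda>_. th'" "\<lambda>t. t"] by simp

lemma measurable_disc_return [measurable]: "disc_return r gm H \<in> borel_measurable (mu H)"
  unfolding disc_return_def by (intro borel_measurable_sum borel_measurable_times measurable_rw) auto

lemma integrable_gpomdp: "integrable (tr th\<^sub>0) (gpomdp r gm H pol th)"
  by (rule integrable_tr[OF measurable_gpomdp norm_gpomdp_le])

lemma integrable_disc_return: "integrable (tr th) (disc_return r gm H)"
  by (rule integrable_tr[OF measurable_disc_return, of "R / (1 - gm)"]) (simp add: abs_disc_return_le)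

lemma abs_V_le: "\<bar>V th\<bar> \<le> R / (1 - gm)"
proof -
  interpret T: prob_space "tr th" by (rule prob_space_tr)
  have "\<bar>V th\<bar> \<le> (\<integral>t. \<bar>disc_return r gm H t\<bar> \<partial>tr th)"
    unfolding Vf_def by (rule integral_abs_bound)
  also have "\<dots> \<le> (\<integral>t. R / (1 - gm) \<partial>tr th)"
    using integrable_disc_return[of th] by (intro integral_mono) (auto intro!: abs_disc_return_le)
  finally show ?thesis using T.prob_space by simp
qed

lemma norm_pgrad_le: "norm (pgrad th) \<le> grad_bound"
proof -
  interpret T: prob_space "tr th" by (rule prob_space_tr)
  have "norm (pgrad th) \<le> (\<integral>t. norm (gpomdp r gm H pol th t) \<partial>tr th)"
    unfolding pgrad_def by (rule integral_norm_bound)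
  also have "\<dots> \<le> (\<integral>t. grad_bound \<partial>tr th)"
    using integrable_gpomdp by (intro integral_mono) (auto intro!: norm_gpomdp_le)
  finally show ?thesis using T.prob_space by simp
qed

text \<open>The reward at time \<open>h\<close> depends on \<open>h + 1\<close> steps only, so it
  needs no more than the weight of that prefix. Values at two parameters thereby become expectations
  under one law and can be compared pointwise.\<close>

lemma V_reweight: "V th' = (\<integral>t. (\<Sum>h<H. gm ^ h * (weight th th' (Suc h) t * rw h t)) \<partial>tr th)"
  and integrable_V_reweight: "integrable (tr th) (\<lambda>t. \<Sum>h<H. gm ^ h * (weight th th' (Suc h) t * rw h t))"
proof -
  have ir: "integrable (tr th') (rw h)" if "h < H" for h
    using that by (intro integrable_tr[of _ R] measurable_rw) (auto simp: abs_rw_le)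
  have iw: "integrable (tr th) (\<lambda>t. weight th th' (Suc h) t * rw h t)" if h: "h < H" for h
  proof (rule integrable_tr)
    show "(\<lambda>t. weight th th' (Suc h) t * rw h t) \<in> borel_measurable (mu H)"
      using h by (intro borel_measurable_times measurable_weight measurable_rw) auto
    show "norm (weight th th' (Suc h) t * rw h t) \<le> exp (G * norm (th' - th)) ^ Suc h * R" if t: "t \<in> space (mu H)" for t
      using weight_bounds[OF t, of "Suc h" th th'] abs_rw_le[OF t h] h
      by (auto simp: abs_mult simp del: power_Suc intro!: mult_mono)
  qed
  then show "integrable (tr th) (\<lambda>t. \<Sum>h<H. gm ^ h * (weight th th' (Suc h) t * rw h t))"
    by (intro Bochner_Integration.integrable_sum) auto
  have "V th' = (\<Sum>h<H. gm ^ h * (\<integral>t. rw h t \<partial>tr th'))"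
    unfolding Vf_def disc_return_def using ir
    by (subst Bochner_Integration.integral_sum) auto
  also have "\<dots> = (\<Sum>h<H. gm ^ h * (\<integral>t. weight th th' (Suc h) t * rw h t \<partial>tr th))"
  proof (intro sum.cong refl)
    fix h assume h: "h \<in> {..<H}"
    then show "gm ^ h * (\<integral>t. rw h t \<partial>tr th') = gm ^ h * (\<integral>t. weight th th' (Suc h) t * rw h t \<partial>tr th)"
      using integral_reweight[of "Suc h" "rw h" th th'] measurable_rw[of h "Suc h"] by simp
  qed
  also have "\<dots> = (\<integral>t. (\<Sum>h<H. gm ^ h * (weight th th' (Suc h) t * rw h t)) \<partial>tr th)"
    using iw by (subst Bochner_Integration.integral_sum) auto
  finally show "V th' = (\<integral>t. (\<Sum>h<H. gm ^ h * (weight th th' (Suc h) t * rw h t)) \<partial>tr th)" .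
qed

text \<open>\<open>Zsum\<close> is the gradient at \<open>th\<close> of the log-weight, which is a
  sum over steps, so the Taylor remainders of \<open>ln pol\<close> simply add up.\<close>

lemma abs_ln_weight_sub_Zsum_le:
  assumes t: "t \<in> space (mu H)" and h: "h < H"
  shows "\<bar>ln (weight th th' (Suc h) t) - Zsum pol th h t \<bullet> (th' - th)\<bar> \<le> (real h + 1) * (M / 2 * (norm (th' - th))\<^sup>2)"
proof -
  have "ln (weight th th' (Suc h) t) - Zsum pol th h t \<bullet> (th' - th)
     = (\<Sum>z\<le>h. ln (ratio th th' z t) - score pol th (fst (t z)) (snd (t z)) \<bullet> (th' - th))"
    using h by (subst ln_weight[OF t]) (auto simp: Zsum_def lessThan_Suc_atMost inner_sum_left sum_subtractf)
  also have "\<bar>\<dots>\<bar> \<le> (\<Sum>z\<le>h. M / 2 * (norm (th' - th))\<^sup>2)"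
  proof (rule order_trans[OF sum_abs sum_mono])
    fix z assume "z \<in> {..h}"
    then have z: "z < H" using h by simp
    show "\<bar>ln (ratio th th' z t) - score pol th (fst (t z)) (snd (t z)) \<bullet> (th' - th)\<bar> \<le> M / 2 * (norm (th' - th))\<^sup>2"
      unfolding ln_ratio[OF t z] using ln_pol_taylor space_mu_component[OF t z] by blast
  qed
  finally show ?thesis by (simp add: add.commute)
qed

text \<open>For each reward, \<open>weight - 1 - Zsum \<bullet> d\<close> splits into
  \<open>weight - 1 - ln weight\<close>, small in mean by the divergence bound, and
  \<open>ln weight - Zsum \<bullet> d\<close>, small pointwise. Both bounds are linear in
  \<open>h + 1\<close>, so the discounted sum costs only \<open>1 / (1 - gm)^2\<close>.\<close>

lemma V_quadratic_bound:
  assumes x: "G * norm (th' - th) \<le> 41/32"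
  shows "\<bar>V th' - V th - pgrad th \<bullet> (th' - th)\<bar> \<le> R * (G\<^sup>2 + M / 2) / (1 - gm)\<^sup>2 * (norm (th' - th))\<^sup>2"
proof -
  interpret T: prob_space "tr th" by (rule prob_space_tr)
  let ?d = "th' - th"
  define F where "F t = (\<Sum>h<H. gm ^ h * (weight th th' (Suc h) t * rw h t)) - disc_return r gm H t - gpomdp r gm H pol th t \<bullet> ?d" for t
  define k where "k h t = weight th th' (Suc h) t - 1 - ln (weight th th' (Suc h) t)" for h t
  define B where "B t = (\<Sum>h<H. (gm ^ h * R) * (k h t + (real h + 1) * (M / 2 * (norm ?d)\<^sup>2)))" for t
  have iF: "integrable (tr th) F"
    using integrable_V_reweight integrable_disc_return integrable_gpomdp unfolding F_def[abs_def] by auto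
  have ik: "integrable (tr th) (k h)" if "h < H" for h
    using that integrable_weight[of "Suc h" th th th'] integrable_ln_weight[of "Suc h" th th th'] unfolding k_def[abs_def] by auto
  have VF: "V th' - V th - pgrad th \<bullet> ?d = integral\<^sup>L (tr th) F"
    unfolding V_reweight[of th' th] pgrad_def
    using integrable_V_reweight[of th th'] integrable_disc_return[of th] integrable_gpomdp[of th th]
    by (simp add: Vf_def F_def[abs_def])
  have "\<bar>integral\<^sup>L (tr th) F\<bar> \<le> (\<integral>t. \<bar>F t\<bar> \<partial>tr th)" by (rule integral_abs_bound)
  also have "\<dots> \<le> (\<integral>t. B t \<partial>tr th)"
  proof (rule integral_mono)
    show "integrable (tr th) (\<lambda>t. \<bar>F t\<bar>)" using iF by (rule integrable_abs)
    show "integrable (tr th) B" unfolding B_def[abs_def] using ik by (intro Bochner_Integration.integrable_sum) auto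
    fix t assume "t \<in> space (tr th)"
    then have t: "t \<in> space (mu H)" by simp
    have Ft: "F t = (\<Sum>h<H. (gm ^ h * rw h t) * (weight th th' (Suc h) t - 1 - Zsum pol th h t \<bullet> ?d))"
      by (simp add: F_def disc_return_def gpomdp_def inner_sum_left sum_subtractf[symmetric] algebra_simps)
    show "\<bar>F t\<bar> \<le> B t"
      unfolding Ft B_def
    proof (rule order_trans[OF sum_abs sum_mono])
      fix h assume "h \<in> {..<H}"
      then have h: "h < H" by simp
      have "ln (weight th th' (Suc h) t) \<le> weight th th' (Suc h) t - 1"
        using weight_bounds(1)[OF t, of "Suc h" th th'] h by (intro ln_le_minus_one) auto
      then have "\<bar>weight th th' (Suc h) t - 1 - Zsum pol th h t \<bullet> ?d\<bar>
          \<le> k h t + (real h + 1) * (M / 2 * (norm ?d)\<^sup>2)"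
        using abs_ln_weight_sub_Zsum_le[OF t h, of th th'] unfolding k_def by linarith
      then show "\<bar>(gm ^ h * rw h t) * (weight th th' (Suc h) t - 1 - Zsum pol th h t \<bullet> ?d)\<bar>
          \<le> (gm ^ h * R) * (k h t + (real h + 1) * (M / 2 * (norm ?d)\<^sup>2))"
        unfolding abs_mult using gm R_pos abs_rw_le[OF t h] by (intro mult_mono) auto
    qed
  qed
  also have "\<dots> = (\<Sum>h<H. (gm ^ h * R) * (integral\<^sup>L (tr th) (k h) + (real h + 1) * (M / 2 * (norm ?d)\<^sup>2)))"
    unfolding B_def[abs_def] using ik T.prob_space by (subst Bochner_Integration.integral_sum) auto
  also have "\<dots> \<le> (\<Sum>h<H. (gm ^ h * R) * (real (Suc h) * (G * norm ?d)\<^sup>2 + (real h + 1) * (M / 2 * (norm ?d)\<^sup>2)))"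
    unfolding k_def[abs_def] using gm R_pos x by (intro sum_mono mult_left_mono add_right_mono integral_weight_sub_ln_le) auto
  also have "\<dots> = (R * (G\<^sup>2 + M / 2) * (norm ?d)\<^sup>2) * (\<Sum>h<H. gm ^ h * (real h + 1))"
    unfolding sum_distrib_left by (intro sum.cong refl) (simp add: algebra_simps power_mult_distrib)
  also have "\<dots> \<le> (R * (G\<^sup>2 + M / 2) * (norm ?d)\<^sup>2) * (1 / (1 - gm)\<^sup>2)"
    using gm R_pos M_pos by (intro mult_left_mono sum_geometric_deriv_le) auto
  finally show ?thesis unfolding VF by simp
qed

text \<open>Within distance \<open>1 / G\<close> the scaled step is below 1, hence below 41/32, and
  the quadratic expansion applies.\<close>

lemma V_has_derivative: "(V has_derivative (\<lambda>d. pgrad th \<bullet> d)) (at th)"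
proof (rule has_derivative_of_quadratic_bound)
  show "(1::real) / G > 0" using G_pos by simp
  fix th' assume "norm (th' - th) < 1 / G"
  then have "G * norm (th' - th) \<le> 41/32" using G_pos by (simp add: field_simps)
  then show "\<bar>V th' - V th - pgrad th \<bullet> (th' - th)\<bar> \<le> R * (G\<^sup>2 + M / 2) / (1 - gm)\<^sup>2 * (norm (th' - th))\<^sup>2"
    by (rule V_quadratic_bound)
qed

lemma grad_V: "grad V th = pgrad th"
  by (rule grad_eqI[OF V_has_derivative])

lemma V_ascent:
  assumes x: "G * norm (th' - th) \<le> 41/32"
  shows "V th + pgrad th \<bullet> (th' - th) - lip / 2 * (norm (th' - th))\<^sup>2 \<le> V th'"
proof -
  \<comment> \<open>The two terms on the left are the halves of the summands of \<open>lip\<close>,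
    up to one spare factor \<open>1 / (1 - gm)\<close> in the second.\<close>
  have "R * (G\<^sup>2 + M / 2) / (1 - gm)\<^sup>2 \<le> lip / 2"
  proof -
    have "R * G\<^sup>2 / (1 - gm)\<^sup>2 \<le> R * G\<^sup>2 / (1 - gm) ^ 3"
      using gm R_pos by (intro divide_left_mono power_decreasing) auto
    then show ?thesis by (simp add: lip_def algebra_simps add_divide_distrib)
  qed
  from mult_right_mono[OF this zero_le_power2[of "norm (th' - th)"]] V_quadratic_bound[OF x]
  show ?thesis by linarith
qed

section \<open>Mean and second moment of the off-policy correction\<close>

definition correction :: "'d \<Rightarrow> 'd \<Rightarrow> (nat \<Rightarrow> 's \<times> 'a) \<Rightarrow> 'd" where
  "correction th th' t = gpomdp r gm H pol th' t - gpomdp_off r gm H pol th' th t"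

lemma measurable_correction [measurable]: "correction th th' \<in> borel_measurable (mu H)"
  unfolding correction_def by measurable

text \<open>Separates the two sources of the difference: the change of the score, which is Lipschitz
  and bounded here pointwise, and the deviation of the weights from 1, which is kept as a sum
  because it can only be controlled in mean square.\<close>

lemma norm_correction_le:
  assumes t: "t \<in> space (mu H)"
  shows "norm (correction th th' t)
    \<le> M * R / (1 - gm)\<^sup>2 * norm (th' - th)
      + R * G * (\<Sum>h<H. gm ^ h * (real h + 1) * \<bar>1 - weight th' th (Suc h) t\<bar>)"
proof -
  let ?d = "norm (th' - th)"
  have eq: "correction th th' t = (\<Sum>h<H. (gm ^ h * rw h t) *\<^sub>R
      ((Zsum pol th' h t - Zsum pol th h t) + (1 - weight th' th (Suc h) t) *\<^sub>R Zsum pol th h t))"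
    unfolding correction_def gpomdp_def gpomdp_off_def iw_prefix_eq_weight sum_subtractf[symmetric]
    by (intro sum.cong refl) (simp add: algebra_simps)
  have "norm (correction th th' t) \<le> (\<Sum>h<H. (R * M * ?d) * (gm ^ h * (real h + 1))
        + (R * G) * (gm ^ h * (real h + 1) * \<bar>1 - weight th' th (Suc h) t\<bar>))"
    unfolding eq
  proof (rule sum_norm_le)
    fix h assume "h \<in> {..<H}"
    then have h: "h < H" by simp
    have "norm ((Zsum pol th' h t - Zsum pol th h t) + (1 - weight th' th (Suc h) t) *\<^sub>R Zsum pol th h t)
       \<le> (real h + 1) * (M * ?d) + \<bar>1 - weight th' th (Suc h) t\<bar> * ((real h + 1) * G)"
      by (rule norm_triangle_mono[OF norm_Zsum_diff_le[OF t h]])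
        (simp add: mult_left_mono norm_Zsum_le[OF t h])
    then have "\<bar>gm ^ h * rw h t\<bar> * norm ((Zsum pol th' h t - Zsum pol th h t) + (1 - weight th' th (Suc h) t) *\<^sub>R Zsum pol th h t)
       \<le> (gm ^ h * R) * ((real h + 1) * (M * ?d) + \<bar>1 - weight th' th (Suc h) t\<bar> * ((real h + 1) * G))"
      using gm R_pos abs_rw_le[OF t h] by (intro mult_mono) (auto simp: abs_mult)
    then show "norm ((gm ^ h * rw h t) *\<^sub>R ((Zsum pol th' h t - Zsum pol th h t) + (1 - weight th' th (Suc h) t) *\<^sub>R Zsum pol th h t))
       \<le> (R * M * ?d) * (gm ^ h * (real h + 1)) + (R * G) * (gm ^ h * (real h + 1) * \<bar>1 - weight th' th (Suc h) t\<bar>)"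
      unfolding norm_scaleR by (rule order_trans) (simp add: algebra_simps)
  qed
  also have "\<dots> = (R * M * ?d) * (\<Sum>h<H. gm ^ h * (real h + 1))
        + (R * G) * (\<Sum>h<H. gm ^ h * (real h + 1) * \<bar>1 - weight th' th (Suc h) t\<bar>)"
    by (simp add: sum.distrib sum_distrib_left)
  also have "\<dots> \<le> (R * M * ?d) * (1 / (1 - gm)\<^sup>2)
        + (R * G) * (\<Sum>h<H. gm ^ h * (real h + 1) * \<bar>1 - weight th' th (Suc h) t\<bar>)"
    using gm R_pos M_pos by (intro add_right_mono mult_left_mono sum_geometric_deriv_le) auto
  finally show ?thesis by (simp add: mult_ac)
qed

text \<open>The bound is exponential in the distance of the parameters and serves integrability
  only.\<close>

lemma norm_correction_bounded: "\<exists>K. \<forall>t\<in>space (mu H). norm (correction th th' t) \<le> K"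
proof (intro exI ballI)
  fix t assume t: "t \<in> space (mu H)"
  let ?W = "\<lambda>h. 1 + exp (G * norm (th' - th)) ^ Suc h"
  have "\<bar>1 - weight th' th (Suc h) t\<bar> \<le> ?W h" if "h < H" for h
    using weight_bounds[OF t, of "Suc h" th' th] that by (simp add: norm_minus_commute abs_le_iff)
  then show "norm (correction th th' t) \<le> M * R / (1 - gm)\<^sup>2 * norm (th' - th)
      + R * G * (\<Sum>h<H. gm ^ h * (real h + 1) * ?W h)"
    using gm R_pos G_pos
    by (intro order_trans[OF norm_correction_le[OF t]] add_left_mono mult_left_mono sum_mono) auto
qed

text \<open>Each summand of the off-policy estimator carries the weight of exactly the prefix it
  depends on, so reweighting makes it unbiased for the gradient at \<open>th\<close>.\<close>

lemma integral_correction: "integral\<^sup>L (tr th') (correction th th') = pgrad th' - pgrad th"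
proof -
  have i: "integrable (tr th\<^sub>0) (\<lambda>t. rw h t *\<^sub>R Zsum pol th h t)" if h: "h < H" for h th\<^sub>0
  proof (rule integrable_tr)
    show "(\<lambda>t. rw h t *\<^sub>R Zsum pol th h t) \<in> borel_measurable (mu H)"
      using h by (intro borel_measurable_scaleR measurable_rw measurable_Zsum)
    show "norm (rw h t *\<^sub>R Zsum pol th h t) \<le> R * ((real h + 1) * G)" if t: "t \<in> space (mu H)" for t
      using abs_rw_le[OF t h] norm_Zsum_le[OF t h] R_pos by (auto intro!: mult_mono)
  qed
  have iw: "integrable (tr th') (\<lambda>t. weight th' th (Suc h) t *\<^sub>R (rw h t *\<^sub>R Zsum pol th h t))" if h: "h < H" for h
  proof (rule integrable_tr)
    show "(\<lambda>t. weight th' th (Suc h) t *\<^sub>R (rw h t *\<^sub>R Zsum pol th h t)) \<in> borel_measurable (mu H)"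
      using h by (intro borel_measurable_scaleR measurable_rw measurable_Zsum measurable_weight) auto
    show "norm (weight th' th (Suc h) t *\<^sub>R (rw h t *\<^sub>R Zsum pol th h t))
      \<le> exp (G * norm (th - th')) ^ Suc h * (R * ((real h + 1) * G))" if t: "t \<in> space (mu H)" for t
      unfolding norm_scaleR
      using weight_bounds[OF t, of "Suc h" th' th] abs_rw_le[OF t h] norm_Zsum_le[OF t h, of th] R_pos G_pos h
      by (intro mult_mono) (auto simp del: power_Suc)
  qed
  have eq: "gpomdp_off r gm H pol th' th t
      = (\<Sum>h<H. gm ^ h *\<^sub>R (weight th' th (Suc h) t *\<^sub>R (rw h t *\<^sub>R Zsum pol th h t)))" for t
    by (simp add: gpomdp_off_def iw_prefix_eq_weight mult_ac)
  have ioff: "integrable (tr th') (gpomdp_off r gm H pol th' th)"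
    unfolding eq using iw by (intro Bochner_Integration.integrable_sum integrable_scaleR_right) auto
  have "integral\<^sup>L (tr th') (gpomdp_off r gm H pol th' th)
     = (\<Sum>h<H. gm ^ h *\<^sub>R (\<integral>t. weight th' th (Suc h) t *\<^sub>R (rw h t *\<^sub>R Zsum pol th h t) \<partial>tr th'))"
    unfolding eq using iw by (subst Bochner_Integration.integral_sum) (auto simp del: scaleR_scaleR)
  also have "\<dots> = (\<Sum>h<H. gm ^ h *\<^sub>R (\<integral>t. rw h t *\<^sub>R Zsum pol th h t \<partial>tr th))"
  proof (intro sum.cong refl arg_cong2[where f=scaleR])
    fix h assume h: "h \<in> {..<H}"
    show "(\<integral>t. weight th' th (Suc h) t *\<^sub>R (rw h t *\<^sub>R Zsum pol th h t) \<partial>tr th') = (\<integral>t. rw h t *\<^sub>R Zsum pol th h t \<partial>tr th)"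
      using h by (intro integral_reweight borel_measurable_scaleR measurable_rw measurable_Zsum)
        (auto simp: Zsum_def)
  qed
  also have "\<dots> = pgrad th"
    unfolding pgrad_def gpomdp_def scaleR_scaleR[symmetric] using i by (subst Bochner_Integration.integral_sum) (auto simp del: scaleR_scaleR)
  finally have "integral\<^sup>L (tr th') (gpomdp_off r gm H pol th' th) = pgrad th" .
  then show ?thesis unfolding correction_def using ioff integrable_gpomdp by (simp add: pgrad_def)
qed

text \<open>Here \<open>a\<close> and \<open>b\<close> are the two summands of \<open>lip\<close>
  times the step length. The score part of the correction is at most \<open>a\<close> pointwise and
  the weight part at most \<open>b\<close> in mean square, so the second moment is at most
  \<open>2 * a^2 + 2 * b^2\<close>, hence at most \<open>2 * (a + b)^2\<close>.\<close>

lemma integral_correction_square_le: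
  assumes x: "G * norm (th' - th) \<le> 41/32 * (1 - gm)"
  shows "(\<integral>t. (norm (correction th th' t))\<^sup>2 \<partial>tr th') \<le> 2 * lip\<^sup>2 * (norm (th' - th))\<^sup>2"
proof -
  interpret T: prob_space "tr th'" by (rule prob_space_tr)
  let ?d = "norm (th' - th)"
  let ?x = "G * ?d"
  define q where "q = exp ?x + exp (- ?x) - 1"
  define a where "a = M * R / (1 - gm)\<^sup>2 * ?d"
  define b where "b = 2 * G\<^sup>2 * R / (1 - gm) ^ 3 * ?d"
  let ?w = "\<lambda>h. gm ^ h * (real h + 1)"
  let ?u = "\<lambda>h t. 1 - weight th' th (Suc h) t"
  let ?S = "\<lambda>t. \<Sum>h<H. ?w h * (?u h t)\<^sup>2"
  have a: "a \<ge> 0" and b: "b \<ge> 0" using M_pos R_pos gm by (auto simp: a_def b_def)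
  have x0: "?x \<ge> 0" using G_pos by simp
  have "41/32 * (1 - gm) \<le> 41/32" using gm by simp
  then have x1: "\<bar>?x\<bar> \<le> 41/32" using x x0 by linarith
  have q1: "q \<ge> 1"
    using exp_ge_add_one_self[of ?x] exp_ge_add_one_self[of "- ?x"] unfolding q_def by linarith
  have q2: "q \<le> 1 + 6/5 * ?x\<^sup>2"
    using exp_add_exp_minus_le[OF x1] by (simp add: q_def)
  have iu: "integrable (tr th') (\<lambda>t. (?u h t)\<^sup>2)" if h: "h < H" for h
  proof -
    have "integrable (tr th') (\<lambda>t. 1 - 2 * weight th' th (Suc h) t + (weight th' th (Suc h) t)\<^sup>2)"
      using h integrable_weight[of "Suc h" th' th' th] integrable_weight_power[of "Suc h" th' th' th 2] by auto
    then show ?thesis by (simp add: power2_diff algebra_simps)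
  qed
  have iS: "integrable (tr th') ?S" using iu by (intro Bochner_Integration.integrable_sum) auto
  have ES: "integral\<^sup>L (tr th') ?S \<le> 4 * ?x\<^sup>2 / (1 - gm) ^ 4"
  proof -
    have "integral\<^sup>L (tr th') ?S = (\<Sum>h<H. ?w h * (\<integral>t. (?u h t)\<^sup>2 \<partial>tr th'))"
      using iu by (subst Bochner_Integration.integral_sum) auto
    also have "\<dots> \<le> (\<Sum>h<H. ?w h * (q ^ Suc h - 1))"
    proof (intro sum_mono mult_left_mono)
      fix h assume "h \<in> {..<H}"
      then show "(\<integral>t. (?u h t)\<^sup>2 \<partial>tr th') \<le> q ^ Suc h - 1"
        using integral_weight_diff_square_le[where n="Suc h" and th=th' and th'=th] by (simp add: q_def norm_minus_commute)
    qed (use gm in auto)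
    also have "\<dots> \<le> 4 * ?x\<^sup>2 / (1 - gm) ^ 4"
      using x x0 by (intro sum_geometric_deriv_diff_le gm q1 q2 power_mono) auto
    finally show ?thesis .
  qed
  have "(\<integral>t. (norm (correction th th' t))\<^sup>2 \<partial>tr th') \<le> (\<integral>t. 2 * a\<^sup>2 + (2 * (R * G)\<^sup>2 / (1 - gm)\<^sup>2) * ?S t \<partial>tr th')"
  proof (rule integral_mono)
    obtain K where K: "\<forall>t\<in>space (mu H). norm (correction th th' t) \<le> K" using norm_correction_bounded by blast
    show "integrable (tr th') (\<lambda>t. (norm (correction th th' t))\<^sup>2)"
      by (rule integrable_tr[of _ "K\<^sup>2"]) (use K in \<open>auto intro!: power_mono\<close>)
    show "integrable (tr th') (\<lambda>t. 2 * a\<^sup>2 + (2 * (R * G)\<^sup>2 / (1 - gm)\<^sup>2) * ?S t)" using iS by auto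
    fix t assume "t \<in> space (tr th')"
    then have t: "t \<in> space (mu H)" by simp
    define s where "s = (\<Sum>h<H. ?w h * \<bar>?u h t\<bar>)"
    have s0: "s \<ge> 0" using gm by (auto simp: s_def intro!: sum_nonneg)
    \<comment> \<open>The total mass of the weights \<open>gm ^ h * (h + 1)\<close> is at most
      \<open>1 / (1 - gm)^2\<close>; the other factor only involves the mean squares of
      \<open>1 - weight\<close>.\<close>
    have "s\<^sup>2 \<le> (\<Sum>h<H. ?w h) * (\<Sum>h<H. ?w h * (\<bar>?u h t\<bar>)\<^sup>2)"
      unfolding s_def using gm by (intro sum_mult_square_le) auto
    also have "\<dots> \<le> (1 / (1 - gm)\<^sup>2) * ?S t"
      using gm by (simp only: power2_abs) (intro mult_right_mono sum_geometric_deriv_le, auto intro!: sum_nonneg)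
    finally have s2: "s\<^sup>2 \<le> (1 / (1 - gm)\<^sup>2) * ?S t" .
    have "norm (correction th th' t) \<le> a + R * G * s"
      using norm_correction_le[OF t, of th th'] by (simp add: a_def s_def)
    then have "(norm (correction th th' t))\<^sup>2 \<le> (a + R * G * s)\<^sup>2" by (intro power_mono) auto
    also have "\<dots> \<le> 2 * a\<^sup>2 + 2 * (R * G * s)\<^sup>2"
      using zero_le_power2[of "a - R * G * s"] by (simp add: power2_sum power2_diff)
    also have "\<dots> = 2 * a\<^sup>2 + 2 * (R * G)\<^sup>2 * s\<^sup>2" by (simp add: power_mult_distrib)
    also have "\<dots> \<le> 2 * a\<^sup>2 + 2 * (R * G)\<^sup>2 * ((1 / (1 - gm)\<^sup>2) * ?S t)"
      using s2 by (intro add_left_mono mult_left_mono) auto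
    finally show "(norm (correction th th' t))\<^sup>2 \<le> 2 * a\<^sup>2 + (2 * (R * G)\<^sup>2 / (1 - gm)\<^sup>2) * ?S t" by simp
  qed
  also have "\<dots> = 2 * a\<^sup>2 + (2 * (R * G)\<^sup>2 / (1 - gm)\<^sup>2) * integral\<^sup>L (tr th') ?S"
    using iS T.prob_space by simp
  also have "\<dots> \<le> 2 * a\<^sup>2 + (2 * (R * G)\<^sup>2 / (1 - gm)\<^sup>2) * (4 * ?x\<^sup>2 / (1 - gm) ^ 4)"
    using ES by (intro add_left_mono mult_left_mono) auto
  \<comment> \<open>An equality: the powers of \<open>1 - gm\<close> combine as 2 + 4 = 6, and the
    factor 4 is the square of the 2 in \<open>b\<close>.\<close>
  also have "\<dots> = 2 * a\<^sup>2 + 2 * b\<^sup>2"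
    using gm by (simp add: b_def power_mult_distrib power_divide field_simps flip: power_mult power_add)
  also have "\<dots> \<le> 2 * (a + b)\<^sup>2" using a b by (simp add: power2_sum)
  also have "(a + b)\<^sup>2 = lip\<^sup>2 * ?d\<^sup>2"
    unfolding a_def b_def lip_def distrib_right[symmetric] power_mult_distrib ..
  finally show ?thesis by simp
qed

end

section \<open>Markov kernels\<close>

text \<open>Passes through the nonnegative integral, which commutes with bind without integrability
  conditions; boundedness makes the inner integrals finite, so both sides translate back to real
  integrals.\<close>

lemma integral_bind_bounded:
  fixes f :: "'b \<Rightarrow> real"
  assumes M: "prob_space M" and K: "K \<in> M \<rightarrow>\<^sub>M subprob_algebra N"
    and Kp: "\<And>x. x \<in> space M \<Longrightarrow> prob_space (K x)"
    and f[measurable]: "f \<in> borel_measurable N" and bd: "\<And>x. x \<in> space N \<Longrightarrow> 0 \<le> f x \<and> f x \<le> C"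
  shows "integral\<^sup>L (M \<bind> K) f = (\<integral>x. integral\<^sup>L (K x) f \<partial>M)"
    and "(\<lambda>x. integral\<^sup>L (K x) f) \<in> borel_measurable M"
proof -
  have sK: "sets (K x) = sets N" if "x \<in> space M" for x using sets_kernel[OF K that] .
  have spK: "space (K x) = space N" if "x \<in> space M" for x using sets_eq_imp_space_eq[OF sK[OF that]] .
  have sb: "sets (M \<bind> K) = sets N" using sK prob_space.not_empty[OF M] by (rule sets_bind)
  have f0: "0 \<le> integral\<^sup>L (K x) f" if "x \<in> space M" for x
    using bd spK[OF that] by (intro integral_nonneg_AE) auto
  have inner: "(\<integral>\<^sup>+y. ennreal (f y) \<partial>K x) = ennreal (integral\<^sup>L (K x) f)" if x: "x \<in> space M" for x
  proof (rule nn_integral_eq_integral)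
    interpret prob_space "K x" by (rule Kp[OF x])
    show "integrable (K x) f"
      using bd spK[OF x] f by (intro integrable_bounded[of _ C]) (auto simp: measurable_cong_sets[OF sK[OF x] refl])
    show "AE y in K x. 0 \<le> f y" using bd spK[OF x] by auto
  qed
  have "(\<lambda>x. \<integral>\<^sup>+y. ennreal (f y) \<partial>K x) \<in> borel_measurable M"
    by (rule measurable_compose[OF K nn_integral_measurable_subprob_algebra]) simp
  then have "(\<lambda>x. ennreal (integral\<^sup>L (K x) f)) \<in> borel_measurable M"
    by (rule measurable_cong[THEN iffD1, rotated]) (rule inner)
  from borel_measurable_enn2real[OF this]
  have "(\<lambda>x. enn2real (ennreal (integral\<^sup>L (K x) f))) \<in> borel_measurable M" .
  then show m: "(\<lambda>x. integral\<^sup>L (K x) f) \<in> borel_measurable M"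
    by (rule measurable_cong[THEN iffD1, rotated]) (simp add: f0)
  have "integral\<^sup>L (M \<bind> K) f = enn2real (\<integral>\<^sup>+y. ennreal (f y) \<partial>(M \<bind> K))"
    using bd sets_eq_imp_space_eq[OF sb] f
    by (intro integral_eq_nn_integral) (auto simp: measurable_cong_sets[OF sb refl])
  also have "(\<integral>\<^sup>+y. ennreal (f y) \<partial>(M \<bind> K)) = (\<integral>\<^sup>+x. \<integral>\<^sup>+y. ennreal (f y) \<partial>K x \<partial>M)"
    by (rule nn_integral_bind[OF _ K]) simp
  also have "\<dots> = (\<integral>\<^sup>+x. ennreal (integral\<^sup>L (K x) f) \<partial>M)"
    by (rule nn_integral_cong) (rule inner)
  also have "enn2real \<dots> = (\<integral>x. integral\<^sup>L (K x) f \<partial>M)"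
    using m f0 by (intro integral_eq_nn_integral[symmetric]) auto
  finally show "integral\<^sup>L (M \<bind> K) f = (\<integral>x. integral\<^sup>L (K x) f \<partial>M)" .
qed

text \<open>The centred sample mean has expectation zero, so its inner product with the constant
  \<open>a\<close> vanishes. In the application \<open>a\<close> is the old gradient error.\<close>

lemma (in prob_space) mean_square_shifted_sample_mean:
  fixes X :: "'a \<Rightarrow> 'd::euclidean_space"
  assumes X[measurable]: "X \<in> borel_measurable M" and bd: "\<And>x. x \<in> space M \<Longrightarrow> norm (X x) \<le> K"
    and n: "n \<ge> 1"
  shows "(\<integral>x. (norm (a + (1 / real n) *\<^sub>R (\<Sum>i<n. X (x i)) - expectation X))\<^sup>2 \<partial>PiM {..<n} (\<lambda>_. M))
     = (norm a)\<^sup>2 + (\<integral>x. (norm (X x - expectation X))\<^sup>2 \<partial>M) / real n"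
proof -
  interpret P: product_prob_space "\<lambda>_. M" "{..<n}" by unfold_locales
  have PS: "P.prob (space (PiM {..<n} (\<lambda>_. M))) = 1"
    by (rule prob_space.prob_space) (rule prob_space_PiM, rule prob_space_axioms)
  define Y where "Y x = (1 / real n) *\<^sub>R (\<Sum>i<n. X (x i)) - expectation X" for x
  have comp[measurable]: "(\<lambda>x. x i) \<in> PiM {..<n} (\<lambda>_. M) \<rightarrow>\<^sub>M M" if "i < n" for i
    using that by (intro measurable_component_singleton) auto
  have Xi[measurable]: "(\<lambda>x. X (x i)) \<in> borel_measurable (PiM {..<n} (\<lambda>_. M))" if "i < n" for i
    using measurable_compose[OF comp[OF that] X] .
  have Xb: "norm (X (x i)) \<le> K" if "i < n" "x \<in> space (PiM {..<n} (\<lambda>_. M))" for x i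
    using measurable_space[OF comp[OF that(1)] that(2)] by (rule bd)
  have iX: "integrable (PiM {..<n} (\<lambda>_. M)) (\<lambda>x. X (x i))" if "i < n" for i
    using Xi[OF that] Xb[OF that] by (rule P.integrable_bounded)
  have EX: "(\<integral>x. X (x i) \<partial>PiM {..<n} (\<lambda>_. M)) = expectation X" if "i < n" for i
  proof -
    have "(\<integral>x. X (x i) \<partial>PiM {..<n} (\<lambda>_. M)) = integral\<^sup>L (distr (PiM {..<n} (\<lambda>_. M)) M (\<lambda>x. x i)) X"
      using that by (intro integral_distr[symmetric]) auto
    also have "distr (PiM {..<n} (\<lambda>_. M)) M (\<lambda>x. x i) = M"
      using that by (intro P.PiM_component) auto
    finally show ?thesis .
  qed
  have iY: "integrable (PiM {..<n} (\<lambda>_. M)) Y"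
    unfolding Y_def[abs_def] using iX by (intro Bochner_Integration.integrable_diff integrable_scaleR_right
      Bochner_Integration.integrable_sum) auto
  have "P.expectation Y = (1 / real n) *\<^sub>R (\<Sum>i<n. P.expectation (\<lambda>x. X (x i))) - expectation X"
  proof -
    have "integrable (PiM {..<n} (\<lambda>_. M)) (\<lambda>x. (1 / real n) *\<^sub>R (\<Sum>i<n. X (x i)))"
      using iX by (intro integrable_scaleR_right Bochner_Integration.integrable_sum) auto
    moreover have "P.expectation (\<lambda>x. \<Sum>i<n. X (x i)) = (\<Sum>i<n. P.expectation (\<lambda>x. X (x i)))"
      using iX by (intro Bochner_Integration.integral_sum) auto
    ultimately show ?thesis by (simp add: Y_def[abs_def] PS)
  qed
  also have "\<dots> = 0" using n by (simp add: EX sum_constant_scaleR)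
  finally have Y0: "P.expectation Y = 0" .
  have Ym[measurable]: "Y \<in> borel_measurable (PiM {..<n} (\<lambda>_. M))" using iY by auto
  have Yb: "norm (Y x) \<le> (1 / real n) * (\<Sum>i<n. K) + norm (expectation X)"
    if "x \<in> space (PiM {..<n} (\<lambda>_. M))" for x
  proof -
    have "norm (\<Sum>i<n. X (x i)) \<le> (\<Sum>i<n. K)" using Xb that by (intro sum_norm_le) auto
    from mult_left_mono[OF this, of "1 / real n"]
    show ?thesis unfolding Y_def by (intro order_trans[OF norm_triangle_ineq4] add_right_mono) simp
  qed
  have iY2: "integrable (PiM {..<n} (\<lambda>_. M)) (\<lambda>x. (norm (Y x))\<^sup>2)"
    by (rule P.integrable_bounded[of _ "((1 / real n) * (\<Sum>i<n. K) + norm (expectation X))\<^sup>2"])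
      (use Yb in \<open>auto intro!: power_mono\<close>)
  have "(\<integral>x. (norm (a + Y x))\<^sup>2 \<partial>PiM {..<n} (\<lambda>_. M))
      = (\<integral>x. (norm a)\<^sup>2 + 2 * (a \<bullet> Y x) + (norm (Y x))\<^sup>2 \<partial>PiM {..<n} (\<lambda>_. M))"
    by (simp add: power2_norm_eq_inner inner_add_left inner_add_right inner_commute algebra_simps)
  also have "\<dots> = (norm a)\<^sup>2 + (\<integral>x. (norm (Y x))\<^sup>2 \<partial>PiM {..<n} (\<lambda>_. M))"
    using iY iY2 Y0 PS by simp
  also have "(\<integral>x. (norm (Y x))\<^sup>2 \<partial>PiM {..<n} (\<lambda>_. M)) = (\<integral>x. (norm (X x - expectation X))\<^sup>2 \<partial>M) / real n"
    unfolding Y_def by (rule mean_square_sample_mean[OF X bd n])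
  finally show ?thesis by (simp add: Y_def add_diff_eq)
qed

lemma (in prob_space) integral_norm_sub_expectation_square_le:
  fixes X :: "'a \<Rightarrow> 'd::euclidean_space"
  assumes X[measurable]: "X \<in> borel_measurable M" and bd: "\<And>x. x \<in> space M \<Longrightarrow> norm (X x) \<le> K"
  shows "(\<integral>x. (norm (X x - expectation X))\<^sup>2 \<partial>M) \<le> (\<integral>x. (norm (X x))\<^sup>2 \<partial>M)"
proof -
  have iX: "integrable M X" using X bd by (rule integrable_bounded)
  have iX2: "integrable M (\<lambda>x. (norm (X x))\<^sup>2)"
    by (rule integrable_bounded[of _ "K\<^sup>2"]) (use bd in \<open>auto intro!: power_mono\<close>)
  have "(\<integral>x. (norm (X x - expectation X))\<^sup>2 \<partial>M)
     = (\<integral>x. (norm (X x))\<^sup>2 - 2 * (X x \<bullet> expectation X) + (norm (expectation X))\<^sup>2 \<partial>M)"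
    by (simp add: power2_norm_eq_inner inner_diff_left inner_diff_right inner_commute algebra_simps)
  also have "\<dots> = (\<integral>x. (norm (X x))\<^sup>2 \<partial>M) - (norm (expectation X))\<^sup>2"
    using iX iX2 prob_space by (simp add: power2_norm_eq_inner)
  finally show ?thesis by simp
qed

context pg
begin

section \<open>Measurability of sampling in the policy parameter\<close>

lemma tr_eq_density: "tr th = density (mu H) (\<lambda>t. ennreal (path_dens (\<lambda>_. pol th) H t))"
  by (simp add: traj_eq_path_law[OF H_pos] path_law_def)

lemma PiM_tr_eq_density:
  "PiM {..<n::nat} (\<lambda>_. tr th) = density (PiM {..<n} (\<lambda>_. mu H)) (\<lambda>x. \<Prod>i<n. ennreal (path_dens (\<lambda>_. pol th) H (x i)))"
  unfolding tr_eq_density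
proof (rule density_PiM_prod[symmetric])
  show "(\<lambda>t. ennreal (path_dens (\<lambda>_. pol th) H t)) \<in> borel_measurable (mu H)"
    using measurable_path_dens[of "\<lambda>_. pol th" H H] policy_pol by simp
  interpret prob_space "tr th" by (rule prob_space_tr)
  show "sigma_finite_measure (density (mu H) (\<lambda>t. ennreal (path_dens (\<lambda>_. pol th) H t)))"
    using sigma_finite_measure_axioms by (simp add: tr_eq_density)
qed (auto intro: sigma_finite_mu)

lemma sets_PiM_tr: "sets (PiM {..<n} (\<lambda>_. tr th)) = sets (PiM {..<n} (\<lambda>_. mu H))"
  by (rule sets_PiM_cong) auto

lemma prob_space_PiM_tr: "prob_space (PiM {..<n} (\<lambda>_. tr th))"
  by (rule prob_space_PiM) (rule prob_space_tr)

text \<open>The parameter enters the sampled measure itself. Writing that measure as a density moves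
  the parameter into the integrand, and what remains is the measurability of a parametrised integral
  against a fixed sigma-finite measure.\<close>

lemma sample_kernel_measurable:
  fixes \<phi> :: "'x \<Rightarrow> 'd" and F :: "'x \<Rightarrow> (nat \<Rightarrow> nat \<Rightarrow> 's \<times> 'a) \<Rightarrow> 'y"
  assumes \<phi>[measurable]: "\<phi> \<in> X \<rightarrow>\<^sub>M borel"
    and F[measurable]: "case_prod F \<in> X \<Otimes>\<^sub>M PiM {..<n} (\<lambda>_. mu H) \<rightarrow>\<^sub>M Y"
  shows "(\<lambda>x. distr (PiM {..<n} (\<lambda>_. tr (\<phi> x))) Y (F x)) \<in> X \<rightarrow>\<^sub>M subprob_algebra Y"
proof (rule measurable_subprob_algebra)
  let ?P = "PiM {..<n} (\<lambda>_. mu H)"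
  interpret m: product_sigma_finite "\<lambda>_::nat. mu H" by (simp add: product_sigma_finite_def sigma_finite_mu)
  interpret PP: sigma_finite_measure ?P by (rule m.sigma_finite) simp
  have Fx: "F x \<in> ?P \<rightarrow>\<^sub>M Y" if "x \<in> space X" for x
    using measurable_compose[OF measurable_Pair1'[OF that] F] by simp
  have Fx': "F x \<in> PiM {..<n} (\<lambda>_. tr (\<phi> x)) \<rightarrow>\<^sub>M Y" if "x \<in> space X" for x
    using Fx[OF that] by (simp add: measurable_cong_sets[OF sets_PiM_tr refl])
  show "subprob_space (distr (PiM {..<n} (\<lambda>_. tr (\<phi> x))) Y (F x))" if "x \<in> space X" for x
    by (intro prob_space_imp_subprob_space prob_space.prob_space_distr prob_space_PiM_tr Fx'[OF that])
  show "sets (distr (PiM {..<n} (\<lambda>_. tr (\<phi> x))) Y (F x)) = sets Y" for x by simp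
  fix E assume E[measurable]: "E \<in> sets Y"
  have mprod: "(\<lambda>z. \<Prod>i<n. ennreal (path_dens (\<lambda>_. pol (\<phi> (fst z))) H (snd z i))) \<in> borel_measurable (X \<Otimes>\<^sub>M ?P)"
  proof (intro borel_measurable_prod_ennreal)
    fix i assume "i \<in> {..<n}"
    then have "(\<lambda>z. snd z i) \<in> X \<Otimes>\<^sub>M ?P \<rightarrow>\<^sub>M mu H"
      by (intro measurable_compose[OF measurable_snd measurable_component_singleton])
    from measurable_path_dens_comp[OF _ this, of "\<lambda>z. \<phi> (fst z)"]
    show "(\<lambda>z. ennreal (path_dens (\<lambda>_. pol (\<phi> (fst z))) H (snd z i))) \<in> borel_measurable (X \<Otimes>\<^sub>M ?P)" by simp
  qed
  have "(\<lambda>x. \<integral>\<^sup>+z. (\<Prod>i<n. ennreal (path_dens (\<lambda>_. pol (\<phi> x)) H (z i))) * indicator E (F x z) \<partial>?P) \<in> borel_measurable X"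
  proof (rule PP.borel_measurable_nn_integral)
    have "(\<lambda>z. indicator E (case_prod F z) :: ennreal) \<in> borel_measurable (X \<Otimes>\<^sub>M ?P)"
      by measurable
    then show "(\<lambda>(x, z). (\<Prod>i<n. ennreal (path_dens (\<lambda>_. pol (\<phi> x)) H (z i))) * indicator E (F x z)) \<in> borel_measurable (X \<Otimes>\<^sub>M ?P)"
      using mprod by (simp add: case_prod_beta')
  qed
  moreover have "emeasure (distr (PiM {..<n} (\<lambda>_. tr (\<phi> x))) Y (F x)) E
      = (\<integral>\<^sup>+z. (\<Prod>i<n. ennreal (path_dens (\<lambda>_. pol (\<phi> x)) H (z i))) * indicator E (F x z) \<partial>?P)" if x: "x \<in> space X" for x
  proof -
    have m: "(\<lambda>z. \<Prod>i<n. ennreal (path_dens (\<lambda>_. pol (\<phi> x)) H (z i))) \<in> borel_measurable ?P"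
      using measurable_compose[OF measurable_Pair1'[OF x] mprod] by simp
    have mE: "(\<lambda>z. indicator E (F x z) :: ennreal) \<in> borel_measurable ?P"
      using Fx[OF x] by measurable
    have "emeasure (distr (PiM {..<n} (\<lambda>_. tr (\<phi> x))) Y (F x)) E
        = (\<integral>\<^sup>+z. indicator E (F x z) \<partial>PiM {..<n} (\<lambda>_. tr (\<phi> x)))"
      using Fx'[OF x] by (subst nn_integral_indicator[symmetric], simp, subst nn_integral_distr) auto
    also have "\<dots> = (\<integral>\<^sup>+z. (\<Prod>i<n. ennreal (path_dens (\<lambda>_. pol (\<phi> x)) H (z i))) * indicator E (F x z) \<partial>?P)"
      unfolding PiM_tr_eq_density using m mE by (rule nn_integral_density)
    finally show ?thesis .
  qed
  ultimately show "(\<lambda>x. emeasure (distr (PiM {..<n} (\<lambda>_. tr (\<phi> x))) Y (F x)) E) \<in> borel_measurable X"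
    by (simp cong: measurable_cong)
qed

lemma measurable_V [measurable]: "V \<in> borel_measurable borel"
proof (rule borel_measurable_continuous_onI)
  show "continuous_on UNIV V"
    using V_has_derivative by (auto intro!: continuous_at_imp_continuous_on has_derivative_continuous)
qed

lemma measurable_pgrad [measurable]: "pgrad \<in> borel_measurable borel"
proof -
  interpret mm: sigma_finite_measure "mu H" by (rule sigma_finite_mu)
  have "(\<lambda>th. \<integral>t. path_dens (\<lambda>_. pol th) H t *\<^sub>R gpomdp r gm H pol th t \<partial>mu H) \<in> borel_measurable borel"
    by (rule mm.borel_measurable_lebesgue_integral) (simp add: case_prod_beta')
  moreover have "(\<integral>t. path_dens (\<lambda>_. pol th) H t *\<^sub>R gpomdp r gm H pol th t \<partial>mu H) = pgrad th" for th
    unfolding pgrad_def tr_eq_density using measurable_path_dens[of "\<lambda>_. pol th" H H] policy_pol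
    by (intro integral_density[symmetric]) (auto intro!: AE_I2 path_dens_nonneg)
  ultimately show ?thesis by simp
qed

end

section \<open>The descent argument\<close>

text \<open>\<open>eta_batch\<close> is the batch-size condition for the constant
  \<open>2 * lip^2\<close>, cleared of denominators so that \<open>p = 1\<close> needs no separate
  treatment.\<close>

locale page = pg S A rho P r R gm H pol G M
  for S :: "'s measure" and A :: "'a measure" and rho P r R gm H
    and pol :: "'d::euclidean_space \<Rightarrow> 's \<Rightarrow> 'a \<Rightarrow> real" and G M +
  fixes eta p sigma :: real and N B :: nat
  assumes eta_pos: "eta > 0" and p_pos: "0 < p" and p_le: "p \<le> 1"
    and N_pos: "N \<ge> 1" and B_pos: "B \<ge> 1"
    and variance_le: "\<And>th. (\<integral>t. (norm (gpomdp r gm H pol th t - pgrad th))\<^sup>2 \<partial>tr th) \<le> sigma\<^sup>2"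
    and eta_lip: "eta\<^sup>2 \<le> 1 / (4 * lip\<^sup>2)"
    and eta_batch: "(1 - p) * (4 * lip\<^sup>2 * eta\<^sup>2) \<le> p * real B"
begin

text \<open>Beyond the threshold \<open>Q\<close> on the squared gradient error the potential is constant, and \<open>Q\<close> is just
  large enough for this constant to pay for the worst possible change of \<open>V\<close> and for the largest
  possible gradient.\<close>

definition Q :: real where
  "Q = grad_bound\<^sup>2 + 4 * R / ((1 - gm) * eta)"

definition Vsup :: real where
  "Vsup = (SUP th. V th)"

definition potential :: "'d \<times> 'd \<Rightarrow> real" where
  "potential x = Vsup - V (fst x) + eta / (2 * p) * min ((norm (snd x - pgrad (fst x)))\<^sup>2) Q"

definition refresh :: "nat \<Rightarrow> 'd \<Rightarrow> (nat \<Rightarrow> nat \<Rightarrow> 's \<times> 'a) \<Rightarrow> 'd \<times> 'd" where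
  "refresh n th taus = (th, (1 / real n) *\<^sub>R (\<Sum>i<n. gpomdp r gm H pol th (taus i)))"

definition update :: "'d \<times> 'd \<Rightarrow> (nat \<Rightarrow> nat \<Rightarrow> 's \<times> 'a) \<Rightarrow> 'd \<times> 'd" where
  "update x taus = (let th' = fst x + eta *\<^sub>R snd x in
     (th', (1 / real B) *\<^sub>R (\<Sum>i<B. gpomdp r gm H pol th' (taus i)) + snd x
           - (1 / real B) *\<^sub>R (\<Sum>i<B. gpomdp_off r gm H pol th' (fst x) (taus i))))"

abbreviation next_th :: "'d \<times> 'd \<Rightarrow> 'd" where
  "next_th x \<equiv> fst x + eta *\<^sub>R snd x"

definition switch :: "'d \<times> 'd \<Rightarrow> bool \<Rightarrow> ('d \<times> 'd) measure" where
  "switch x b = (if b then distr (PiM {..<N} (\<lambda>_. tr (next_th x))) borel (refresh N (next_th x))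
     else distr (PiM {..<B} (\<lambda>_. tr (next_th x))) borel (update x))"

abbreviation step :: "'d \<times> 'd \<Rightarrow> ('d \<times> 'd) measure" where
  "step \<equiv> page_step S A rho P r gm H pol eta p N B"

lemma page_init_eq: "page_init S A rho P r gm H pol N th = distr (PiM {..<N} (\<lambda>_. tr th)) borel (refresh N th)"
  by (simp add: page_init_def refresh_def[abs_def])

lemma page_step_eq: "step x = measure_pmf (bernoulli_pmf p) \<bind> switch x"
  unfolding page_step_def switch_def[abs_def] refresh_def[abs_def] update_def[abs_def] Let_def ..

lemma measurable_sample: "i < n \<Longrightarrow> (\<lambda>z. snd z i) \<in> X \<Otimes>\<^sub>M PiM {..<n} (\<lambda>_. mu H) \<rightarrow>\<^sub>M mu H"
  by (rule measurable_compose[OF measurable_snd measurable_component_singleton]) simp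

lemma measurable_refresh:
  assumes [measurable]: "f \<in> X \<rightarrow>\<^sub>M borel"
  shows "(\<lambda>(x, taus). refresh n (f x) taus) \<in> X \<Otimes>\<^sub>M PiM {..<n} (\<lambda>_. mu H) \<rightarrow>\<^sub>M borel"
proof -
  have "(\<lambda>z. (f (fst z), (1 / real n) *\<^sub>R (\<Sum>i<n. gpomdp r gm H pol (f (fst z)) (snd z i))))
     \<in> X \<Otimes>\<^sub>M PiM {..<n} (\<lambda>_. mu H) \<rightarrow>\<^sub>M borel \<Otimes>\<^sub>M borel"
    by (intro measurable_Pair borel_measurable_scaleR borel_measurable_const borel_measurable_sum
        measurable_gpomdp_comp measurable_sample measurable_compose[OF measurable_fst assms]) auto
  then show ?thesis by (simp add: refresh_def case_prod_beta' borel_prod)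
qed

lemma measurable_update: "case_prod update \<in> borel \<Otimes>\<^sub>M PiM {..<B} (\<lambda>_. mu H) \<rightarrow>\<^sub>M borel"
proof -
  let ?X = "(borel :: ('d \<times> 'd) measure) \<Otimes>\<^sub>M PiM {..<B} (\<lambda>_. mu H)"
  have f1: "(\<lambda>z. fst (fst z)) \<in> ?X \<rightarrow>\<^sub>M borel" "(\<lambda>z. snd (fst z)) \<in> ?X \<rightarrow>\<^sub>M borel"
    by (rule measurable_compose[OF measurable_fst], simp add: borel_prod[symmetric])+
  have f2: "(\<lambda>z. next_th (fst z)) \<in> ?X \<rightarrow>\<^sub>M borel"
    by (intro borel_measurable_add borel_measurable_scaleR borel_measurable_const f1)
  have "(\<lambda>z. (next_th (fst z), (1 / real B) *\<^sub>R (\<Sum>i<B. gpomdp r gm H pol (next_th (fst z)) (snd z i)) + snd (fst z)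
           - (1 / real B) *\<^sub>R (\<Sum>i<B. gpomdp_off r gm H pol (next_th (fst z)) (fst (fst z)) (snd z i))))
     \<in> ?X \<rightarrow>\<^sub>M borel \<Otimes>\<^sub>M borel"
    by (intro measurable_Pair borel_measurable_scaleR borel_measurable_const borel_measurable_sum
        borel_measurable_add borel_measurable_diff measurable_gpomdp_comp measurable_gpomdp_off_comp measurable_sample f1 f2) auto
  then show ?thesis by (simp add: update_def case_prod_beta' borel_prod Let_def)
qed

lemma measurable_next_th: "next_th \<in> borel \<rightarrow>\<^sub>M borel"
  by (intro borel_measurable_add borel_measurable_scaleR borel_measurable_const)
    (simp_all add: borel_prod[symmetric])

lemma switch_kernel:
  "(\<lambda>x. switch x b) \<in> borel \<rightarrow>\<^sub>M subprob_algebra borel"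
proof (cases b)
  case True
  then show ?thesis unfolding switch_def
    using sample_kernel_measurable[OF measurable_next_th measurable_refresh[OF measurable_next_th]] by simp
next
  case False
  then show ?thesis unfolding switch_def
    using sample_kernel_measurable[OF measurable_next_th measurable_update] by simp
qed

lemma measurable_refresh_tr: "refresh n th \<in> PiM {..<n} (\<lambda>_. tr th') \<rightarrow>\<^sub>M borel"
proof -
  \<comment> \<open>The joint measurability statement is used with a one-point parameter
    space.\<close>
  have "(\<lambda>taus. case ((), taus) of (x, taus) \<Rightarrow> refresh n th taus) \<in> PiM {..<n} (\<lambda>_. mu H) \<rightarrow>\<^sub>M borel"
    by (rule measurable_compose[OF measurable_Pair1' measurable_refresh[of "\<lambda>_. th" "count_space UNIV"]]) auto
  then show ?thesis by (simp add: measurable_cong_sets[OF sets_PiM_tr refl])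
qed

lemma measurable_update_tr: "update x \<in> PiM {..<B} (\<lambda>_. tr th') \<rightarrow>\<^sub>M borel"
  using measurable_compose[OF measurable_Pair1'[of x] measurable_update]
  by (simp add: measurable_cong_sets[OF sets_PiM_tr refl])

lemma prob_space_switch: "prob_space (switch x b)"
  unfolding switch_def
  by (auto intro!: prob_space.prob_space_distr prob_space_PiM_tr measurable_refresh_tr measurable_update_tr)

lemma sets_switch: "sets (switch x b) = sets borel"
  by (simp add: switch_def)

lemma switch_measurable: "switch x \<in> measure_pmf q \<rightarrow>\<^sub>M subprob_algebra borel"
  by (simp add: space_subprob_algebra sets_switch prob_space_imp_subprob_space prob_space_switch)

lemma step_kernel: "step \<in> borel \<rightarrow>\<^sub>M subprob_algebra borel"
  unfolding page_step_eq[abs_def]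
proof (rule measurable_bind)
  show "(\<lambda>x. measure_pmf (bernoulli_pmf p)) \<in> borel \<rightarrow>\<^sub>M subprob_algebra (count_space UNIV)"
    by (intro measurable_const) (simp add: space_subprob_algebra prob_space_imp_subprob_space measure_pmf.prob_space_axioms)
  have "(\<lambda>z. if snd z then switch (fst z) True else switch (fst z) False)
      \<in> borel \<Otimes>\<^sub>M count_space UNIV \<rightarrow>\<^sub>M subprob_algebra borel"
  proof -
    have k: "(\<lambda>z. switch (fst z) b) \<in> borel \<Otimes>\<^sub>M count_space UNIV \<rightarrow>\<^sub>M subprob_algebra borel" for b
      by (rule measurable_compose[OF measurable_fst switch_kernel])
    show ?thesis by (rule measurable_If[OF k k]) measurable
  qed
  moreover have "(if snd z then switch (fst z) True else switch (fst z) False) = switch (fst z) (snd z)" for z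
    by simp
  ultimately show "(\<lambda>z. switch (fst z) (snd z)) \<in> borel \<Otimes>\<^sub>M count_space UNIV \<rightarrow>\<^sub>M subprob_algebra borel"
    by simp
qed

lemma prob_space_step: "prob_space (step x)"
  unfolding page_step_eq
  by (rule prob_space.prob_space_bind[OF measure_pmf.prob_space_axioms _ switch_measurable]) (simp add: prob_space_switch)

lemma integral_step:
  assumes f: "f \<in> borel_measurable borel" and bd: "\<And>x. 0 \<le> f x \<and> f x \<le> C"
  shows "integral\<^sup>L (step x) f = p * (\<integral>t. f (refresh N (next_th x) t) \<partial>PiM {..<N} (\<lambda>_. tr (next_th x)))
      + (1 - p) * (\<integral>t. f (update x t) \<partial>PiM {..<B} (\<lambda>_. tr (next_th x)))"
proof -
  have "integral\<^sup>L (step x) f = (\<integral>b. integral\<^sup>L (switch x b) f \<partial>measure_pmf (bernoulli_pmf p))"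
    unfolding page_step_eq using bd
    by (intro integral_bind_bounded[OF measure_pmf.prob_space_axioms switch_measurable prob_space_switch f]) auto
  also have "\<dots> = p * integral\<^sup>L (switch x True) f + (1 - p) * integral\<^sup>L (switch x False) f"
    using p_pos p_le by (subst integral_bernoulli_pmf) (auto simp: mult.commute)
  finally show ?thesis
    unfolding switch_def using f
    by (simp add: integral_distr[OF measurable_refresh_tr] integral_distr[OF measurable_update_tr])
qed

section \<open>One-step estimates for the potential\<close>

lemma V_le_Vsup: "V th \<le> Vsup"
  unfolding Vsup_def using abs_V_le by (intro cSUP_upper bdd_aboveI2[of _ _ "R / (1 - gm)"]) (auto simp: abs_le_iff)

lemma Vsup_le: "Vsup \<le> R / (1 - gm)"
  unfolding Vsup_def using abs_V_le by (intro cSUP_least) (auto simp: abs_le_iff)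

lemma Q_nonneg: "Q \<ge> 0"
  using R_pos gm eta_pos by (simp add: Q_def)

lemma potential_bounds: "0 \<le> potential x" "potential x \<le> 2 * R / (1 - gm) + eta / (2 * p) * Q"
proof -
  show "0 \<le> potential x"
    unfolding potential_def using V_le_Vsup[of "fst x"] Q_nonneg eta_pos p_pos by simp
  have "Vsup - V (fst x) \<le> 2 * R / (1 - gm)"
    using Vsup_le abs_V_le[of "fst x"] by (simp add: abs_le_iff)
  then show "potential x \<le> 2 * R / (1 - gm) + eta / (2 * p) * Q"
    unfolding potential_def using eta_pos p_pos by (intro add_mono mult_left_mono) auto
qed

lemma measurable_potential: "potential \<in> borel_measurable borel"
proof -
  have [measurable]: "(fst :: 'd \<times> 'd \<Rightarrow> 'd) \<in> borel \<rightarrow>\<^sub>M borel" "(snd :: 'd \<times> 'd \<Rightarrow> 'd) \<in> borel \<rightarrow>\<^sub>M borel"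
    by (simp_all add: borel_prod[symmetric])
  show ?thesis unfolding potential_def[abs_def] by measurable
qed

text \<open>The two upper bounds serve the two regimes: the truncation is dropped when the error is
  small, and replaced by \<open>Q\<close> when it is large.\<close>

lemma integral_min_le:
  assumes M: "prob_space M'" and f: "f \<in> borel_measurable M'" and bd: "\<And>x. x \<in> space M' \<Longrightarrow> 0 \<le> f x \<and> f x \<le> K"
  shows "(\<integral>x. min (f x) Q \<partial>M') \<le> integral\<^sup>L M' f" "(\<integral>x. min (f x) Q \<partial>M') \<le> Q"
    "integrable M' (\<lambda>x. min (f x) Q)"
proof -
  interpret prob_space M' by (rule M)
  have i: "integrable M' f" using bd by (intro integrable_bounded[OF f, of K]) auto
  show im: "integrable M' (\<lambda>x. min (f x) Q)"
  proof (rule integrable_bounded)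
    show "(\<lambda>x. min (f x) Q) \<in> borel_measurable M'" using f by simp
    show "norm (min (f x) Q) \<le> K" if "x \<in> space M'" for x
      using bd[OF that] Q_nonneg by (auto simp: min_def)
  qed
  show "(\<integral>x. min (f x) Q \<partial>M') \<le> integral\<^sup>L M' f" using im i by (rule integral_mono) simp
  have "(\<integral>x. min (f x) Q \<partial>M') \<le> (\<integral>x. Q \<partial>M')" using im by (rule integral_mono) auto
  then show "(\<integral>x. min (f x) Q \<partial>M') \<le> Q" using prob_space by simp
qed

lemma integral_potential_refresh_le:
  "(\<integral>t. potential (refresh N th t) \<partial>PiM {..<N} (\<lambda>_. tr th)) \<le> Vsup - V th + eta / (2 * p) * (sigma\<^sup>2 / real N)"
proof -
  interpret T: prob_space "tr th" by (rule prob_space_tr)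
  interpret PT: prob_space "PiM {..<N} (\<lambda>_. tr th)" by (rule prob_space_PiM_tr)
  let ?e = "\<lambda>t. (norm ((1 / real N) *\<^sub>R (\<Sum>i<N. gpomdp r gm H pol th (t i)) - pgrad th))\<^sup>2"
  have Rm: "(\<lambda>t. snd (refresh N th t)) \<in> PiM {..<N} (\<lambda>_. tr th) \<rightarrow>\<^sub>M borel"
    by (rule measurable_compose[OF measurable_refresh_tr]) (simp add: borel_prod[symmetric])
  have em: "?e \<in> borel_measurable (PiM {..<N} (\<lambda>_. tr th))"
    using Rm by (simp add: refresh_def)
  have eb: "0 \<le> ?e t \<and> ?e t \<le> (grad_bound + grad_bound)\<^sup>2" if t: "t \<in> space (PiM {..<N} (\<lambda>_. tr th))" for t
  proof -
    have "norm (\<Sum>i<N. gpomdp r gm H pol th (t i)) \<le> (\<Sum>i<N. grad_bound)"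
      using t by (intro sum_norm_le norm_gpomdp_le) (auto simp: space_PiM)
    from mult_left_mono[OF this, of "1 / real N"]
    have "norm ((1 / real N) *\<^sub>R (\<Sum>i<N. gpomdp r gm H pol th (t i)) - pgrad th) \<le> grad_bound + grad_bound"
      using N_pos norm_pgrad_le[of th] by (intro order_trans[OF norm_triangle_ineq4] add_mono) auto
    then show ?thesis by (intro conjI power_mono zero_le_power2) auto
  qed
  have "(\<integral>t. potential (refresh N th t) \<partial>PiM {..<N} (\<lambda>_. tr th))
      = Vsup - V th + eta / (2 * p) * (\<integral>t. min (?e t) Q \<partial>PiM {..<N} (\<lambda>_. tr th))"
    using integral_min_le(3)[OF PT.prob_space_axioms em eb] PT.prob_space
    by (simp add: potential_def refresh_def)
  also have "\<dots> \<le> Vsup - V th + eta / (2 * p) * (sigma\<^sup>2 / real N)"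
  proof -
    have "(\<integral>t. min (?e t) Q \<partial>PiM {..<N} (\<lambda>_. tr th)) \<le> (\<integral>t. ?e t \<partial>PiM {..<N} (\<lambda>_. tr th))"
      by (rule integral_min_le(1)[OF PT.prob_space_axioms em eb])
    also have "\<dots> = (\<integral>t. (norm (gpomdp r gm H pol th t - pgrad th))\<^sup>2 \<partial>tr th) / real N"
      using T.mean_square_sample_mean[of "gpomdp r gm H pol th" grad_bound N] N_pos norm_gpomdp_le
      by (simp add: pgrad_def)
    also have "\<dots> \<le> sigma\<^sup>2 / real N" using variance_le by (intro divide_right_mono) auto
    finally show ?thesis using eta_pos p_pos by (intro add_left_mono mult_left_mono) auto
  qed
  finally show ?thesis .
qed

text \<open>The correction has mean \<open>pgrad (next_th x) - pgrad (fst x)\<close>, so the new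
  error is the old one plus a centred sample mean, and only the variance of that mean is added. This
  needs a short step; the first bound holds for every step.\<close>

lemma integral_potential_update_le:
  fixes x :: "'d \<times> 'd"
  defines "I \<equiv> (\<integral>t. potential (update x t) \<partial>PiM {..<B} (\<lambda>_. tr (next_th x)))"
  shows "I \<le> Vsup - V (next_th x) + eta / (2 * p) * Q"
    and "G * norm (eta *\<^sub>R snd x) \<le> 41/32 * (1 - gm) \<Longrightarrow>
      I \<le> Vsup - V (next_th x) + eta / (2 * p) *
        ((norm (snd x - pgrad (fst x)))\<^sup>2 + 2 * lip\<^sup>2 * eta\<^sup>2 * (norm (snd x))\<^sup>2 / real B)"
proof -
  let ?th = "fst x" and ?v = "snd x" and ?th' = "next_th x"
  interpret T: prob_space "tr ?th'" by (rule prob_space_tr)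
  interpret PT: prob_space "PiM {..<B} (\<lambda>_. tr ?th')" by (rule prob_space_PiM_tr)
  obtain K where K: "\<And>t. t \<in> space (mu H) \<Longrightarrow> norm (correction ?th ?th' t) \<le> K" using norm_correction_bounded by blast
  let ?e = "\<lambda>t. (norm (?v + (1 / real B) *\<^sub>R (\<Sum>i<B. correction ?th ?th' (t i)) - pgrad ?th'))\<^sup>2"
  have upd: "update x t = (?th', ?v + (1 / real B) *\<^sub>R (\<Sum>i<B. correction ?th ?th' (t i)))" for t
    by (simp add: update_def Let_def correction_def sum_subtractf scaleR_diff_right)
  have Um: "(\<lambda>t. snd (update x t)) \<in> PiM {..<B} (\<lambda>_. tr ?th') \<rightarrow>\<^sub>M borel"
    by (rule measurable_compose[OF measurable_update_tr]) (simp add: borel_prod[symmetric])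
  have em: "?e \<in> borel_measurable (PiM {..<B} (\<lambda>_. tr ?th'))"
    using Um by (simp add: upd)
  have eb: "0 \<le> ?e t \<and> ?e t \<le> (norm ?v + K + grad_bound)\<^sup>2" if t: "t \<in> space (PiM {..<B} (\<lambda>_. tr ?th'))" for t
  proof -
    have "norm (\<Sum>i<B. correction ?th ?th' (t i)) \<le> (\<Sum>i<B. K)"
      using t by (intro sum_norm_le K) (auto simp: space_PiM)
    from mult_left_mono[OF this, of "1 / real B"]
    have "norm (?v + (1 / real B) *\<^sub>R (\<Sum>i<B. correction ?th ?th' (t i)) - pgrad ?th') \<le> norm ?v + K + grad_bound"
      using B_pos norm_pgrad_le[of ?th']
      by (intro order_trans[OF norm_triangle_ineq4] add_mono order_trans[OF norm_triangle_ineq]) auto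
    then show ?thesis by (intro conjI power_mono zero_le_power2) auto
  qed
  have I: "I = Vsup - V ?th' + eta / (2 * p) * (\<integral>t. min (?e t) Q \<partial>PiM {..<B} (\<lambda>_. tr ?th'))"
    unfolding I_def using integral_min_le(3)[OF PT.prob_space_axioms em eb] PT.prob_space
    by (simp add: potential_def upd)
  show "I \<le> Vsup - V ?th' + eta / (2 * p) * Q"
    unfolding I using integral_min_le(2)[OF PT.prob_space_axioms em eb] eta_pos p_pos
    by (intro add_left_mono mult_left_mono) auto
  assume small: "G * norm (eta *\<^sub>R ?v) \<le> 41/32 * (1 - gm)"
  have "(\<integral>t. min (?e t) Q \<partial>PiM {..<B} (\<lambda>_. tr ?th')) \<le> (\<integral>t. ?e t \<partial>PiM {..<B} (\<lambda>_. tr ?th'))"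
    by (rule integral_min_le(1)[OF PT.prob_space_axioms em eb])
  \<comment> \<open>The gradient at the new parameter is traded for the gradient at the old one plus
    the mean of the correction.\<close>
  also have "\<dots> = (\<integral>t. (norm ((?v - pgrad ?th) + (1 / real B) *\<^sub>R (\<Sum>i<B. correction ?th ?th' (t i))
      - T.expectation (correction ?th ?th')))\<^sup>2 \<partial>PiM {..<B} (\<lambda>_. tr ?th'))"
    by (simp add: integral_correction algebra_simps)
  also have "\<dots> = (norm (?v - pgrad ?th))\<^sup>2
      + (\<integral>t. (norm (correction ?th ?th' t - T.expectation (correction ?th ?th')))\<^sup>2 \<partial>tr ?th') / real B"
    using K B_pos by (intro T.mean_square_shifted_sample_mean[where K=K]) auto
  also have "\<dots> \<le> (norm (?v - pgrad ?th))\<^sup>2 + 2 * lip\<^sup>2 * eta\<^sup>2 * (norm ?v)\<^sup>2 / real B"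
  proof -
    have "(\<integral>t. (norm (correction ?th ?th' t - T.expectation (correction ?th ?th')))\<^sup>2 \<partial>tr ?th')
        \<le> (\<integral>t. (norm (correction ?th ?th' t))\<^sup>2 \<partial>tr ?th')"
      using K by (intro T.integral_norm_sub_expectation_square_le[where K=K]) auto
    also have "\<dots> \<le> 2 * lip\<^sup>2 * (norm (?th' - ?th))\<^sup>2"
      using small by (intro integral_correction_square_le) simp
    finally show ?thesis by (intro add_left_mono divide_right_mono) (simp_all add: power_mult_distrib mult.assoc)
  qed
  finally show "I \<le> Vsup - V ?th' + eta / (2 * p) *
        ((norm (?v - pgrad ?th))\<^sup>2 + 2 * lip\<^sup>2 * eta\<^sup>2 * (norm ?v)\<^sup>2 / real B)"
    unfolding I using eta_pos p_pos by (intro add_left_mono mult_left_mono) auto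
qed

lemma lip_pos: "lip > 0"
  unfolding lip_def using M_pos R_pos gm by (intro add_pos_nonneg divide_pos_pos mult_pos_pos) auto

lemma eta_mult_lip_le: "eta * lip \<le> 1/2"
proof -
  have "(eta * lip)\<^sup>2 \<le> (1/2)\<^sup>2"
    using eta_lip lip_pos by (simp add: power_mult_distrib power_divide field_simps)
  then show ?thesis using eta_pos lip_pos by (simp add: power2_le_iff_abs_le)
qed

text \<open>Bounds \<open>norm v\<close> by the gradient error plus the gradient. Both are
  controlled through \<open>eta * G^2 * R\<close>, which the second summand of \<open>lip\<close>
  limits to a quarter of \<open>(1 - gm)^3\<close>.\<close>

lemma small_step:
  assumes "(norm (v - pgrad th))\<^sup>2 < Q"
  shows "G * norm (eta *\<^sub>R v) \<le> 41/32 * (1 - gm)"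
proof -
  define d where "d = 1 - gm"
  have d: "d > 0" "d \<le> 1" using gm by (auto simp: d_def)
  have "eta * (2 * G\<^sup>2 * R / d ^ 3) \<le> eta * lip"
    using eta_pos M_pos R_pos d by (intro mult_left_mono) (auto simp: lip_def d_def)
  then have "eta * (2 * G\<^sup>2 * R / d ^ 3) \<le> 1/2" using eta_mult_lip_le by simp
  then have k: "eta * G\<^sup>2 * R \<le> d ^ 3 / 4" using d by (simp add: field_simps)
  have g: "G * eta * grad_bound \<le> d / 4"
  proof -
    have "G * eta * grad_bound = (eta * G\<^sup>2 * R) / d\<^sup>2"
      by (simp add: grad_bound_def d_def power2_eq_square)
    also have "\<dots> \<le> (d ^ 3 / 4) / d\<^sup>2" using k by (intro divide_right_mono) auto
    also have "\<dots> = d / 4" using d by (simp add: power2_eq_square power3_eq_cube)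
    finally show ?thesis .
  qed
  have g0: "0 \<le> G * eta * grad_bound" using G_pos eta_pos R_pos by (simp add: grad_bound_def)
  \<comment> \<open>The second term of \<open>Q\<close> contains \<open>1 / eta\<close>, so one
    factor \<open>eta\<close> survives and the same bound on \<open>eta * G^2 * R\<close>
    applies.\<close>
  have "(G * eta)\<^sup>2 * Q = (G * eta * grad_bound)\<^sup>2 + 4 * (eta * G\<^sup>2 * R) / d"
    using eta_pos d by (simp add: Q_def d_def[symmetric] power2_eq_square field_simps)
  also have "\<dots> \<le> (d / 4)\<^sup>2 + 4 * (d ^ 3 / 4) / d"
    using g g0 k d by (intro add_mono power_mono divide_right_mono mult_left_mono) auto
  \<comment> \<open>The left side is 17/16 times \<open>d^2\<close>, and 33/32 is a rational just
    above the square root of 17/16.\<close>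
  also have "\<dots> \<le> (33/32 * d)\<^sup>2"
    using d by (simp add: power2_eq_square power3_eq_cube)
  finally have q: "(G * eta)\<^sup>2 * Q \<le> (33/32 * d)\<^sup>2" .
  have "(G * eta * norm (v - pgrad th))\<^sup>2 \<le> (G * eta)\<^sup>2 * Q"
    unfolding power_mult_distrib using assms by (intro mult_left_mono) auto
  with q have "(G * eta * norm (v - pgrad th))\<^sup>2 \<le> (33/32 * d)\<^sup>2" by linarith
  then have e: "G * eta * norm (v - pgrad th) \<le> 33/32 * d"
    by (rule power2_le_imp_le) (use d in simp)
  have "norm v \<le> norm (v - pgrad th) + grad_bound"
    using norm_triangle_sub[of v "pgrad th"] norm_pgrad_le[of th] by linarith
  then have "G * eta * norm v \<le> G * eta * (norm (v - pgrad th) + grad_bound)"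
    using G_pos eta_pos by (intro mult_left_mono) auto
  also have "\<dots> \<le> 33/32 * d + d / 4" using e g by (simp add: distrib_left)
  also have "\<dots> = 41/32 * (1 - gm)" by (simp add: d_def field_simps)
  finally show ?thesis using eta_pos by (simp add: mult.assoc)
qed

text \<open>With the error weighted by \<open>c = eta / (2 * p)\<close>, a refresh, having
  probability \<open>p\<close>, removes on average \<open>c * p = eta / 2\<close> times the
  truncated error. That gain pays for the use of \<open>v\<close> in place of the gradient when the
  error is below \<open>Q\<close>, and for everything when it is above.\<close>

lemma potential_step:
  "integral\<^sup>L (step x) potential \<le> potential x - eta / 2 * (norm (pgrad (fst x)))\<^sup>2 + eta / 2 * (sigma\<^sup>2 / real N)"
proof -
  let ?th = "fst x" and ?v = "snd x" and ?th' = "next_th x"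
  define c where "c = eta / (2 * p)"
  define e where "e = (norm (?v - pgrad ?th))\<^sup>2"
  define g where "g = (norm (pgrad ?th))\<^sup>2"
  define I where "I = (\<integral>t. potential (update x t) \<partial>PiM {..<B} (\<lambda>_. tr ?th'))"
  have cp: "c * p = eta / 2" "c > 0" using p_pos eta_pos by (auto simp: c_def)
  have "integral\<^sup>L (step x) potential
      = p * (\<integral>t. potential (refresh N ?th' t) \<partial>PiM {..<N} (\<lambda>_. tr ?th')) + (1 - p) * I"
    unfolding I_def using potential_bounds by (intro integral_step[OF measurable_potential]) auto
  also have "\<dots> \<le> p * (Vsup - V ?th' + c * (sigma\<^sup>2 / real N)) + (1 - p) * I"
    unfolding c_def using p_pos by (intro add_right_mono mult_left_mono integral_potential_refresh_le) auto
  also have "\<dots> = p * (Vsup - V ?th') + (1 - p) * I + eta / 2 * (sigma\<^sup>2 / real N)"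
    unfolding cp(1)[symmetric] by (simp add: algebra_simps)
  also have "p * (Vsup - V ?th') + (1 - p) * I \<le> potential x - eta / 2 * g"
  proof (cases "e < Q")
    case True
    have small: "G * norm (eta *\<^sub>R ?v) \<le> 41/32 * (1 - gm)" using True unfolding e_def by (rule small_step)
    have "I \<le> Vsup - V ?th' + c * (e + 2 * lip\<^sup>2 * eta\<^sup>2 * (norm ?v)\<^sup>2 / real B)"
      unfolding I_def c_def e_def by (rule integral_potential_update_le(2)[OF small])
    then have "(1 - p) * I \<le> (1 - p) * (Vsup - V ?th' + c * (e + 2 * lip\<^sup>2 * eta\<^sup>2 * (norm ?v)\<^sup>2 / real B))"
      using p_le by (intro mult_left_mono) auto
    also have "\<dots> = (1 - p) * (Vsup - V ?th') + (1 - p) * c * e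
        + c / 2 * (((1 - p) * (4 * lip\<^sup>2 * eta\<^sup>2)) / real B * (norm ?v)\<^sup>2)"
      by (simp add: algebra_simps)
    \<comment> \<open>The batch condition limits the variance injected by the correction to
      \<open>eta / 4 * norm v ^ 2\<close>, which is what the ascent inequality leaves over
      below.\<close>
    also have "\<dots> \<le> (1 - p) * (Vsup - V ?th') + (1 - p) * c * e + c / 2 * (p * (norm ?v)\<^sup>2)"
      using eta_batch B_pos cp(2) by (intro add_left_mono mult_left_mono mult_right_mono) (auto simp: field_simps)
    also have "\<dots> = (1 - p) * (Vsup - V ?th') + c * e - eta / 2 * e + eta / 4 * (norm ?v)\<^sup>2"
    proof -
      have "(1 - p) * c * e = c * e - (c * p) * e" "c / 2 * (p * (norm ?v)\<^sup>2) = (c * p) / 2 * (norm ?v)\<^sup>2"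
        by (simp_all add: algebra_simps)
      then show ?thesis unfolding cp(1) by simp
    qed
    finally have I: "(1 - p) * I \<le> (1 - p) * (Vsup - V ?th') + c * e - eta / 2 * e + eta / 4 * (norm ?v)\<^sup>2" .
    have "41/32 * (1 - gm) \<le> 41/32" using gm by simp
    then have "G * norm (?th' - ?th) \<le> 41/32" using small by simp
    from V_ascent[OF this]
    have "V ?th + eta * (pgrad ?th \<bullet> ?v) - lip / 2 * (eta\<^sup>2 * (norm ?v)\<^sup>2) \<le> V ?th'"
      by (simp add: power_mult_distrib)
    \<comment> \<open>Polarisation. The term in \<open>norm v ^ 2\<close> covers both the curvature
      and the injected variance, a half each, and the term in \<open>e\<close> is cancelled by the
      refresh gain.\<close>
    moreover have "eta * (pgrad ?th \<bullet> ?v) = eta / 2 * g + eta / 2 * (norm ?v)\<^sup>2 - eta / 2 * e"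
      unfolding g_def e_def by (simp add: power2_norm_eq_inner inner_diff_left inner_diff_right inner_commute algebra_simps)
    moreover have "lip / 2 * (eta\<^sup>2 * (norm ?v)\<^sup>2) \<le> eta / 4 * (norm ?v)\<^sup>2"
    proof -
      have "eta * lip * (eta / 2 * (norm ?v)\<^sup>2) \<le> 1/2 * (eta / 2 * (norm ?v)\<^sup>2)"
        using eta_mult_lip_le eta_pos by (intro mult_right_mono) auto
      then show ?thesis by (simp add: power2_eq_square mult_ac)
    qed
    ultimately have "V ?th + eta / 2 * g + eta / 4 * (norm ?v)\<^sup>2 - eta / 2 * e \<le> V ?th'" by linarith
    moreover have "potential x = Vsup - V ?th + c * e"
      using True by (simp add: potential_def c_def e_def)
    moreover have "p * (Vsup - V ?th') + (1 - p) * (Vsup - V ?th') = Vsup - V ?th'" by (simp add: algebra_simps)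
    ultimately show ?thesis using I by linarith
  next
    case False
    \<comment> \<open>The step may be arbitrarily long here, so only global bounds are used. The
      gain \<open>eta / 2 * Q\<close> equals the largest possible drop of \<open>V\<close> plus
      \<open>eta / 2\<close> times the largest squared gradient.\<close>
    have "I \<le> Vsup - V ?th' + c * Q" unfolding I_def c_def by (rule integral_potential_update_le(1))
    then have "(1 - p) * I \<le> (1 - p) * (Vsup - V ?th' + c * Q)" using p_le by (intro mult_left_mono) auto
    also have "\<dots> = (1 - p) * (Vsup - V ?th') + c * Q - eta / 2 * Q"
      unfolding cp(1)[symmetric] by (simp add: algebra_simps)
    finally have I: "(1 - p) * I \<le> (1 - p) * (Vsup - V ?th') + c * Q - eta / 2 * Q" .
    have "V ?th - V ?th' \<le> 2 * R / (1 - gm)"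
      using abs_V_le[of ?th] abs_V_le[of ?th'] by (simp add: abs_le_iff)
    moreover have "g \<le> grad_bound\<^sup>2" unfolding g_def using norm_pgrad_le by (intro power_mono) auto
    then have "eta / 2 * g \<le> eta / 2 * grad_bound\<^sup>2" using eta_pos by (intro mult_left_mono) auto
    moreover have "eta / 2 * Q = eta / 2 * grad_bound\<^sup>2 + 2 * R / (1 - gm)"
      using eta_pos gm by (simp add: Q_def field_simps)
    moreover have "potential x = Vsup - V ?th + c * Q"
      using False by (simp add: potential_def c_def e_def)
    moreover have "p * (Vsup - V ?th') + (1 - p) * (Vsup - V ?th') = Vsup - V ?th'" by (simp add: algebra_simps)
    ultimately show ?thesis using I by linarith
  qed
  finally show ?thesis by (simp add: g_def)
qed

section \<open>Telescoping along the laws of the iterates\<close>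

abbreviation law :: "'d \<Rightarrow> nat \<Rightarrow> ('d \<times> 'd) measure" where
  "law \<equiv> page_law S A rho P r gm H pol eta p N B"

lemma law_0: "law th0 0 = distr (PiM {..<N} (\<lambda>_. tr th0)) borel (refresh N th0)"
  by (simp add: page_law_def page_init_eq)

lemma law_Suc: "law th0 (Suc t) = law th0 t \<bind> step"
  by (simp add: page_law_def)

lemma law_prob: "prob_space (law th0 t) \<and> sets (law th0 t) = sets borel"
proof (induction t)
  case 0
  show ?case unfolding law_0
    by (simp add: prob_space.prob_space_distr prob_space_PiM_tr measurable_refresh_tr)
next
  case (Suc t)
  then have k: "step \<in> law th0 t \<rightarrow>\<^sub>M subprob_algebra borel"
    using step_kernel by (simp add: measurable_cong_sets[of "law th0 t" borel])
  then show ?case unfolding law_Suc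
    using Suc prob_space.prob_space_bind[of "law th0 t" step borel] prob_space_step
      sets_bind[of "law th0 t" step borel] sets_kernel[OF k] prob_space.not_empty[of "law th0 t"] by auto
qed

lemma potential_law_Suc:
  "integral\<^sup>L (law th0 (Suc t)) potential
    \<le> integral\<^sup>L (law th0 t) potential - eta / 2 * (\<integral>x. (norm (pgrad (fst x)))\<^sup>2 \<partial>law th0 t) + eta / 2 * (sigma\<^sup>2 / real N)"
proof -
  have sl: "sets (law th0 t) = sets borel" using law_prob by blast
  then have spl: "space (law th0 t) = UNIV" using sets_eq_imp_space_eq by fastforce
  interpret L: prob_space "law th0 t" using law_prob by blast
  let ?C = "2 * R / (1 - gm) + eta / (2 * p) * Q"
  have k: "step \<in> law th0 t \<rightarrow>\<^sub>M subprob_algebra borel"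
    using step_kernel by (simp add: measurable_cong_sets[OF sl])
  have bd: "0 \<le> potential x \<and> potential x \<le> ?C" for x using potential_bounds by blast
  note b = integral_bind_bounded[OF L.prob_space_axioms k prob_space_step measurable_potential bd]
  have ip: "integrable (law th0 t) potential"
    using measurable_potential bd by (intro L.integrable_bounded[of _ ?C]) (auto simp: measurable_cong_sets[OF sl])
  have "(fst :: 'd \<times> 'd \<Rightarrow> 'd) \<in> borel \<rightarrow>\<^sub>M borel" by (simp add: borel_prod[symmetric])
  then have "(\<lambda>x :: 'd \<times> 'd. (norm (pgrad (fst x)))\<^sup>2) \<in> borel_measurable borel" by measurable
  then have ig: "integrable (law th0 t) (\<lambda>x. (norm (pgrad (fst x)))\<^sup>2)"
    using norm_pgrad_le by (intro L.integrable_bounded[of _ "grad_bound\<^sup>2"])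
      (auto simp: measurable_cong_sets[OF sl] intro!: power_mono)
  have ist: "integrable (law th0 t) (\<lambda>x. integral\<^sup>L (step x) potential)"
  proof (rule L.integrable_bounded[OF b(2), of ?C])
    fix x
    interpret s: prob_space "step x" by (rule prob_space_step)
    have "sets (step x) = sets borel" using sets_kernel[OF step_kernel, of x] by simp
    then have "integrable (step x) potential"
      using measurable_potential bd by (intro s.integrable_bounded[of _ ?C]) (auto simp: measurable_cong_sets[of "step x" borel])
    then have "integral\<^sup>L (step x) potential \<le> (\<integral>y. ?C \<partial>step x)" using bd by (intro integral_mono) auto
    moreover have "0 \<le> integral\<^sup>L (step x) potential" using bd by (intro integral_nonneg_AE) auto
    ultimately show "norm (integral\<^sup>L (step x) potential) \<le> ?C" using s.prob_space by simp
  qed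
  have "integral\<^sup>L (law th0 (Suc t)) potential = (\<integral>x. integral\<^sup>L (step x) potential \<partial>law th0 t)"
    unfolding law_Suc by (rule b(1))
  also have "\<dots> \<le> (\<integral>x. potential x - eta / 2 * (norm (pgrad (fst x)))\<^sup>2 + eta / 2 * (sigma\<^sup>2 / real N) \<partial>law th0 t)"
    using ist ip ig by (intro integral_mono potential_step) auto
  also have "\<dots> = integral\<^sup>L (law th0 t) potential - eta / 2 * (\<integral>x. (norm (pgrad (fst x)))\<^sup>2 \<partial>law th0 t)
      + eta / 2 * (sigma\<^sup>2 / real N)"
    using ip ig L.prob_space by simp
  finally show ?thesis .
qed

lemma potential_law_0: "integral\<^sup>L (law th0 0) potential \<le> Vsup - V th0 + eta / (2 * p) * (sigma\<^sup>2 / real N)"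
  unfolding law_0 using integral_potential_refresh_le[of th0]
  by (simp add: integral_distr[OF measurable_refresh_tr measurable_potential])

text \<open>Summing the one-step inequality and dividing by \<open>eta * T / 2\<close>: the initial
  potential contributes the terms with \<open>1 / T\<close>, its error part being the one with
  \<open>1 / p\<close>, and the noise of each step contributes \<open>sigma^2 / N\<close>.\<close>

lemma average_gradient_le:
  assumes "T \<ge> 1"
  shows "(1 / real T) * (\<Sum>t<T. \<integral>x. (norm (grad V (fst x)))\<^sup>2 \<partial>law th0 t)
    \<le> 2 * (Vsup - V th0) / (eta * real T) + sigma\<^sup>2 / real N + sigma\<^sup>2 / (p * real N * real T)"
proof -
  let ?g = "\<lambda>t. \<integral>x. (norm (grad V (fst x)))\<^sup>2 \<partial>law th0 t"
  have tel: "integral\<^sup>L (law th0 n) potential + eta / 2 * (\<Sum>t<n. ?g t)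
     \<le> Vsup - V th0 + eta / (2 * p) * (sigma\<^sup>2 / real N) + real n * (eta / 2 * (sigma\<^sup>2 / real N))" for n
  proof (induction n)
    case 0
    then show ?case using potential_law_0 by simp
  next
    case (Suc n)
    then show ?case using potential_law_Suc[of th0 n]
      unfolding grad_V sum.lessThan_Suc of_nat_Suc distrib_left distrib_right by linarith
  qed
  have "0 \<le> integral\<^sup>L (law th0 T) potential" using potential_bounds by (intro integral_nonneg_AE) auto
  with tel[of T] have "eta / 2 * (\<Sum>t<T. ?g t)
     \<le> Vsup - V th0 + eta / (2 * p) * (sigma\<^sup>2 / real N) + real T * (eta / 2 * (sigma\<^sup>2 / real N))" by linarith
  from mult_left_mono[OF this, of "2 / (eta * real T)"]
  have "2 / (eta * real T) * (eta / 2 * (\<Sum>t<T. ?g t))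
     \<le> 2 / (eta * real T) * (Vsup - V th0 + eta / (2 * p) * (sigma\<^sup>2 / real N) + real T * (eta / 2 * (sigma\<^sup>2 / real N)))"
    using eta_pos by simp
  also have "\<dots> = 2 * (Vsup - V th0) / (eta * real T) + sigma\<^sup>2 / real N + sigma\<^sup>2 / (p * real N * real T)"
    using eta_pos p_pos N_pos assms by (simp add: field_simps)
  also have "2 / (eta * real T) * (eta / 2 * (\<Sum>t<T. ?g t)) = (1 / real T) * (\<Sum>t<T. ?g t)"
    using eta_pos by simp
  finally show ?thesis .
qed

end

theorem theorem1:
  fixes S :: "'s measure" and A :: "'a measure"
    and rho :: "'s \<Rightarrow> real" and P :: "'s \<Rightarrow> 'a \<Rightarrow> 's \<Rightarrow> real"
    and r :: "'s \<Rightarrow> 'a \<Rightarrow> real" and R gm :: real and H :: nat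
    and pol :: "'d::euclidean_space \<Rightarrow> 's \<Rightarrow> 'a \<Rightarrow> real"
    and G M sigma W eta p :: real and N B T :: nat and th0 :: 'd
  assumes sfS: "sigma_finite_measure S" and sfA: "sigma_finite_measure A"
    and H_pos: "H \<ge> 1"
    and rho_meas: "rho \<in> borel_measurable S"
    and rho_nonneg: "\<forall>s\<in>space S. rho s \<ge> 0"
    and rho_int: "(\<integral>\<^sup>+ s. ennreal (rho s) \<partial>S) = 1"
    and P_meas: "(\<lambda>(s, a, s'). P s a s') \<in> borel_measurable (S \<Otimes>\<^sub>M A \<Otimes>\<^sub>M S)"
    and P_nonneg: "\<forall>s\<in>space S. \<forall>a\<in>space A. \<forall>s'\<in>space S. P s a s' \<ge> 0"
    and P_int: "\<forall>s\<in>space S. \<forall>a\<in>space A. (\<integral>\<^sup>+ s'. ennreal (P s a s') \<partial>S) = 1"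
    and r_meas: "(\<lambda>(s, a). r s a) \<in> borel_measurable (S \<Otimes>\<^sub>M A)"
    and R_pos: "R > 0"
    and r_bound: "\<forall>s\<in>space S. \<forall>a\<in>space A. \<bar>r s a\<bar> \<le> R"
    and gm: "0 < gm" "gm < 1"
    and pol_meas: "(\<lambda>(th, s, a). pol th s a) \<in> borel_measurable (borel \<Otimes>\<^sub>M S \<Otimes>\<^sub>M A)"
    and pol_pos: "\<forall>th. \<forall>s\<in>space S. \<forall>a\<in>space A. pol th s a > 0"
    and pol_int: "\<forall>th. \<forall>s\<in>space S. (\<integral>\<^sup>+ a. ennreal (pol th s a) \<partial>A) = 1"
    and pol_diff: "\<forall>th. \<forall>s\<in>space S. \<forall>a\<in>space A. (\<lambda>th'. pol th' s a) differentiable (at th)"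
    and pol_diff2: "\<forall>th. \<forall>s\<in>space S. \<forall>a\<in>space A.
                      grad (\<lambda>th'. pol th' s a) differentiable (at th)"
    and A1: "G > 0" "\<forall>th. \<forall>s\<in>space S. \<forall>a\<in>space A. norm (score pol th s a) \<le> G"
    and A2: "M > 0" "\<forall>th. \<forall>s\<in>space S. \<forall>a\<in>space A. hess_norm (\<lambda>th'. ln (pol th' s a)) th \<le> M"
    and A3: "sigma > 0"
      "\<forall>th. (\<integral>tau. (norm (gpomdp r gm H pol th tau - grad (Vf S A rho P r gm H pol) th))\<^sup>2
              \<partial>traj S A rho P H pol th) \<le> sigma\<^sup>2"
    and A4: "W > 0"
      "\<forall>tha thb. (\<integral>tau. (traj_iw rho P H pol thb tha tau
                   - (\<integral>tau'. traj_iw rho P H pol thb tha tau' \<partial>traj S A rho P H pol thb))\<^sup>2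
               \<partial>traj S A rho P H pol thb) \<le> W"
    and eta_pos: "eta > 0" and p_pos: "0 < p" and p_le: "p \<le> 1"
    and N_pos: "N \<ge> 1" and B_pos: "B \<ge> 1"
    and step1: "eta\<^sup>2 \<le> 1 / (4 * (M * R / (1 - gm)\<^sup>2 + 2 * G\<^sup>2 * R / (1 - gm) ^ 3)\<^sup>2)"
    and step2: "p < 1 \<Longrightarrow> eta\<^sup>2 \<le> p / (1 - p) * (real B /
                  (2 * (2 * ((M * R / (1 - gm)\<^sup>2 + 2 * G\<^sup>2 * R / (1 - gm) ^ 3)\<^sup>2
                         + 24 * R * G\<^sup>2 * (2 * G\<^sup>2 + M) * (W + 1) * gm / (1 - gm) ^ 5))))"
    and T_pos: "T \<ge> 1"
  shows "(1 / real T) * (\<Sum>t<T. (\<integral>x. (norm (grad (Vf S A rho P r gm H pol) (fst x)))\<^sup>2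
                                   \<partial>page_law S A rho P r gm H pol eta p N B th0 t))
         \<le> 2 * ((SUP th. Vf S A rho P r gm H pol th) - Vf S A rho P r gm H pol th0) / (eta * real T)
           + sigma\<^sup>2 / real N + sigma\<^sup>2 / (p * real N * real T)"
proof -
  interpret pg S A rho P r R gm H pol G M
    by (intro pg.intro mdp.intro pg_axioms.intro) fact+
  let ?K = "24 * R * G\<^sup>2 * (2 * G\<^sup>2 + M) * (W + 1) * gm / (1 - gm) ^ 5"
  have lip0: "lip > 0"
    unfolding lip_def using A2(1) R_pos gm by (intro add_pos_nonneg divide_pos_pos mult_pos_pos) auto
  interpret page S A rho P r R gm H pol G M eta p sigma N B
  proof
    show "(\<integral>t. (norm (gpomdp r gm H pol th t - pgrad th))\<^sup>2 \<partial>tr th) \<le> sigma\<^sup>2" for th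
      using A3(2) by (simp add: grad_V)
    show "eta\<^sup>2 \<le> 1 / (4 * lip\<^sup>2)" using step1 by (simp add: lip_def)
    show "(1 - p) * (4 * lip\<^sup>2 * eta\<^sup>2) \<le> p * real B"
    proof (cases "p < 1")
      case True
      have K: "?K \<ge> 0" using R_pos gm A1(1) A2(1) A4(1) by (intro divide_nonneg_nonneg mult_nonneg_nonneg) auto
      have "eta\<^sup>2 \<le> p / (1 - p) * (real B / (2 * (2 * (lip\<^sup>2 + ?K))))"
        using step2[OF True] by (simp only: lip_def)
      \<comment> \<open>The nonnegative summand \<open>?K\<close> is dropped from the denominator,
        which is the passage from \<open>C\<close> to \<open>2 * lip^2\<close>.\<close>
      also have "\<dots> \<le> p / (1 - p) * (real B / (4 * lip\<^sup>2))"
        using K lip0 p_pos True by (intro mult_left_mono divide_left_mono) (auto intro!: mult_pos_pos add_pos_nonneg)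
      finally have "(1 - p) * (4 * lip\<^sup>2) * eta\<^sup>2 \<le> (1 - p) * (4 * lip\<^sup>2) * (p / (1 - p) * (real B / (4 * lip\<^sup>2)))"
        using True by (intro mult_left_mono) auto
      also have "\<dots> = p * real B" using True lip0 by simp
      finally show ?thesis by (simp add: mult.assoc)
    next
      case False
      then show ?thesis using p_le p_pos by simp
    qed
  qed fact+
  show ?thesis using average_gradient_le[OF T_pos, of th0] by (simp only: Vsup_def)
qed

end
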